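(* Let $Y$ and $Z$ be two locally convex spaces over $\mathbf{R}$ and let $m$ be a cylindrical probability on $Y \times Z$ whose canonical image $m_1 = \pi_Y[m]$ on $Y$ (under the projection $\pi_Y : Y \times Z \to Y$) is countably additive. Let $(Y, \mathcal{B}, Q)$ be the complete probability space obtained by extending $m_1$ to a countably additive probability on the sigma-algebra generated by the cylinder sets of $Y$ and completing it. Then there exists a family $\{ m_y \}_{y \in Y}$ of cylindrical probabilities on $Z$ such that for every positive integer $n$, every continuous linear mapping $b : Z \to \mathbf{R}^n$ and every Borel set $E \subseteq \mathbf{R}^n$: (a) the function $y \mapsto b[m_y](E)$ is $\mathcal{B}$-measurable on $Y$; (b) for every $F \in \mathcal{B}$, $$ (I_Y \times b)[m](F \times E) \;=\; \int_F b[m_y](E) \, \mathrm{d}Q(y), $$ where $I_Y$ is the identity map of $Y$ and $(I_Y \times b)(y,z) = (y, b(z))$.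
   Context: All linear spaces are over the field $\mathbf{R}$ of reals. A probability is a nonnegative countably additive measure of total mass $1$ on a sigma-algebra. Cylinder sets: for a locally convex space $V$, a cylinder set of $V$ is a set of the form $u^{-1}(B)$, where $k$ is a positive integer, $u : V \to \mathbf{R}^k$ is a continuous linear mapping and $B \subseteq \mathbf{R}^k$ is a Borel set. The cylinder sets of $V$ form an algebra $\mathrm{Cyl}(V)$ of subsets of $V$. Cylindrical probability: a cylindrical probability on $V$ is a nonnegative finitely additive set function $\mu$ on $\mathrm{Cyl}(V)$ with $\mu(V) = 1$ such that for every positive integer $k$ and every continuous linear $u : V \to \mathbf{R}^k$ the set function $B \mapsto \mu(u^{-1}(B))$ is a countably additive (Borel) probability on $\mathbf{R}^k$. (Equivalently, it is a family of Borel probabilities $\mu_u$ on $\mathbf{R}^k$, indexed by all $k$ and all continuous linear $u : V \to \mathbf{R}^k$, such that $\mu_{v \circ u}$ is the image of $\mu_u$ under $v$ for every linear $v : \mathbf{R}^k \to \mathbf{R}^l$.) In general $\mu$ need not be countably additive on $\mathrm{Cyl}(V)$. "$\mu$ is countably additive" means that it is countably additive on the algebra $\mathrm{Cyl}(V)$; it then extends uniquely to a probability on the sigma-algebra generated by $\mathrm{Cyl}(V)$. Images: if $\mu$ is a cylindrical probability on $V$ and $T : V \to W$ is a continuous linear mapping into a locally convex space $W$, then $T[\mu]$ is the cylindrical probability on $W$ given by $T[\mu](C) = \mu(T^{-1}(C))$ for $C \in \mathrm{Cyl}(W)$. In particular, for a cylindrical probability $\mu$ on $Z$ and continuous linear $b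 : Z \to \mathbf{R}^n$, $b[\mu]$ is the Borel probability $E \mapsto \mu(b^{-1}(E))$ on $\mathbf{R}^n$. Meaning of the left-hand side of (b): $(I_Y \times b)[m]$ is a cylindrical probability on $Y \times \mathbf{R}^n$. Under the assumption that $m_1$ is countably additive, it has a unique extension to a countably additive probability on the product sigma-algebra of $\mathcal{B}$ and the Borel sigma-algebra of $\mathbf{R}^n$ (the smallest sigma-algebra on $Y \times \mathbf{R}^n$ making both coordinate projections measurable). This extension is denoted by the same symbol $(I_Y \times b)[m]$, and its image under the projection to $Y$ is $Q$. *)

theory Defs
  imports "HOL-Analysis.Analysis" "HOL-Library.Function_Algebras"
begin

text \<open>
  Locally convex spaces are not assumed to be Hausdorff.  Convexity of \<open>C\<close> is spelled out because
  the constant \<open>convex\<close> cannot be used inside the class specification.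
\<close>

class locally_convex_space = real_vector + topological_space +
  assumes tendsto_plus_Pair:
    "LIM p (nhds x \<times>\<^sub>F nhds y). fst p + snd p :> nhds (x + y)"
  assumes tendsto_scaleR_Pair:
    "LIM p (nhds c \<times>\<^sub>F nhds x). fst p *\<^sub>R snd p :> nhds (c *\<^sub>R x)"
  assumes convex_nhds_zero:
    "open U \<Longrightarrow> 0 \<in> U \<Longrightarrow> \<exists>C.
      (\<forall>x\<in>C. \<forall>y\<in>C. \<forall>t. 0 \<le> t \<and> t \<le> 1 \<longrightarrow> (1 - t) *\<^sub>R x + t *\<^sub>R y \<in> C) \<and>
      C \<subseteq> U \<and> eventually (\<lambda>x. x \<in> C) (nhds 0)"

instance real_normed_vector \<subseteq> locally_convex_space
proof
  fix x y :: 'a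
  show "LIM p (nhds x \<times>\<^sub>F nhds y). fst p + snd p :> nhds (x + y)"
    by (rule tendsto_add_Pair)
next
  fix c :: real and x :: 'a
  show "LIM p (nhds c \<times>\<^sub>F nhds x). fst p *\<^sub>R snd p :> nhds (c *\<^sub>R x)"
    by (intro tendsto_scaleR filterlim_fst filterlim_snd)
next
  fix U :: "'a set"
  assume "open U" "0 \<in> U"
  then obtain e where e: "e > 0" "ball 0 e \<subseteq> U"
    using open_contains_ball by blast
  then have "eventually (\<lambda>x. x \<in> ball 0 e) (nhds (0::'a))"
    by (intro eventually_nhds_in_open) auto
  then show "\<exists>C. (\<forall>x\<in>C. \<forall>y\<in>C. \<forall>t. 0 \<le> t \<and> t \<le> 1 \<longrightarrow> (1 - t) *\<^sub>R x + t *\<^sub>R y \<in> C) \<and>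
      C \<subseteq> U \<and> eventually (\<lambda>x. x \<in> C) (nhds 0)"
    unfolding convex_alt[symmetric] using e convex_ball by blast
qed

instance prod :: (locally_convex_space, locally_convex_space) locally_convex_space
proof
  fix x y :: "'a \<times> 'b"
  have *: "((\<lambda>p. f (fst p) + f (snd p)) \<longlongrightarrow> f x + f y) (nhds x \<times>\<^sub>F nhds y)"
    if "\<And>z. (f \<longlongrightarrow> f z) (nhds z)" for f :: "'a \<times> 'b \<Rightarrow> 'c::locally_convex_space"
  proof -
    have "LIM p (nhds x \<times>\<^sub>F nhds y). (f (fst p), f (snd p)) :> nhds (f x) \<times>\<^sub>F nhds (f y)"
      by (intro filterlim_Pair filterlim_compose[OF that filterlim_fst]
          filterlim_compose[OF that filterlim_snd])
    from filterlim_compose[OF tendsto_plus_Pair this] show ?thesis by simp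
  qed
  show "LIM p (nhds x \<times>\<^sub>F nhds y). fst p + snd p :> nhds (x + y)"
    unfolding plus_prod_def
    by (intro tendsto_Pair * tendsto_fst tendsto_snd filterlim_ident)
next
  fix c :: real and x :: "'a \<times> 'b"
  have *: "((\<lambda>p. fst p *\<^sub>R f (snd p)) \<longlongrightarrow> c *\<^sub>R f x) (nhds c \<times>\<^sub>F nhds x)"
    if "(f \<longlongrightarrow> f x) (nhds x)" for f :: "'a \<times> 'b \<Rightarrow> 'c::locally_convex_space"
  proof -
    have "LIM p (nhds c \<times>\<^sub>F nhds x). (fst p, f (snd p)) :> nhds c \<times>\<^sub>F nhds (f x)"
      by (intro filterlim_Pair filterlim_fst filterlim_compose[OF that filterlim_snd])
    from filterlim_compose[OF tendsto_scaleR_Pair this] show ?thesis by simp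
  qed
  show "LIM p (nhds c \<times>\<^sub>F nhds x). fst p *\<^sub>R snd p :> nhds (c *\<^sub>R x)"
    unfolding scaleR_prod_def
    by (intro tendsto_Pair * tendsto_fst tendsto_snd filterlim_ident)
next
  fix U :: "('a \<times> 'b) set"
  assume "open U" "0 \<in> U"
  then obtain A B where AB: "open A" "open B" "0 \<in> A" "0 \<in> B" "A \<times> B \<subseteq> U"
    by (metis mem_Sigma_iff open_prod_elim zero_prod_def)
  obtain C where C: "convex C" "C \<subseteq> A" "eventually (\<lambda>x. x \<in> C) (nhds 0)"
    using convex_nhds_zero[folded convex_alt] AB by blast
  obtain D where D: "convex D" "D \<subseteq> B" "eventually (\<lambda>x. x \<in> D) (nhds 0)"
    using convex_nhds_zero[folded convex_alt] AB by blast
  have "eventually (\<lambda>x. x \<in> C \<times> D) (nhds (0::'a) \<times>\<^sub>F nhds (0::'b))"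
    unfolding eventually_prod_filter using C D by auto
  then have "eventually (\<lambda>x. x \<in> C \<times> D) (nhds 0)"
    by (simp add: zero_prod_def nhds_prod)
  moreover have "convex (C \<times> D)" using C D by (intro convex_Times)
  ultimately show "\<exists>C. (\<forall>x\<in>C. \<forall>y\<in>C. \<forall>t. 0 \<le> t \<and> t \<le> 1 \<longrightarrow> (1 - t) *\<^sub>R x + t *\<^sub>R y \<in> C) \<and>
      C \<subseteq> U \<and> eventually (\<lambda>x. x \<in> C) (nhds 0)"
    unfolding convex_alt[symmetric] using AB C D by blast
qed

instantiation "fun" :: (type, real_vector) real_vector
begin

definition scaleR_fun :: "real \<Rightarrow> ('a \<Rightarrow> 'b) \<Rightarrow> 'a \<Rightarrow> 'b" where
  "scaleR_fun c f = (\<lambda>i. c *\<^sub>R f i)"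

instance
  by standard (auto simp: scaleR_fun_def fun_eq_iff scaleR_add_right scaleR_add_left)

end

text \<open>
  Since the dimension \<open>k\<close> is quantified inside the statement, \<open>\<real>\<^sup>k\<close> is the linear subspace of
  \<open>nat \<Rightarrow> real\<close> of all sequences vanishing from index \<open>k\<close> on.  Its Euclidean topology is the
  restriction of the product topology, so its Borel sets are the traces of the Borel sets of
  \<open>nat \<Rightarrow> real\<close>.  Accordingly the notions below are stated for a linear subspace \<open>V\<close> of a type;
  this is needed for \<open>V = Y \<times> \<real>\<^sup>n\<close>, while the spaces \<open>Y\<close>, \<open>Z\<close> and \<open>Y \<times> Z\<close> are full types.
\<close>

definition Rn :: "nat \<Rightarrow> (nat \<Rightarrow> real) set" where
  "Rn k = topspace (Euclidean_space k)"

definition borel_Rn :: "nat \<Rightarrow> (nat \<Rightarrow> real) measure" where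
  "borel_Rn k = restrict_space borel (Rn k)"

definition continuous_linear_on ::
  "'a::{real_vector,topological_space} set \<Rightarrow> 'b::{real_vector,topological_space} set
    \<Rightarrow> ('a \<Rightarrow> 'b) \<Rightarrow> bool" where
  "continuous_linear_on V W u \<longleftrightarrow>
     u ` V \<subseteq> W \<and> continuous_on V u \<and>
     (\<forall>x\<in>V. \<forall>y\<in>V. u (x + y) = u x + u y) \<and>
     (\<forall>c. \<forall>x\<in>V. u (c *\<^sub>R x) = c *\<^sub>R u x)"

definition cylinder_sets :: "'a::{real_vector,topological_space} set \<Rightarrow> 'a set set" where
  "cylinder_sets V =
     {u -` B \<inter> V | k u B. k > 0 \<and> continuous_linear_on V (Rn k) u \<and> B \<in> sets (borel_Rn k)}"

text \<open>
  Set functions are total and \<open>ennreal\<close>-valued; only their values on cylinder sets are meaningful.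
  Nonnegativity is thus built into the type.
\<close>

definition image_set_function ::
  "'a set \<Rightarrow> ('a \<Rightarrow> 'b) \<Rightarrow> ('a set \<Rightarrow> ennreal) \<Rightarrow> 'b set \<Rightarrow> ennreal" where
  "image_set_function V T \<mu> C = \<mu> (T -` C \<inter> V)"

definition cylindrical_probability ::
  "'a::{real_vector,topological_space} set \<Rightarrow> ('a set \<Rightarrow> ennreal) \<Rightarrow> bool" where
  "cylindrical_probability V \<mu> \<longleftrightarrow>
     additive (cylinder_sets V) \<mu> \<and> \<mu> V = 1 \<and>
     (\<forall>k>0. \<forall>u. continuous_linear_on V (Rn k) u \<longrightarrow>
        countably_additive (sets (borel_Rn k)) (image_set_function V u \<mu>))"

text \<open>
  The measure on the sigma-algebra of \<open>N\<close> that extends the set function \<open>\<mu>\<close> given on \<open>\<A>\<close>;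
  the description is unspecified unless exactly one such measure exists.
\<close>

definition measure_extension ::
  "'a measure \<Rightarrow> 'a set set \<Rightarrow> ('a set \<Rightarrow> ennreal) \<Rightarrow> 'a measure" where
  "measure_extension N \<A> \<mu> =
     (THE M. sets M = sets N \<and> (\<forall>C\<in>\<A>. emeasure M C = \<mu> C))"

definition completed_extension ::
  "('a::{real_vector,topological_space} set \<Rightarrow> ennreal) \<Rightarrow> 'a measure" where
  "completed_extension \<mu> =
     completion (measure_extension (sigma UNIV (cylinder_sets UNIV)) (cylinder_sets UNIV) \<mu>)"

definition joint_extension ::
  "'y::{real_vector,topological_space} measure \<Rightarrow> nat
    \<Rightarrow> (('y \<times> (nat \<Rightarrow> real)) set \<Rightarrow> ennreal) \<Rightarrow> ('y \<times> (nat \<Rightarrow> real)) measure" where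
  "joint_extension Q n \<mu> =
     measure_extension (Q \<Otimes>\<^sub>M borel_Rn n) (cylinder_sets (UNIV \<times> Rn n)) \<mu>"

end

theory Submission
  imports Defs "HOL-Probability.Probability"
begin

text \<open>
  For one continuous linear map \<open>b\<close> into \<open>\<real>\<^sup>n\<close>, the measures \<open>b[m\<^sub>y]\<close> are regular conditional laws,
  which are determined up to a null set of points \<open>y\<close> only.  The difficulty is that uncountably
  many such laws must fit together into a cylindrical probability for every single \<open>y\<close>, so null sets
  depending on \<open>b\<close> cannot be discarded.

  The first idea is to remove all linear relations.  Let \<open>H\<close> be a Hamel basis of the dual of \<open>Z\<close>.
  Finitely many elements of \<open>H\<close> map \<open>Z\<close> onto a full coordinate space, and every continuous linear map
  into \<open>\<real>\<^sup>n\<close> is a linear function of finitely many elements of \<open>H\<close>.  Hence every probability on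
  the product \<open>\<real>\<^sup>H\<close> induces a cylindrical probability on \<open>Z\<close>
  (\<open>cylindrical_probability_cylinder_lift\<close>), and it suffices to find a Markov kernel from \<open>Y\<close> to
  \<open>\<real>\<^sup>H\<close> with the right finite-dimensional joint laws.

  The second idea is to build this kernel one coordinate at a time.  Suppose that it is known on
  \<open>\<real>\<^sup>S\<close> for some \<open>S \<subseteq> H\<close>.  Together with \<open>Q\<close> it gives a probability \<open>P\<close> on \<open>Y \<times> \<real>\<^sup>S\<close>, and a further
  functional \<open>h\<close> has a regular conditional law given the whole pair of \<open>y\<close> and the coordinates in \<open>S\<close>
  (\<open>conditional_kernel\<close>).  Composing the two kernels gives a kernel to the product over \<open>S \<union> {h}\<close>
  whose marginal on \<open>\<real>\<^sup>S\<close> is unchanged for \<^emph>\<open>every\<close> \<open>y\<close> (\<open>extend_by_coordinate\<close>).  So exceptional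
  sets never accumulate: the null sets met when a conditional law is chosen only affect the new coordinate.
  Zorn's lemma, applied to consistent families of finite-dimensional kernels, reaches all of \<open>H\<close>
  (\<open>exists_disintegration\<close>).  The families, rather than kernels to infinite products, are ordered by
  extension because a union of a chain of families is a family; Kolmogorov's theorem turns a family
  into a kernel (\<open>kolmogorov_kernel\<close>).

  The same finite-dimensional joint laws (\<open>joint_law\<close>) show that the composition of \<open>Q\<close> with
  \<open>y \<mapsto> b[m\<^sub>y]\<close> extends the cylindrical probability \<open>(I\<^sub>Y \<times> b)[m]\<close>.  Such an extension is unique
  (\<open>joint_extension_unique\<close>), and this gives the integral formula.
\<close>

section \<open>Cylinder sets as a directed union of sigma-algebras\<close>

abbreviation borel_PiM :: "'i set \<Rightarrow> ('i \<Rightarrow> real) measure" where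
  "borel_PiM J \<equiv> Pi\<^sub>M J (\<lambda>_. borel)"

text \<open>
  The continuous linear functionals.  They are kept as plain functions, so that linear
  independence and span refer to the pointwise vector space structure.
\<close>

definition dual :: "('a::{real_vector,topological_space} \<Rightarrow> real) set" where
  "dual = {f. continuous_linear_on UNIV UNIV f}"

definition coords :: "('a \<Rightarrow> real) set \<Rightarrow> 'a \<Rightarrow> ('a \<Rightarrow> real) \<Rightarrow> real" where
  "coords J x = (\<lambda>f\<in>J. f x)"

text \<open>
  The sigma-algebra generated by the functionals in \<open>J\<close>, written as a preimage so that each of its
  members comes with a Borel set in the coordinate space.
\<close>

definition coord_algebra :: "('a \<Rightarrow> real) set \<Rightarrow> 'a measure" where
  "coord_algebra J = vimage_algebra UNIV (coords J) (borel_PiM J)"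

lemma coords_in_space: "coords J x \<in> space (borel_PiM J)"
  by (auto simp: coords_def space_PiM)

lemma space_coord_algebra [simp]: "space (coord_algebra J) = UNIV"
  by (simp add: coord_algebra_def)

lemma sets_coord_algebra:
  "sets (coord_algebra J) = {coords J -` A |A. A \<in> sets (borel_PiM J)}"
  unfolding coord_algebra_def by (subst sets_vimage_algebra2) (auto simp: coords_in_space)

lemma coord_algebraE:
  assumes "C \<in> sets (coord_algebra J)"
  obtains A where "A \<in> sets (borel_PiM J)" "C = coords J -` A"
  using assms by (auto simp: sets_coord_algebra)

lemma measurable_coords: "coords J \<in> coord_algebra J \<rightarrow>\<^sub>M borel_PiM J"
  unfolding coord_algebra_def by (rule measurable_vimage_algebra1) (auto simp: coords_in_space)

lemma measurable_coord: "f \<in> J \<Longrightarrow> f \<in> borel_measurable (coord_algebra J)"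
  using measurable_compose[OF measurable_coords measurable_component_singleton, of f J]
  by (simp add: coords_def)

lemma sets_coord_algebra_le:
  assumes "space M = UNIV" "\<And>f. f \<in> J \<Longrightarrow> f \<in> borel_measurable M"
  shows "sets (coord_algebra J) \<subseteq> sets M"
proof -
  have "coords J \<in> M \<rightarrow>\<^sub>M borel_PiM J"
    unfolding coords_def using assms(2) by (intro measurable_restrict) auto
  from measurable_sets[OF this] show ?thesis
    using assms(1) by (auto simp: sets_coord_algebra)
qed

lemma sets_coord_algebra_mono: "J \<subseteq> K \<Longrightarrow> sets (coord_algebra J) \<subseteq> sets (coord_algebra K)"
  by (intro sets_coord_algebra_le measurable_coord) auto

lemma Rn_iff: "x \<in> Rn k \<longleftrightarrow> (\<forall>i\<ge>k. x i = 0)"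
  by (simp add: Rn_def topspace_Euclidean_space)

lemma space_borel_Rn [simp]: "space (borel_Rn k) = Rn k"
  by (simp add: borel_Rn_def space_restrict_space)

lemma measurable_borel_Rn_iff:
  "f \<in> M \<rightarrow>\<^sub>M borel_Rn k \<longleftrightarrow>
    (\<forall>x\<in>space M. f x \<in> Rn k) \<and> (\<forall>i. (\<lambda>x. f x i) \<in> borel_measurable M)"
proof -
  have "f \<in> borel_measurable M \<longleftrightarrow> (\<forall>i. (\<lambda>x. f x i) \<in> borel_measurable M)"
    by (auto intro: measurable_coordinatewise_then_product
        measurable_compose[OF _ measurable_product_coordinates])
  then show ?thesis
    by (auto simp: borel_Rn_def measurable_restrict_space2_iff Pi_iff)
qed

lemma borel_measurable_component_Rn: "(\<lambda>w. w i) \<in> borel_measurable (borel_Rn k)"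
  using measurable_borel_Rn_iff[of "\<lambda>x. x" "borel_Rn k" k] by simp

lemma continuous_linear_on_Rn_iff:
  "continuous_linear_on UNIV (Rn k) u \<longleftrightarrow> (\<forall>x. u x \<in> Rn k) \<and> (\<forall>i. (\<lambda>x. u x i) \<in> dual)"
proof -
  have "continuous_on UNIV u \<longleftrightarrow> (\<forall>i. continuous_on UNIV (\<lambda>x. u x i))"
    by (auto intro: continuous_on_coordinatewise_then_product
        continuous_on_product_then_coordinatewise)
  then show ?thesis
    by (auto simp: continuous_linear_on_def dual_def fun_eq_iff scaleR_fun_def)
qed

lemma continuous_linear_on_measurable:
  assumes "continuous_linear_on UNIV (Rn k) u"
  shows "u \<in> coord_algebra ((\<lambda>i x. u x i) ` {..<k}) \<rightarrow>\<^sub>M borel_Rn k"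
  unfolding measurable_borel_Rn_iff
proof (intro conjI ballI allI)
  fix i
  show "(\<lambda>x. u x i) \<in> borel_measurable (coord_algebra ((\<lambda>i x. u x i) ` {..<k}))"
  proof (cases "i < k")
    case False
    then have "(\<lambda>x. u x i) = (\<lambda>_. 0)"
      using assms by (auto simp: continuous_linear_on_Rn_iff Rn_iff)
    then show ?thesis by simp
  qed (auto intro: measurable_coord)
qed (use assms in \<open>auto simp: continuous_linear_on_Rn_iff\<close>)

text \<open>
  Cylinder sets are defined by maps into \<open>\<real>\<^sup>k\<close> with \<open>k > 0\<close>, whereas a finite set of functionals
  carries no order and may be empty.  An enumeration of \<open>J\<close>, padded with one zero coordinate,
  translates between the two.
\<close>

lemma coords_factor_through_Rn:
  assumes "finite J" "J \<subseteq> dual"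
  obtains k u \<phi> where "k > 0" "continuous_linear_on UNIV (Rn k) u"
    "\<phi> \<in> borel_Rn k \<rightarrow>\<^sub>M borel_PiM J" "coords J = \<phi> \<circ> u"
proof -
  obtain e where e: "bij_betw e {..<card J} J"
    using assms(1) by (metis ex_bij_betw_nat_finite atLeast0LessThan)
  define u where "u = (\<lambda>x i. if i < card J then e i x else 0)"
  define g where "g = inv_into {..<card J} e"
  define \<phi> where "\<phi> = (\<lambda>w::nat \<Rightarrow> real. \<lambda>f\<in>J. w (g f))"
  have g: "g f < card J" "e (g f) = f" if "f \<in> J" for f
    using that e bij_betwE[OF bij_betw_inv_into[OF e]] bij_betw_inv_into_right[OF e]
    by (auto simp: g_def)
  have 0: "(\<lambda>_. 0) \<in> (dual :: ('a \<Rightarrow> real) set)"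
    by (auto simp: dual_def continuous_linear_on_def)
  have eJ: "e i \<in> dual" if "i < card J" for i
    using that e assms(2) by (auto simp: bij_betw_def)
  show thesis
  proof (rule that)
    show "Suc (card J) > 0" by simp
    have "(\<lambda>x. u x i) \<in> dual" for i
      using 0 eJ[of i] by (cases "i < card J") (auto simp: u_def)
    then show "continuous_linear_on UNIV (Rn (Suc (card J))) u"
      unfolding continuous_linear_on_Rn_iff by (auto simp: u_def Rn_iff)
    show "\<phi> \<in> borel_Rn (Suc (card J)) \<rightarrow>\<^sub>M borel_PiM J"
      unfolding \<phi>_def by (intro measurable_restrict borel_measurable_component_Rn)
    show "coords J = \<phi> \<circ> u"
      by (auto simp: fun_eq_iff coords_def \<phi>_def u_def g)
  qed
qed

text \<open>
  Indexing by finite sets of functionals instead of maps into \<open>\<real>\<^sup>k\<close> makes the family directed: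
  two cylinder sets live over the union of their index sets.
\<close>

lemma cylinder_sets_eq_Union_coord_algebra:
  "cylinder_sets UNIV = (\<Union>J\<in>{J. finite J \<and> J \<subseteq> dual}. sets (coord_algebra J))"
proof (intro set_eqI iffI)
  fix C :: "'a set" assume "C \<in> cylinder_sets UNIV"
  then obtain k u B where *: "continuous_linear_on UNIV (Rn k) u" "B \<in> sets (borel_Rn k)" "C = u -` B"
    by (auto simp: cylinder_sets_def)
  let ?J = "(\<lambda>i x. u x i) ` {..<k}"
  have "C \<in> sets (coord_algebra ?J)"
    using measurable_sets[OF continuous_linear_on_measurable[OF *(1)] *(2)] *(3) by simp
  moreover have "finite ?J" "?J \<subseteq> dual"
    using *(1) by (auto simp: continuous_linear_on_Rn_iff)
  ultimately show "C \<in> (\<Union>J\<in>{J. finite J \<and> J \<subseteq> dual}. sets (coord_algebra J))"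
    by blast
next
  fix C :: "'a set" assume "C \<in> (\<Union>J\<in>{J. finite J \<and> J \<subseteq> dual}. sets (coord_algebra J))"
  then obtain J A where J: "finite J" "J \<subseteq> dual" "A \<in> sets (borel_PiM J)" "C = coords J -` A"
    by (auto simp: sets_coord_algebra)
  obtain k u \<phi> where *: "k > 0" "continuous_linear_on UNIV (Rn k) u"
    "\<phi> \<in> borel_Rn k \<rightarrow>\<^sub>M borel_PiM J" "coords J = \<phi> \<circ> u"
    using coords_factor_through_Rn[OF J(1,2)] .
  have "C = u -` (\<phi> -` A \<inter> Rn k)"
    using *(2) unfolding J(4) *(4) by (auto simp: continuous_linear_on_Rn_iff)
  then show "C \<in> cylinder_sets UNIV"
    unfolding cylinder_sets_def mem_Collect_eq
    using *(1,2) measurable_sets[OF *(3) J(3)]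
    by (intro exI[of _ k] exI[of _ u] exI[of _ "\<phi> -` A \<inter> Rn k"]) simp
qed

lemma coord_algebra_subset_cylinder_sets:
  "finite J \<Longrightarrow> J \<subseteq> dual \<Longrightarrow> sets (coord_algebra J) \<subseteq> cylinder_sets UNIV"
  by (auto simp: cylinder_sets_eq_Union_coord_algebra)

lemma cylinder_setE:
  assumes "C \<in> cylinder_sets UNIV"
  obtains J where "finite J" "J \<subseteq> dual" "C \<in> sets (coord_algebra J)"
  using assms by (auto simp: cylinder_sets_eq_Union_coord_algebra)

lemma algebra_directed_Union:
  assumes "\<I> \<noteq> {}" and sp: "\<And>i. i \<in> \<I> \<Longrightarrow> space (V i) = \<Omega>"
    and dir: "\<And>i j. i \<in> \<I> \<Longrightarrow> j \<in> \<I> \<Longrightarrow>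
      \<exists>k\<in>\<I>. sets (V i) \<subseteq> sets (V k) \<and> sets (V j) \<subseteq> sets (V k)"
  shows "algebra \<Omega> (\<Union>i\<in>\<I>. sets (V i))"
  unfolding algebra_iff_Un
proof (intro conjI ballI)
  show "(\<Union>i\<in>\<I>. sets (V i)) \<subseteq> Pow \<Omega>"
    using sets.sets_into_space sp by fastforce
  show "{} \<in> (\<Union>i\<in>\<I>. sets (V i))" using assms(1) by auto
next
  fix A assume "A \<in> (\<Union>i\<in>\<I>. sets (V i))"
  then show "\<Omega> - A \<in> (\<Union>i\<in>\<I>. sets (V i))"
    using sp sets.compl_sets by fastforce
next
  fix A B assume "A \<in> (\<Union>i\<in>\<I>. sets (V i))" "B \<in> (\<Union>i\<in>\<I>. sets (V i))"
  then obtain i j where ij: "i \<in> \<I>" "A \<in> sets (V i)" "j \<in> \<I>" "B \<in> sets (V j)" by blast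
  from dir[OF ij(1,3)] obtain k where "k \<in> \<I>" "sets (V i) \<subseteq> sets (V k)" "sets (V j) \<subseteq> sets (V k)"
    by blast
  with ij show "A \<union> B \<in> (\<Union>i\<in>\<I>. sets (V i))" by blast
qed

lemma algebra_cylinder_sets: "algebra UNIV (cylinder_sets UNIV)"
  unfolding cylinder_sets_eq_Union_coord_algebra
proof (rule algebra_directed_Union)
  fix I J :: "('a \<Rightarrow> real) set"
  assume "I \<in> {J. finite J \<and> J \<subseteq> dual}" "J \<in> {J. finite J \<and> J \<subseteq> dual}"
  then show "\<exists>L\<in>{J. finite J \<and> J \<subseteq> dual}.
      sets (coord_algebra I) \<subseteq> sets (coord_algebra L) \<and> sets (coord_algebra J) \<subseteq> sets (coord_algebra L)"
    by (intro bexI[of _ "I \<union> J"] conjI sets_coord_algebra_mono) auto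
qed auto

text \<open>
  On a fixed finite set of functionals, a cylindrical probability is an honest measure.
\<close>

definition coord_measure :: "('a set \<Rightarrow> ennreal) \<Rightarrow> ('a \<Rightarrow> real) set \<Rightarrow> 'a measure" where
  "coord_measure \<mu> J = measure_of UNIV (sets (coord_algebra J)) \<mu>"

lemma sets_coord_measure [simp]: "sets (coord_measure \<mu> J) = sets (coord_algebra J)"
  using sets.sigma_sets_eq[of "coord_algebra J"] by (simp add: coord_measure_def)

lemma space_coord_measure [simp]: "space (coord_measure \<mu> J) = UNIV"
  by (simp add: coord_measure_def)

text \<open>
  Additivity alone would allow the value \<open>\<infinity>\<close>; the total mass excludes it.
\<close>

lemma cylindrical_probability_empty:
  assumes "cylindrical_probability UNIV \<mu>"
  shows "\<mu> {} = 0"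
proof -
  have e: "{} \<in> cylinder_sets (UNIV :: 'a set)"
    by (meson algebra_cylinder_sets algebra_iff_Un)
  have u: "UNIV \<in> cylinder_sets (UNIV :: 'a set)"
    using algebra.top[OF algebra_cylinder_sets] .
  have "\<mu> (UNIV \<union> {}) = \<mu> UNIV + \<mu> {}"
    using assms e u unfolding cylindrical_probability_def additive_def by blast
  then have "1 = 1 + \<mu> {}"
    using assms by (simp add: cylindrical_probability_def)
  then show ?thesis
    by (metis add.right_neutral ennreal_add_left_cancel ennreal_one_neq_top infinity_ennreal_def)
qed

text \<open>
  A disjoint sequence in the preimage sigma-algebra need not come from disjoint Borel sets.
  Making the Borel sets disjoint does not change their preimages.
\<close>

lemma countably_additive_coord_algebra:
  assumes \<mu>: "cylindrical_probability UNIV \<mu>" and J: "finite J" "J \<subseteq> dual"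
  shows "countably_additive (sets (coord_algebra J)) \<mu>"
proof (rule countably_additiveI)
  fix C :: "nat \<Rightarrow> 'a set"
  assume C: "range C \<subseteq> sets (coord_algebra J)" "disjoint_family C"
  obtain k u \<phi> where *: "k > 0" "continuous_linear_on UNIV (Rn k) u"
    "\<phi> \<in> borel_Rn k \<rightarrow>\<^sub>M borel_PiM J" "coords J = \<phi> \<circ> u"
    using coords_factor_through_Rn[OF J] .
  have "\<exists>A. A \<in> sets (borel_PiM J) \<and> C i = coords J -` A" for i
  proof -
    have "C i \<in> sets (coord_algebra J)" using C(1) by (rule range_subsetD)
    then show ?thesis by (rule coord_algebraE) (intro exI conjI)
  qed
  then obtain A where A: "\<And>i. A i \<in> sets (borel_PiM J)" "\<And>i. C i = coords J -` A i"
    by metis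
  define B where "B = (\<lambda>i. \<phi> -` A i \<inter> Rn k)"
  have B: "B i \<in> sets (borel_Rn k)" for i
    using measurable_sets[OF *(3) A(1)] by (simp add: B_def)
  have uB: "u -` B i = C i" for i
    using *(2) unfolding A(2) *(4) by (auto simp: continuous_linear_on_Rn_iff B_def)
  have dC: "u -` disjointed B i = C i" for i
  proof -
    have "u -` disjointed B i = C i - (\<Union>j<i. C j)"
      by (simp add: disjointed_def vimage_Diff vimage_UN uB atLeast0LessThan)
    also have "\<dots> = C i"
    proof -
      have "C i \<inter> C j = {}" if "j < i" for j
        using C(2) that by (simp add: disjoint_family_on_def)
      then show ?thesis by blast
    qed
    finally show ?thesis .
  qed
  have "countably_additive (sets (borel_Rn k)) (image_set_function UNIV u \<mu>)"
    using \<mu> *(1,2) by (auto simp: cylindrical_probability_def)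
  then have "(\<Sum>i. image_set_function UNIV u \<mu> (disjointed B i)) =
      image_set_function UNIV u \<mu> (\<Union>i. disjointed B i)"
    unfolding countably_additive_def
    using B disjoint_family_disjointed[of B] sets.range_disjointed_sets[of B "borel_Rn k"]
    by blast
  then show "(\<Sum>i. \<mu> (C i)) = \<mu> (\<Union>i. C i)"
    by (simp add: image_set_function_def dC vimage_UN)
qed

lemma emeasure_coord_measure:
  assumes "cylindrical_probability UNIV \<mu>" "finite J" "J \<subseteq> dual" "C \<in> sets (coord_algebra J)"
  shows "emeasure (coord_measure \<mu> J) C = \<mu> C"
proof (rule emeasure_measure_of[OF coord_measure_def])
  show "countably_additive (sets (coord_measure \<mu> J)) \<mu>"
    using countably_additive_coord_algebra[OF assms(1-3)] by simp
  show "positive (sets (coord_measure \<mu> J)) \<mu>"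
    using cylindrical_probability_empty[OF assms(1)] by (simp add: positive_def)
qed (use assms(4) sets.space_closed in auto)

section \<open>Regular conditional laws of a real coordinate\<close>

text \<open>
  The bound by a measure forces continuity at the empty set, which is all that Caratheodory's
  theorem needs.
\<close>

lemma dominated_set_function_extends:
  assumes P: "finite_measure P" and \<A>: "algebra \<Omega> \<A>" and sets: "sets P = sigma_sets \<Omega> \<A>"
    and add: "additive \<A> \<nu>" and dom: "\<And>A. A \<in> \<A> \<Longrightarrow> \<nu> A \<le> emeasure P A"
  obtains N where "sets N = sets P" "\<And>A. A \<in> \<A> \<Longrightarrow> emeasure N A = \<nu> A"
proof -
  interpret P: finite_measure P by fact
  interpret \<A>: algebra \<Omega> \<A> by fact
  have sub: "\<A> \<subseteq> sets P"
    unfolding sets by (rule sigma_sets_superset_generator)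
  have "\<exists>\<mu>. (\<forall>A\<in>\<A>. \<mu> A = \<nu> A) \<and> measure_space \<Omega> (sigma_sets \<Omega> \<A>) \<mu>"
  proof (rule \<A>.caratheodory_empty_continuous)
    show "positive \<A> \<nu>"
      using dom[OF \<A>.empty_sets] by (simp add: positive_def)
    show "\<nu> A \<noteq> \<infinity>" if "A \<in> \<A>" for A
      using dom[OF that] P.emeasure_finite[of A] by (auto simp: top_unique)
    fix A :: "nat \<Rightarrow> 'a set"
    assume A: "range A \<subseteq> \<A>" "decseq A" "(\<Inter>i. A i) = {}"
    have "(\<lambda>i. emeasure P (A i)) \<longlonglongrightarrow> emeasure P (\<Inter>i. A i)"
      using A sub by (intro Lim_emeasure_decseq) auto
    then have "(\<lambda>i. emeasure P (A i)) \<longlonglongrightarrow> 0"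
      using A by simp
    note lim = this
    show "(\<lambda>i. \<nu> (A i)) \<longlonglongrightarrow> 0"
    proof (rule tendsto_sandwich[OF _ _ tendsto_const lim])
      have "\<nu> (A i) \<le> emeasure P (A i)" for i
        using A(1) dom by blast
      then show "\<forall>\<^sub>F i in sequentially. \<nu> (A i) \<le> emeasure P (A i)"
        by simp
    qed simp
  qed (use add in auto)
  then obtain \<mu> where \<mu>: "\<And>A. A \<in> \<A> \<Longrightarrow> \<mu> A = \<nu> A" "measure_space \<Omega> (sigma_sets \<Omega> \<A>) \<mu>"
    by blast
  define N where "N = measure_of \<Omega> (sigma_sets \<Omega> \<A>) \<mu>"
  have pow: "sigma_sets \<Omega> \<A> \<subseteq> Pow \<Omega>"
    using \<A>.space_closed by (rule sigma_sets_into_sp[THEN PowI, THEN subsetI])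
  have sN: "sets N = sigma_sets \<Omega> \<A>"
    unfolding N_def using pow by (simp add: sigma_sets_sigma_sets_eq \<A>.space_closed)
  show thesis
  proof (rule that)
    show "sets N = sets P" by (simp add: sN sets)
    fix A assume "A \<in> \<A>"
    then show "emeasure N A = \<nu> A"
      using \<mu> pow sN by (subst emeasure_measure_of[OF N_def]) (auto simp: measure_space_def)
  qed
qed

lemma add_diff_add_ennreal:
  fixes a b c d :: ennreal
  assumes "b \<le> a" "d \<le> c" "b \<noteq> \<infinity>" "d \<noteq> \<infinity>"
  shows "(a - b) + (c - d) = (a + c) - (b + d)"
proof -
  have "a + c = (b + d) + ((a - b) + (c - d))"
    using assms by (metis add.assoc add.commute add_diff_inverse_ennreal)
  then show ?thesis
    using assms by (simp add: ennreal_add_diff_cancel_left)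
qed

text \<open>
  The difference \<open>P - N\<close> on the algebra extends to a measure as well, and \<open>P\<close> is the sum of the two
  extensions by uniqueness.
\<close>

lemma emeasure_mono_from_algebra:
  assumes P: "finite_measure P" and \<A>: "algebra \<Omega> \<A>" and sets: "sets P = sigma_sets \<Omega> \<A>"
    and N: "sets N = sets P" and le: "\<And>A. A \<in> \<A> \<Longrightarrow> emeasure N A \<le> emeasure P A"
    and B: "B \<in> sets P"
  shows "emeasure N B \<le> emeasure P B"
proof -
  interpret P: finite_measure P by fact
  interpret \<A>: algebra \<Omega> \<A> by fact
  have sub: "\<A> \<subseteq> sets P"
    unfolding sets by (rule sigma_sets_superset_generator)
  have "sets P = sets (sigma \<Omega> \<A>)"
    using \<A>.space_closed by (simp add: sets)
  then have "space P = \<Omega>"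
    using \<A>.space_closed by (metis sets_eq_imp_space_eq space_measure_of)
  then have sp: "space P = \<Omega>" "space N = \<Omega>"
    using sets_eq_imp_space_eq[OF N] by auto
  have fin: "emeasure N B \<noteq> \<infinity>" if "B \<in> sets P" for B
  proof -
    have "emeasure N B \<le> emeasure N \<Omega>"
      using that N sp by (intro emeasure_mono) (auto dest: sets.sets_into_space)
    also have "\<dots> \<le> emeasure P \<Omega>" by (rule le[OF \<A>.top])
    finally show ?thesis using P.emeasure_finite[of \<Omega>] by (auto simp: top_unique)
  qed
  have "additive \<A> (\<lambda>A. emeasure P A - emeasure N A)"
    unfolding additive_def
  proof (intro ballI impI)
    fix A B assume AB: "A \<in> \<A>" "B \<in> \<A>" "A \<inter> B = {}"
    have "emeasure P A - emeasure N A + (emeasure P B - emeasure N B) =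
        (emeasure P A + emeasure P B) - (emeasure N A + emeasure N B)"
      using le fin AB sub by (intro add_diff_add_ennreal) auto
    then show "emeasure P (A \<union> B) - emeasure N (A \<union> B) =
        emeasure P A - emeasure N A + (emeasure P B - emeasure N B)"
      using AB sub N by (subst (1 2) plus_emeasure[symmetric]) auto
  qed
  then obtain N' where N': "sets N' = sets P"
    "\<And>A. A \<in> \<A> \<Longrightarrow> emeasure N' A = emeasure P A - emeasure N A"
    using dominated_set_function_extends[OF P \<A> sets, of "\<lambda>A. emeasure P A - emeasure N A"]
    by (metis diff_le_self_ennreal)
  have sp': "space N' = \<Omega>"
    using sp sets_eq_imp_space_eq[OF N'(1)] by simp
  have fin': "emeasure N' B \<noteq> \<infinity>" if "B \<in> sets P" for B
  proof -
    have "emeasure N' B \<le> emeasure N' \<Omega>"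
      using that N' sp' sp by (intro emeasure_mono) (auto dest: sets.sets_into_space)
    also have "\<dots> \<le> emeasure P \<Omega>" using N'(2)[OF \<A>.top] by simp
    finally show ?thesis using P.emeasure_finite[of \<Omega>] by (auto simp: top_unique)
  qed
  have *: "emeasure P A = emeasure N A + emeasure N' A" if "A \<in> \<A>" for A
    by (simp only: N'(2)[OF that] add_diff_inverse_ennreal[OF le[OF that]])
  from B have "B \<in> sigma_sets \<Omega> \<A>" by (simp add: sets)
  with \<A>.Int_stable \<A>.space_closed have "emeasure P B = emeasure N B + emeasure N' B"
  proof (induction rule: sigma_sets_induct_disjoint)
    case (compl A)
    then have A: "A \<in> sets P" by (simp add: sets)
    have "emeasure P (\<Omega> - A) = emeasure P \<Omega> - emeasure P A"
      using emeasure_compl[of A P] A sp by simp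
    also have "\<dots> = (emeasure N \<Omega> + emeasure N' \<Omega>) - (emeasure N A + emeasure N' A)"
      using compl *[OF \<A>.top] by simp
    also have "\<dots> = (emeasure N \<Omega> - emeasure N A) + (emeasure N' \<Omega> - emeasure N' A)"
      using A sp sp' N N' fin[OF A] fin'[OF A]
      by (intro add_diff_add_ennreal[symmetric] emeasure_mono) (auto dest: sets.sets_into_space)
    also have "\<dots> = emeasure N (\<Omega> - A) + emeasure N' (\<Omega> - A)"
      using A sp sp' N N' fin[OF A] fin'[OF A] emeasure_compl[of A N] emeasure_compl[of A N'] by auto
    finally show ?case .
  next
    case (union A)
    have A: "range A \<subseteq> sets P" using union by (auto simp: sets)
    have "emeasure P (\<Union>i. A i) = (\<Sum>i. emeasure P (A i))"
      using A union by (intro suminf_emeasure[symmetric]) auto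
    also have "\<dots> = (\<Sum>i. emeasure N (A i)) + (\<Sum>i. emeasure N' (A i))"
      using union by (simp add: suminf_add)
    also have "\<dots> = emeasure N (\<Union>i. A i) + emeasure N' (\<Union>i. A i)"
      using A union N N' by (subst (1 2) suminf_emeasure) auto
    finally show ?case .
  qed (auto simp: *)
  then show ?thesis by simp
qed

text \<open>
  On the set where \<open>g < f\<close> the integral of \<open>f - g\<close> is at most zero.
\<close>

lemma AE_le_if_set_nn_integral_le:
  assumes [measurable]: "f \<in> borel_measurable P" "g \<in> borel_measurable P"
    and fin: "(\<integral>\<^sup>+x. f x \<partial>P) \<noteq> \<infinity>"
    and le: "\<And>A. A \<in> sets P \<Longrightarrow> (\<integral>\<^sup>+x\<in>A. f x \<partial>P) \<le> (\<integral>\<^sup>+x\<in>A. g x \<partial>P)"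
  shows "AE x in P. f x \<le> g x"
proof -
  define A where "A = {x\<in>space P. g x < f x}"
  have [measurable]: "A \<in> sets P" by (simp add: A_def)
  have finA: "(\<integral>\<^sup>+x\<in>A. g x \<partial>P) \<noteq> \<infinity>"
  proof -
    have "(\<integral>\<^sup>+x\<in>A. g x \<partial>P) \<le> (\<integral>\<^sup>+x. f x \<partial>P)"
      by (intro nn_integral_mono) (auto simp: A_def indicator_def)
    then show ?thesis using fin by (auto simp: top_unique)
  qed
  have "(\<integral>\<^sup>+x. f x * indicator A x - g x * indicator A x \<partial>P) =
      (\<integral>\<^sup>+x\<in>A. f x \<partial>P) - (\<integral>\<^sup>+x\<in>A. g x \<partial>P)"
    using finA by (intro nn_integral_diff) (auto simp: A_def indicator_def)
  also have "\<dots> = 0"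
    using le[of A] finA by (auto simp: diff_eq_0_iff_ennreal less_top[symmetric] top_unique)
  finally have "AE x in P. f x * indicator A x - g x * indicator A x = 0"
    by (subst (asm) nn_integral_0_iff_AE) auto
  then show ?thesis
  proof (rule AE_mp[OF _ AE_I2], intro impI)
    fix x assume x: "x \<in> space P" "f x * indicator A x - g x * indicator A x = 0"
    show "f x \<le> g x"
    proof (rule ccontr)
      assume "\<not> f x \<le> g x"
      with x show False
        by (auto simp: A_def diff_eq_0_iff_ennreal)
    qed
  qed
qed

text \<open>
  Radon--Nikodym for a set function that is given on a generating algebra only.  The bound by
  \<open>P\<close> itself allows the density to be cut off at \<open>1\<close> everywhere.
\<close>

lemma dominated_density:
  assumes P: "finite_measure P" and \<A>: "algebra \<Omega> \<A>" and sets: "sets P = sigma_sets \<Omega> \<A>"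
    and add: "additive \<A> \<nu>" and dom: "\<And>A. A \<in> \<A> \<Longrightarrow> \<nu> A \<le> emeasure P A"
  obtains f :: "'a \<Rightarrow> ennreal" where "f \<in> borel_measurable P" "\<And>x. f x \<le> 1"
    "\<And>A. A \<in> \<A> \<Longrightarrow> (\<integral>\<^sup>+x\<in>A. f x \<partial>P) = \<nu> A"
proof -
  interpret P: finite_measure P by fact
  obtain N where N: "sets N = sets P" "\<And>A. A \<in> \<A> \<Longrightarrow> emeasure N A = \<nu> A"
    using dominated_set_function_extends[OF assms] by blast
  have le: "emeasure N B \<le> emeasure P B" if "B \<in> sets P" for B
    using emeasure_mono_from_algebra[OF P \<A> sets N(1) _ that] N(2) dom by auto
  have "absolutely_continuous P N"
    unfolding absolutely_continuous_def
  proof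
    fix B assume "B \<in> null_sets P"
    then show "B \<in> null_sets N"
      using le[of B] N(1) by (auto simp: null_sets_def)
  qed
  then obtain f where f: "f \<in> borel_measurable P" "density P f = N"
    using P.Radon_Nikodym[OF _ N(1)] by blast
  have fA: "(\<integral>\<^sup>+x\<in>B. f x \<partial>P) = emeasure N B" if "B \<in> sets P" for B
    using emeasure_density[OF f(1) that] f(2) by simp
  have "AE x in P. f x \<le> 1"
  proof (rule AE_le_if_set_nn_integral_le)
    have "(\<integral>\<^sup>+x. f x \<partial>P) = emeasure N (space P)"
      using fA[OF sets.top] by (simp cong: nn_integral_cong)
    then show "(\<integral>\<^sup>+x. f x \<partial>P) \<noteq> \<infinity>"
      using le[OF sets.top] P.emeasure_finite[of "space P"] by (auto simp: top_unique)
  qed (use f fA le in auto)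
  then have "AE x in P. min 1 (f x) = f x"
    by eventually_elim (auto simp: min_absorb2)
  then have *: "(\<integral>\<^sup>+x\<in>B. min 1 (f x) \<partial>P) = (\<integral>\<^sup>+x\<in>B. f x \<partial>P)" for B
    by (rule nn_set_integral_cong)
  show thesis
  proof (rule that)
    show "(\<lambda>x. min 1 (f x)) \<in> borel_measurable P" using f(1) by measurable
    fix A assume A: "A \<in> \<A>"
    then have "A \<in> sets P" by (simp add: sets)
    then show "(\<integral>\<^sup>+x\<in>A. min 1 (f x) \<partial>P) = \<nu> A"
      by (simp add: * fA N(2)[OF A])
  qed simp
qed

lemma mono_continuous_at_right:
  fixes F :: "real \<Rightarrow> real"
  assumes "\<And>x y. x \<le> y \<Longrightarrow> F x \<le> F y"
    and approx: "\<And>x e. 0 < e \<Longrightarrow> \<exists>y>x. F y < F x + e"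
  shows "continuous (at_right a) F"
  unfolding continuous_within
proof (rule order_tendstoI)
  fix l assume l: "l < F a"
  have "l < F x" if "a < x" for x
    using assms(1)[of a x] that l by auto
  then show "\<forall>\<^sub>F x in at_right a. l < F x"
    by (rule eventually_mono[OF eventually_at_right_less])
next
  fix u assume "F a < u"
  then obtain y where y: "a < y" "F y < u"
    using approx[of "u - F a" a] by auto
  have "F x < u" if "x \<in> {a<..<y}" for x
    using assms(1)[of x y] that y by auto
  then show "\<forall>\<^sub>F x in at_right a. F x < u"
    using y(1) by (auto simp: eventually_at_right intro!: exI[of _ y])
qed

text \<open>
  Existence of a regular conditional law on the real line, for a bimeasure \<open>N A E\<close> that is only
  additive in \<open>A\<close>.  The densities \<open>f q\<close> of \<open>A \<mapsto> N A {..q}\<close> are almost surely monotone along the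
  rationals.  Their right limits \<open>F x\<close> are monotone and right-continuous for every \<open>x\<close>, so \<open>F x\<close> is a
  distribution function as soon as its limits at both ends are right.  This holds almost surely,
  and an arbitrary fixed law is used at the other points.
\<close>

lemma conditional_kernel:
  fixes N :: "'a set \<Rightarrow> real measure"
  assumes P: "prob_space P" and \<A>: "algebra \<Omega> \<A>" and sets: "sets P = sigma_sets \<Omega> \<A>"
    and setsN: "\<And>A. A \<in> \<A> \<Longrightarrow> sets (N A) = sets borel"
    and add: "\<And>E. E \<in> sets borel \<Longrightarrow> additive \<A> (\<lambda>A. emeasure (N A) E)"
    and total: "\<And>A. A \<in> \<A> \<Longrightarrow> emeasure (N A) UNIV = emeasure P A"
  obtains \<kappa> where "\<kappa> \<in> P \<rightarrow>\<^sub>M prob_algebra borel"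
    "\<And>A E. A \<in> \<A> \<Longrightarrow> E \<in> sets borel \<Longrightarrow> (\<integral>\<^sup>+x\<in>A. emeasure (\<kappa> x) E \<partial>P) = emeasure (N A) E"
proof -
  interpret P: prob_space P by fact
  interpret \<A>: algebra \<Omega> \<A> by fact
  have sub: "\<A> \<subseteq> sets P"
    unfolding sets by (rule sigma_sets_superset_generator)
  have "sets P = sets (sigma \<Omega> \<A>)"
    using \<A>.space_closed by (simp add: sets)
  then have sp: "space P = \<Omega>"
    using \<A>.space_closed by (metis sets_eq_imp_space_eq space_measure_of)
  have spN: "space (N A) = UNIV" if "A \<in> \<A>" for A
    using sets_eq_imp_space_eq[OF setsN[OF that]] by simp
  have finN: "emeasure (N A) E \<noteq> \<infinity>" if "A \<in> \<A>" for A E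
    using emeasure_space[of "N A" E] spN[OF that] total[OF that] P.emeasure_finite[of A]
    by (auto simp: top_unique)
  have domN: "emeasure (N A) E \<le> emeasure P A" if "A \<in> \<A>" for A E
    using emeasure_space[of "N A" E] spN[OF that] total[OF that] by simp
  have "\<exists>f. f \<in> borel_measurable P \<and> (\<forall>x. f x \<le> (1::ennreal)) \<and>
      (\<forall>A\<in>\<A>. (\<integral>\<^sup>+x\<in>A. f x \<partial>P) = emeasure (N A) {..q})" for q
  proof -
    obtain f where "f \<in> borel_measurable P" "\<And>x. f x \<le> (1::ennreal)"
        "\<And>A. A \<in> \<A> \<Longrightarrow> (\<integral>\<^sup>+x\<in>A. f x \<partial>P) = emeasure (N A) {..q}"
      using dominated_density[OF P.finite_measure_axioms \<A> sets, of "\<lambda>A. emeasure (N A) {..q}"]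
        add[of "{..q}"] domN by auto
    then show ?thesis by blast
  qed
  then obtain f :: "real \<Rightarrow> 'a \<Rightarrow> ennreal"
    where f [measurable]: "\<And>q. f q \<in> borel_measurable P" and f1: "\<And>q x. f q x \<le> 1"
      and fN: "\<And>q A. A \<in> \<A> \<Longrightarrow> (\<integral>\<^sup>+x\<in>A. f q x \<partial>P) = emeasure (N A) {..q}"
    by metis
  have fin_f: "(\<integral>\<^sup>+x. f q x \<partial>P) \<noteq> \<infinity>" for q
  proof -
    have "(\<integral>\<^sup>+x. f q x \<partial>P) \<le> (\<integral>\<^sup>+x. 1 \<partial>P)"
      by (intro nn_integral_mono f1)
    then show ?thesis by (auto simp: P.emeasure_space_1 top_unique)
  qed
  have f_mono: "AE x in P. f q x \<le> f r x" if "q \<le> r" for q r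
  proof (rule AE_le_if_set_nn_integral_le)
    fix B assume B: "B \<in> sets P"
    have "emeasure (density P (f q)) B \<le> emeasure (density P (f r)) B"
    proof (rule emeasure_mono_from_algebra[OF _ \<A>])
      show "finite_measure (density P (f r))"
        using fin_f by (intro finite_measureI) (simp add: emeasure_density cong: nn_integral_cong)
      fix A assume A: "A \<in> \<A>"
      have "emeasure (N A) {..q} \<le> emeasure (N A) {..r}"
        using that setsN[OF A] by (intro emeasure_mono) auto
      then show "emeasure (density P (f q)) A \<le> emeasure (density P (f r)) A"
        using A sub by (simp add: emeasure_density fN subset_iff)
    qed (use sets B in auto)
    then show "(\<integral>\<^sup>+x\<in>B. f q x \<partial>P) \<le> (\<integral>\<^sup>+x\<in>B. f r x \<partial>P)"
      using B by (simp add: emeasure_density)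
  qed (use f fin_f in auto)
  have "AE x in P. \<forall>p\<in>{(q, r). q \<in> \<rat> \<and> r \<in> \<rat> \<and> q \<le> r}. f (fst p) x \<le> f (snd p) x"
  proof (subst AE_ball_countable)
    show "countable {(q::real, r::real). q \<in> \<rat> \<and> r \<in> \<rat> \<and> q \<le> r}"
      by (rule countable_subset[of _ "\<rat> \<times> \<rat>"]) (auto simp: countable_rat)
  qed (auto intro: f_mono)
  then have f_mono_rat: "AE x in P. \<forall>q\<in>\<rat>. \<forall>r\<in>\<rat>. q \<le> r \<longrightarrow> f q x \<le> f r x"
    by eventually_elim auto
  define F where "F = (\<lambda>x t. INF q\<in>{q\<in>\<rat>. t < q}. f q x)"
  have cnt: "countable {q\<in>\<rat>. t < q}" for t :: real
    by (rule countable_subset[OF _ countable_rat]) auto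
  have F_meas [measurable]: "(\<lambda>x. F x t) \<in> borel_measurable P" for t
    unfolding F_def by (intro borel_measurable_INF cnt f)
  have F_mono: "F x s \<le> F x t" if "s \<le> t" for x s t
    unfolding F_def using that by (intro INF_superset_mono) auto
  have F1: "F x t \<le> 1" for x t
  proof -
    obtain q where "q \<in> \<rat>" "t < q" using Rats_dense_in_real[of t "t + 1"] by auto
    then show ?thesis
      unfolding F_def using f1[of q x] by (intro INF_lower2[of q]) auto
  qed
  \<comment> \<open>Passing to the right limit does not change the integrals, because \<open>E \<mapsto> N A E\<close> is continuous
    from above along a strictly decreasing sequence of rationals with limit \<open>t\<close>.\<close>
  have F_int: "(\<integral>\<^sup>+x\<in>A. F x t \<partial>P) = emeasure (N A) {..t}" if A: "A \<in> \<A>" for A t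
  proof -
    have "\<exists>q\<in>\<rat>. t + 1 / Suc (Suc n) < q \<and> q < t + 1 / Suc n" for n
      by (rule Rats_dense_in_real) (simp add: field_simps)
    then obtain q where q: "\<And>n. q n \<in> \<rat>" "\<And>n. t + 1 / Suc (Suc n) < q n"
      "\<And>n. q n < t + 1 / Suc n"
      by metis
    have qdec: "q (Suc n) \<le> q n" for n
      using q(2)[of n] q(3)[of "Suc n"] by linarith
    have qt: "t < q n" for n
      by (rule order.strict_trans[OF _ q(2)]) simp
    have qs: "\<exists>n. q n < s" if ts: "t < s" for s
    proof -
      obtain n where "1 / Suc n < s - t"
        using ts reals_Archimedean[of "s - t"] by (auto simp: inverse_eq_divide)
      then show ?thesis using q(3)[of n] by (intro exI[of _ n]) simp
    qed
    have [measurable]: "A \<in> sets P" using A sub by auto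
    have "(\<integral>\<^sup>+x\<in>A. F x t \<partial>P) = (\<integral>\<^sup>+x. (INF n. f (q n) x * indicator A x) \<partial>P)"
    proof (rule nn_integral_cong_AE, rule AE_mp[OF f_mono_rat], intro AE_I2 impI)
      fix x assume mono: "\<forall>q\<in>\<rat>. \<forall>r\<in>\<rat>. q \<le> r \<longrightarrow> f q x \<le> f r x"
      have "F x t = (INF n. f (q n) x)"
        unfolding F_def
      proof (rule antisym)
        show "(INF q\<in>{q\<in>\<rat>. t < q}. f q x) \<le> (INF n. f (q n) x)"
          using q(1) qt by (intro INF_greatest INF_lower) auto
        show "(INF n. f (q n) x) \<le> (INF q\<in>{q\<in>\<rat>. t < q}. f q x)"
        proof (rule INF_greatest)
          fix s assume s: "s \<in> {q\<in>\<rat>. t < q}"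
          then obtain n where "q n < s" using qs by auto
          then show "(INF n. f (q n) x) \<le> f s x"
            using s mono q(1) by (intro INF_lower2[of n]) auto
        qed
      qed
      then show "F x t * indicator A x = (INF n. f (q n) x * indicator A x)"
        by (cases "x \<in> A") auto
    qed
    also have "\<dots> = (INF n. \<integral>\<^sup>+x\<in>A. f (q n) x \<partial>P)"
    proof (rule nn_integral_monotone_convergence_INF_AE')
      show "AE x in P. f (q (Suc i)) x * indicator A x \<le> f (q i) x * indicator A x" for i
        using f_mono[OF qdec[of i]] by eventually_elim (auto intro!: mult_right_mono)
      show "(\<integral>\<^sup>+x. f (q 0) x * indicator A x \<partial>P) < \<infinity>"
        using fN[OF A, of "q 0"] finN[OF A] by (simp add: less_top)
    qed simp
    also have "\<dots> = (INF n. emeasure (N A) {..q n})"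
      by (simp add: fN[OF A])
    also have "\<dots> = emeasure (N A) (\<Inter>n. {..q n})"
    proof (rule INF_emeasure_decseq)
      show "decseq (\<lambda>n. {..q n})" using qdec by (intro decseq_SucI) simp
    qed (use finN[OF A] in \<open>simp_all add: setsN[OF A] image_subset_iff\<close>)
    also have "(\<Inter>n. {..q n}) = {..t}"
      using qt qs by (fastforce intro: less_imp_le order_trans simp: not_less[symmetric])
    finally show ?thesis .
  qed
  \<comment> \<open>The points at which the right limits form a distribution function.\<close>
  define good where "good = (\<lambda>x. (SUP n. F x (real n)) = 1 \<and> (INF n. F x (- real n)) = 0)"
  have good_meas [measurable]: "Measurable.pred P good"
    unfolding good_def by measurable
  have F_space: "(\<integral>\<^sup>+x. F x t \<partial>P) = emeasure (N \<Omega>) {..t}" for t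
    using F_int[OF \<A>.top, of t] unfolding sp[symmetric] by simp
  have "AE x in P. (SUP n. F x (real n)) = 1"
  proof -
    have "(\<integral>\<^sup>+x. (SUP n. F x (real n)) \<partial>P) = (SUP n. \<integral>\<^sup>+x. F x (real n) \<partial>P)"
    proof (rule nn_integral_monotone_convergence_SUP)
      show "incseq (\<lambda>n x. F x (real n))"
        by (intro incseq_SucI le_funI F_mono) simp
    qed (rule F_meas)
    also have "\<dots> = emeasure (N \<Omega>) (\<Union>n. {..real n})"
      unfolding F_space
    proof (rule SUP_emeasure_incseq)
      show "incseq (\<lambda>n. {..real n})" by (intro incseq_SucI) simp
    qed (simp add: setsN[OF \<A>.top] image_subset_iff)
    also have "(\<Union>n. {..real n}) = UNIV"
      using real_arch_simple by auto
    finally have "(\<integral>\<^sup>+x. (SUP n. F x (real n)) \<partial>P) = 1"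
      using total[OF \<A>.top] P.emeasure_space_1 sp by simp
    moreover have le1: "(SUP n. F x (real n)) \<le> 1" for x
      by (intro SUP_least F1)
    ultimately have "(\<integral>\<^sup>+x. 1 - (SUP n. F x (real n)) \<partial>P) = 0"
      by (subst nn_integral_diff) (auto simp: P.emeasure_space_1)
    then have "AE x in P. 1 - (SUP n. F x (real n)) = 0"
      by (subst (asm) nn_integral_0_iff_AE) auto
    then show ?thesis
      by eventually_elim (auto intro!: antisym le1 simp: diff_eq_0_iff_ennreal)
  qed
  moreover have "AE x in P. (INF n. F x (- real n)) = 0"
  proof -
    have "(\<integral>\<^sup>+x. (INF n. F x (- real n)) \<partial>P) = (INF n. \<integral>\<^sup>+x. F x (- real n) \<partial>P)"
    proof (rule nn_integral_monotone_convergence_INF_decseq)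
      show "decseq (\<lambda>n x. F x (- real n))"
        by (intro decseq_SucI le_funI F_mono) simp
      show "(\<integral>\<^sup>+x. F x (- real 0) \<partial>P) < \<infinity>"
        using F_space finN[OF \<A>.top] by (simp add: less_top)
    qed (rule F_meas)
    also have "\<dots> = emeasure (N \<Omega>) (\<Inter>n. {..- real n})"
      unfolding F_space
    proof (rule INF_emeasure_decseq)
      show "decseq (\<lambda>n. {..- real n})" by (intro decseq_SucI) simp
    qed (use finN[OF \<A>.top] in \<open>simp_all add: setsN[OF \<A>.top] image_subset_iff\<close>)
    also have "(\<Inter>n. {..- real n}) = {}"
    proof -
      have "\<exists>n. \<not> x \<le> - real n" for x :: real
      proof -
        obtain n where "- x < real n" using reals_Archimedean2 by blast
        then show ?thesis by (intro exI[of _ n]) simp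
      qed
      then show ?thesis by auto
    qed
    finally have "(\<integral>\<^sup>+x. (INF n. F x (- real n)) \<partial>P) = 0" by simp
    then show ?thesis
      by (subst (asm) nn_integral_0_iff_AE) auto
  qed
  ultimately have AE_good: "AE x in P. good x"
    by (auto simp: good_def)
  define \<kappa> where "\<kappa> = (\<lambda>x. if good x then interval_measure (\<lambda>t. enn2real (F x t)) else return borel 0)"
  have F_top: "F x t < \<top>" for x t
    using F1[of x t] by (rule order.strict_trans1) simp
  have eF: "ennreal (enn2real (F x t)) = F x t" for x t
    using F_top[of x t] by simp
  have G_mono: "enn2real (F x s) \<le> enn2real (F x t)" if "s \<le> t" for x s t
    using F_mono[OF that] F_top by (intro enn2real_mono) auto
  have G_cont: "continuous (at_right a) (\<lambda>t. enn2real (F x t))" for x a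
  proof (rule mono_continuous_at_right[OF G_mono])
    fix t e :: real assume e: "0 < e"
    define c where "c = F x t + ennreal e"
    have "F x t < c"
      using F_top[of x t] e
      by (cases "F x t") (auto simp: c_def ennreal_less_iff simp flip: ennreal_plus)
    then have "(INF q\<in>{q\<in>\<rat>. t < q}. f q x) < c"
      by (simp add: F_def)
    then obtain q where q: "q \<in> \<rat>" "t < q" "f q x < F x t + ennreal e"
      by (auto simp: INF_less_iff c_def)
    obtain y where y: "t < y" "y < q"
      using dense[OF q(2)] by auto
    have "F x y \<le> f q x"
      unfolding F_def using q y by (intro INF_lower) auto
    then have "F x y < ennreal (enn2real (F x t) + e)"
      using q(3) e by (simp add: ennreal_plus eF)
    then have "enn2real (F x y) < enn2real (F x t) + e"
      by (metis eF ennreal_less_iff enn2real_nonneg)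
    then show "\<exists>y>t. enn2real (F x y) < enn2real (F x t) + e"
      using y by auto
  qed
  have G_top: "((\<lambda>t. enn2real (F x t)) \<longlongrightarrow> 1) at_top" if "good x" for x
  proof (rule tendsto_at_topI_sequentially_real)
    have "(\<lambda>n. F x (real n)) \<longlonglongrightarrow> (SUP n. F x (real n))"
      by (intro LIMSEQ_SUP incseq_SucI F_mono) simp
    then show "(\<lambda>n. enn2real (F x (real n))) \<longlonglongrightarrow> 1"
      using that tendsto_enn2real[where l=1 and u="\<lambda>n. F x (real n)" and F=sequentially] by (simp add: good_def)
  qed (auto intro!: monoI G_mono)
  have G_bot: "((\<lambda>t. enn2real (F x t)) \<longlongrightarrow> 0) at_bot" if "good x" for x
  proof -
    have "(\<lambda>n. F x (- real n)) \<longlonglongrightarrow> (INF n. F x (- real n))"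
      by (intro LIMSEQ_INF decseq_SucI F_mono) simp
    then have "(\<lambda>n. enn2real (F x (- real n))) \<longlonglongrightarrow> 0"
      using that tendsto_enn2real[where l=0 and u="\<lambda>n. F x (- real n)" and F=sequentially] by (simp add: good_def)
    then have "(\<lambda>n. - enn2real (F x (- real n))) \<longlonglongrightarrow> 0"
      using tendsto_minus by fastforce
    then have "((\<lambda>t. - enn2real (F x (- t))) \<longlongrightarrow> 0) at_top"
      by (intro tendsto_at_topI_sequentially_real) (auto intro!: monoI G_mono)
    from filterlim_compose[OF this filterlim_uminus_at_top_at_bot]
    have "((\<lambda>t. - enn2real (F x t)) \<longlongrightarrow> 0) at_bot" by simp
    then show ?thesis using tendsto_minus by fastforce
  qed
  have \<kappa>_prob: "prob_space (\<kappa> x)" for x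
  proof (cases "good x")
    case True
    have "real_distribution (interval_measure (\<lambda>t. enn2real (F x t)))"
      by (rule real_distribution_interval_measure[OF G_mono G_cont G_bot[OF True] G_top[OF True]])
    then show ?thesis using True by (simp add: \<kappa>_def real_distribution_def)
  qed (simp add: \<kappa>_def prob_space_return)
  have \<kappa>_sets: "sets (\<kappa> x) = sets borel" for x
    by (simp add: \<kappa>_def)
  have \<kappa>_Iic: "emeasure (\<kappa> x) {..t} = F x t" if "good x" for x t
    using that by (simp add: \<kappa>_def eF emeasure_interval_measure_Iic[OF G_mono G_cont G_bot[OF that]])
  have \<kappa>_meas: "\<kappa> \<in> P \<rightarrow>\<^sub>M prob_algebra borel"
  proof (rule measurable_prob_algebra_generated)
    show "sets borel = sigma_sets UNIV (range (atMost :: real \<Rightarrow> _))"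
      by (simp add: borel_eq_atMost)
    show "Int_stable (range (atMost :: real \<Rightarrow> _))"
      by (auto simp: Int_stable_def)
    fix A assume "A \<in> range (atMost :: real \<Rightarrow> _)"
    then obtain t where A: "A = {..t}" by auto
    have "(\<lambda>x. emeasure (\<kappa> x) A) = (\<lambda>x. if good x then F x t else indicator {..t} 0)"
      using \<kappa>_Iic by (auto simp: A \<kappa>_def fun_eq_iff)
    then show "(\<lambda>x. emeasure (\<kappa> x) A) \<in> borel_measurable P"
      by simp
  qed (simp_all add: \<kappa>_prob \<kappa>_sets)
  show thesis
  proof (rule that[OF \<kappa>_meas])
    fix A E assume A: "A \<in> \<A>" and E: "E \<in> sets (borel :: real measure)"
    have [measurable]: "A \<in> sets P" using A sub by auto
    have \<kappa>_sub: "\<kappa> \<in> density P (indicator A) \<rightarrow>\<^sub>M subprob_algebra borel"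
      using measurable_prob_algebraD[OF \<kappa>_meas] by (simp cong: measurable_cong_sets)
    have bind: "emeasure (density P (indicator A) \<bind> \<kappa>) E = (\<integral>\<^sup>+x\<in>A. emeasure (\<kappa> x) E \<partial>P)"
      if "E \<in> sets borel" for E
      using that measurable_prob_algebraD[OF \<kappa>_meas] P.not_empty
      by (subst emeasure_bind[OF _ \<kappa>_sub])
        (auto simp: nn_integral_density mult.commute intro!: nn_integral_cong)
    have "density P (indicator A) \<bind> \<kappa> = N A"
    proof (rule measure_eqI_generator_eq)
      show "sets (density P (indicator A) \<bind> \<kappa>) = sigma_sets UNIV (range (atMost :: real \<Rightarrow> _))"
        by (subst sets_bind[where N=borel]) (simp_all add: \<kappa>_sets borel_eq_atMost P.not_empty)
      show "sets (N A) = sigma_sets UNIV (range (atMost :: real \<Rightarrow> _))"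
        using setsN[OF A] by (simp add: borel_eq_atMost)
      show "Int_stable (range (atMost :: real \<Rightarrow> _))"
        by (auto simp: Int_stable_def)
      show "range atMost \<subseteq> Pow UNIV" by simp
      have eq: "emeasure (density P (indicator A) \<bind> \<kappa>) {..t} = emeasure (N A) {..t}" for t
      proof -
        have "(\<integral>\<^sup>+x\<in>A. emeasure (\<kappa> x) {..t} \<partial>P) = (\<integral>\<^sup>+x\<in>A. F x t \<partial>P)"
        proof (rule nn_set_integral_cong)
          show "AE x in P. emeasure (\<kappa> x) {..t} = F x t"
            using AE_good by eventually_elim (auto intro!: \<kappa>_Iic)
        qed
        then show ?thesis
          by (simp add: bind F_int[OF A])
      qed
      then show "emeasure (density P (indicator A) \<bind> \<kappa>) X = emeasure (N A) X"
        if "X \<in> range atMost" for X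
        using that by auto
      show "range (\<lambda>n. {..real n}) \<subseteq> range atMost" by auto
      show "(\<Union>n. {..real n}) = UNIV" using real_arch_simple by auto
      show "emeasure (density P (indicator A) \<bind> \<kappa>) {..real n} \<noteq> \<infinity>" for n
        unfolding eq by (rule finN[OF A])
    qed
    then show "(\<integral>\<^sup>+x\<in>A. emeasure (\<kappa> x) E \<partial>P) = emeasure (N A) E"
      using bind[OF E] by simp
  qed
qed

section \<open>Measure extensions, kernels and projective limits\<close>

text \<open>
  The definite description in \<open>measure_extension\<close> denotes the Caratheodory extension, which is the
  only one because an algebra is stable under intersection.
\<close>

lemma measure_extension_from_algebra:
  fixes \<mu> :: "'a set \<Rightarrow> ennreal"
  assumes \<A>: "algebra UNIV \<A>" and pos: "positive \<A> \<mu>" and ca: "countably_additive \<A> \<mu>"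
    and total: "\<mu> UNIV = 1"
  defines "M0 \<equiv> measure_extension (sigma UNIV \<A>) \<A> \<mu>"
  shows "sets M0 = sigma_sets UNIV \<A>" and "\<And>C. C \<in> \<A> \<Longrightarrow> emeasure M0 C = \<mu> C"
    and "prob_space M0"
proof -
  interpret \<A>: algebra UNIV \<A> by fact
  obtain \<nu> where \<nu>: "\<And>C. C \<in> \<A> \<Longrightarrow> \<nu> C = \<mu> C" "measure_space UNIV (sigma_sets UNIV \<A>) \<nu>"
    using \<A>.caratheodory'[OF pos ca] by blast
  define N where "N = measure_of UNIV (sigma_sets UNIV \<A>) \<nu>"
  have sN: "sets N = sigma_sets UNIV \<A>"
    unfolding N_def by (simp add: sigma_sets_sigma_sets_eq)
  have eN: "emeasure N C = \<mu> C" if "C \<in> \<A>" for C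
    using \<nu> that sN by (subst emeasure_measure_of[OF N_def]) (auto simp: measure_space_def)
  let ?Q = "\<lambda>M. sets M = sets (sigma UNIV \<A>) \<and> (\<forall>C\<in>\<A>. emeasure M C = \<mu> C)"
  have "?Q N" using sN eN by simp
  moreover have "M = N" if "?Q M" for M
  proof (rule measure_eqI_generator_eq[OF \<A>.Int_stable, of UNIV])
    show "range (\<lambda>_::nat. UNIV) \<subseteq> \<A>" using \<A>.top by auto
    show "emeasure M UNIV \<noteq> \<infinity>"
      using that \<A>.top total by simp
  qed (use that eN sN in auto)
  ultimately have "\<exists>!M. ?Q M" by blast
  from theI'[OF this] have *: "?Q M0"
    unfolding M0_def measure_extension_def by blast
  then show s: "sets M0 = sigma_sets UNIV \<A>" and e: "\<And>C. C \<in> \<A> \<Longrightarrow> emeasure M0 C = \<mu> C"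
    by auto
  have "space M0 = UNIV"
    using sets_eq_imp_space_eq[of M0 "sigma UNIV \<A>"] * by simp
  then show "prob_space M0"
    using e[OF \<A>.top] total by (intro prob_spaceI) simp
qed

lemma prob_algebra_kernelD:
  assumes "K \<in> Q \<rightarrow>\<^sub>M prob_algebra N" "y \<in> space Q"
  shows "prob_space (K y)" "sets (K y) = sets N" "space (K y) = space N"
  using measurable_space[OF assms] sets_eq_imp_space_eq[of "K y" N]
  by (auto simp: space_prob_algebra)

text \<open>
  Kolmogorov's extension theorem at each point, together with measurability in the parameter.  The
  latter is inherited from the marginals since finite cylinders generate the product sigma-algebra.
\<close>

lemma kolmogorov_kernel:
  fixes p :: "'i set \<Rightarrow> 'y \<Rightarrow> ('i \<Rightarrow> real) measure"
  assumes meas: "\<And>J. finite J \<Longrightarrow> J \<subseteq> S \<Longrightarrow> p J \<in> Q \<rightarrow>\<^sub>M prob_algebra (borel_PiM J)"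
    and consistent: "\<And>J H y. J \<subseteq> H \<Longrightarrow> finite H \<Longrightarrow> H \<subseteq> S \<Longrightarrow> y \<in> space Q \<Longrightarrow>
      p J y = distr (p H y) (borel_PiM J) (\<lambda>\<omega>. restrict \<omega> J)"
  obtains K where "K \<in> Q \<rightarrow>\<^sub>M prob_algebra (borel_PiM S)"
    "\<And>J y. finite J \<Longrightarrow> J \<subseteq> S \<Longrightarrow> y \<in> space Q \<Longrightarrow>
      distr (K y) (borel_PiM J) (\<lambda>\<omega>. restrict \<omega> J) = p J y"
proof -
  define K where "K = (\<lambda>y. projective_family.lim S (\<lambda>J. p J y) (\<lambda>_. borel))"
  have pp: "polish_projective S (\<lambda>J. p J y)" if "y \<in> space Q" for y
  proof (intro polish_projective.intro projective_family.intro)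
    show "prob_space (p J y)" if "finite J" "J \<subseteq> S" for J
      using prob_algebra_kernelD(1)[OF meas[OF that] \<open>y \<in> space Q\<close>] .
  qed (use consistent that in auto)
  have pf: "projective_family S (\<lambda>J. p J y) (\<lambda>_. borel)" if "y \<in> space Q" for y
    using polish_projective.axioms[OF pp[OF that]] .
  have K_sets: "sets (K y) = sets (borel_PiM S)" if "y \<in> space Q" for y
    unfolding K_def by (rule projective_family.sets_lim[OF pf[OF that]])
  have K_prob: "prob_space (K y)" if "y \<in> space Q" for y
  proof -
    interpret polish_projective S "\<lambda>J. p J y" by (rule pp[OF that])
    show ?thesis unfolding K_def by (rule P.prob_space_axioms)
  qed
  have K_emb: "emeasure (K y) (prod_emb S (\<lambda>_. borel) J X) = emeasure (p J y) X"
    if "y \<in> space Q" "finite J" "J \<subseteq> S" "X \<in> sets (borel_PiM J)" for y J X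
    unfolding K_def using polish_projective.emeasure_lim_emb[OF pp[OF that(1)] that(3,2,4)] .
  show thesis
  proof (rule that)
    show "K \<in> Q \<rightarrow>\<^sub>M prob_algebra (borel_PiM S)"
    proof (rule measurable_prob_algebra_generated[OF sets_PiM Int_stable_prod_algebra
          prod_algebra_sets_into_space K_prob K_sets])
      fix A assume "A \<in> prod_algebra S (\<lambda>_. borel :: real measure)"
      then have "\<exists>J E. A = prod_emb S (\<lambda>_. borel) J (Pi\<^sub>E J E) \<and> finite J \<and> J \<subseteq> S \<and>
          (\<forall>i\<in>J. E i \<in> sets (borel :: real measure))"
        unfolding prod_algebra_def by (simp add: image_iff Pi_iff) metis
      then obtain J E where J: "A = prod_emb S (\<lambda>_. borel) J (Pi\<^sub>E J E)" "finite J" "J \<subseteq> S"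
        "\<forall>i\<in>J. E i \<in> sets (borel :: real measure)"
        by blast
      have E: "Pi\<^sub>E J E \<in> sets (borel_PiM J)"
        using J by (intro sets_PiM_I_finite) auto
      have "(\<lambda>y. emeasure (p J y) (Pi\<^sub>E J E)) \<in> borel_measurable Q"
        using measurable_emeasure_kernel[OF measurable_prob_algebraD[OF meas[OF J(2,3)]] E] .
      then show "(\<lambda>y. emeasure (K y) A) \<in> borel_measurable Q"
        by (subst measurable_cong[of _ _ "\<lambda>y. emeasure (p J y) (Pi\<^sub>E J E)"])
          (auto simp: J(1) K_emb J(2,3) E)
    qed
    fix J y assume J: "finite J" "J \<subseteq> S" "y \<in> space Q"
    show "distr (K y) (borel_PiM J) (\<lambda>\<omega>. restrict \<omega> J) = p J y"
    proof (rule measure_eqI)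
      show "sets (distr (K y) (borel_PiM J) (\<lambda>\<omega>. restrict \<omega> J)) = sets (p J y)"
        using prob_algebra_kernelD(2)[OF meas[OF J(1,2)] J(3)] by simp
      fix X assume "X \<in> sets (distr (K y) (borel_PiM J) (\<lambda>\<omega>. restrict \<omega> J))"
      then have X: "X \<in> sets (borel_PiM J)" by simp
      have r: "(\<lambda>\<omega>. restrict \<omega> J) \<in> K y \<rightarrow>\<^sub>M borel_PiM J"
        unfolding measurable_cong_sets[OF K_sets[OF J(3)] refl] using J(2)
        by (rule measurable_restrict_subset)
      have "(\<lambda>\<omega>. restrict \<omega> J) -` X \<inter> space (K y) = prod_emb S (\<lambda>_. borel) J X"
        using sets_eq_imp_space_eq[OF K_sets[OF J(3)]] by (simp add: prod_emb_def space_PiM)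
      then show "emeasure (distr (K y) (borel_PiM J) (\<lambda>\<omega>. restrict \<omega> J)) X = emeasure (p J y) X"
        using K_emb[OF J(3,1,2) X] by (simp add: emeasure_distr[OF r X])
    qed
  qed
qed

text \<open>
  The law of \<open>(y, \<omega>)\<close> when \<open>y\<close> has law \<open>Q\<close> and \<open>\<omega>\<close> has law \<open>K y\<close> given \<open>y\<close>.
\<close>

definition kernel_product :: "'y measure \<Rightarrow> 'b measure \<Rightarrow> ('y \<Rightarrow> 'b measure) \<Rightarrow> ('y \<times> 'b) measure" where
  "kernel_product Q N K = Q \<bind> (\<lambda>y. distr (K y) (Q \<Otimes>\<^sub>M N) (Pair y))"

lemma
  assumes Q: "prob_space Q" and K: "K \<in> Q \<rightarrow>\<^sub>M prob_algebra N"
  shows sets_kernel_product: "sets (kernel_product Q N K) = sets (Q \<Otimes>\<^sub>M N)"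
    and emeasure_kernel_product: "\<And>G. G \<in> sets (Q \<Otimes>\<^sub>M N) \<Longrightarrow>
      emeasure (kernel_product Q N K) G = (\<integral>\<^sup>+y. emeasure (K y) (Pair y -` G) \<partial>Q)"
    and nn_integral_kernel_product: "\<And>f. f \<in> borel_measurable (Q \<Otimes>\<^sub>M N) \<Longrightarrow>
      (\<integral>\<^sup>+x. f x \<partial>kernel_product Q N K) = (\<integral>\<^sup>+y. \<integral>\<^sup>+\<omega>. f (y, \<omega>) \<partial>K y \<partial>Q)"
    and prob_space_kernel_product: "prob_space (kernel_product Q N K)"
proof -
  have ne: "space Q \<noteq> {}" by (rule prob_space.not_empty[OF Q])
  have Ks: "K \<in> Q \<rightarrow>\<^sub>M subprob_algebra N" by (rule measurable_prob_algebraD[OF K])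
  have L: "(\<lambda>y. distr (K y) (Q \<Otimes>\<^sub>M N) (Pair y)) \<in> Q \<rightarrow>\<^sub>M subprob_algebra (Q \<Otimes>\<^sub>M N)"
    by (rule measurable_distr2[OF _ Ks]) simp
  have pm: "Pair y \<in> K y \<rightarrow>\<^sub>M Q \<Otimes>\<^sub>M N" if "y \<in> space Q" for y
    using measurable_Pair1'[OF that, of N] measurable_cong_sets[OF prob_algebra_kernelD(2)[OF K that] refl]
    by blast
  show sets: "sets (kernel_product Q N K) = sets (Q \<Otimes>\<^sub>M N)"
    unfolding kernel_product_def using ne by (intro sets_bind) auto
  have 1: "(\<integral>\<^sup>+x. f x \<partial>kernel_product Q N K) = (\<integral>\<^sup>+y. \<integral>\<^sup>+\<omega>. f (y, \<omega>) \<partial>K y \<partial>Q)"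
    if f: "f \<in> borel_measurable (Q \<Otimes>\<^sub>M N)" for f
    unfolding kernel_product_def nn_integral_bind[OF f L]
    by (intro nn_integral_cong nn_integral_distr pm) (simp_all add: f)
  then show "\<And>f. f \<in> borel_measurable (Q \<Otimes>\<^sub>M N) \<Longrightarrow>
      (\<integral>\<^sup>+x. f x \<partial>kernel_product Q N K) = (\<integral>\<^sup>+y. \<integral>\<^sup>+\<omega>. f (y, \<omega>) \<partial>K y \<partial>Q)" .
  show 2: "emeasure (kernel_product Q N K) G = (\<integral>\<^sup>+y. emeasure (K y) (Pair y -` G) \<partial>Q)"
    if G: "G \<in> sets (Q \<Otimes>\<^sub>M N)" for G
    unfolding kernel_product_def emeasure_bind[OF ne L G]
  proof (rule nn_integral_cong)
    fix y assume y: "y \<in> space Q"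
    have "Pair y -` G \<inter> space (K y) = Pair y -` G"
      using sets.sets_into_space[OF G] prob_algebra_kernelD(3)[OF K y]
      by (auto simp: space_pair_measure)
    then show "emeasure (distr (K y) (Q \<Otimes>\<^sub>M N) (Pair y)) G = emeasure (K y) (Pair y -` G)"
      by (simp add: emeasure_distr[OF pm[OF y] G])
  qed
  show "prob_space (kernel_product Q N K)"
  proof (rule prob_spaceI)
    have "emeasure (kernel_product Q N K) (space (Q \<Otimes>\<^sub>M N)) =
        (\<integral>\<^sup>+y. emeasure (K y) (Pair y -` space (Q \<Otimes>\<^sub>M N)) \<partial>Q)"
      by (rule 2) simp
    also have "\<dots> = (\<integral>\<^sup>+y. 1 \<partial>Q)"
    proof (rule nn_integral_cong)
      fix y assume y: "y \<in> space Q"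
      then have "Pair y -` space (Q \<Otimes>\<^sub>M N) = space (K y)"
        by (auto simp: prob_algebra_kernelD(3)[OF K y] space_pair_measure)
      then show "emeasure (K y) (Pair y -` space (Q \<Otimes>\<^sub>M N)) = 1"
        using prob_space.emeasure_space_1[OF prob_algebra_kernelD(1)[OF K y]] by simp
    qed
    also have "\<dots> = 1" using prob_space.emeasure_space_1[OF Q] by simp
    finally show "emeasure (kernel_product Q N K) (space (kernel_product Q N K)) = 1"
      using sets_eq_imp_space_eq[OF sets] by simp
  qed
qed

lemma dual_comp_fst: "f \<in> dual \<Longrightarrow> f \<circ> fst \<in> dual"
  using continuous_on_compose[OF continuous_on_fst[OF continuous_on_id], of UNIV f]
  by (auto simp: dual_def continuous_linear_on_def comp_def intro: continuous_on_subset)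

lemma dual_comp_snd: "g \<in> dual \<Longrightarrow> g \<circ> snd \<in> dual"
  using continuous_on_compose[OF continuous_on_snd[OF continuous_on_id], of UNIV g]
  by (auto simp: dual_def continuous_linear_on_def comp_def intro: continuous_on_subset)

definition lift_coords :: "('y \<Rightarrow> real) set \<Rightarrow> ('z \<Rightarrow> real) set \<Rightarrow> ('y \<times> 'z \<Rightarrow> real) set" where
  "lift_coords I J = (\<lambda>f. f \<circ> fst) ` I \<union> (\<lambda>g. g \<circ> snd) ` J"

lemma finite_lift_coords: "finite I \<Longrightarrow> finite J \<Longrightarrow> finite (lift_coords I J)"
  by (simp add: lift_coords_def)

lemma lift_coords_dual: "I \<subseteq> dual \<Longrightarrow> J \<subseteq> dual \<Longrightarrow> lift_coords I J \<subseteq> dual"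
  by (auto simp: lift_coords_def intro!: dual_comp_fst dual_comp_snd)

lemma measurable_coords_fst:
  "(\<lambda>x. coords I (fst x)) \<in> coord_algebra (lift_coords I J) \<rightarrow>\<^sub>M borel_PiM I"
  unfolding coords_def
proof (rule measurable_restrict)
  fix f assume "f \<in> I"
  then have "f \<circ> fst \<in> borel_measurable (coord_algebra (lift_coords I J))"
    by (intro measurable_coord) (auto simp: lift_coords_def)
  then show "(\<lambda>x. f (fst x)) \<in> borel_measurable (coord_algebra (lift_coords I J))"
    by (simp add: comp_def)
qed

lemma measurable_coords_snd:
  "(\<lambda>x. coords J (snd x)) \<in> coord_algebra (lift_coords I J) \<rightarrow>\<^sub>M borel_PiM J"
  unfolding coords_def
proof (rule measurable_restrict)
  fix g assume "g \<in> J"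
  then have "g \<circ> snd \<in> borel_measurable (coord_algebra (lift_coords I J))"
    by (intro measurable_coord) (auto simp: lift_coords_def)
  then show "(\<lambda>x. g (snd x)) \<in> borel_measurable (coord_algebra (lift_coords I J))"
    by (simp add: comp_def)
qed

section \<open>Disintegration over finitely many functionals\<close>

text \<open>
  The situation of the theorem: \<open>Q0\<close> extends the first marginal of \<open>m\<close> to the sigma-algebra generated
  by the cylinder sets, before completion.
\<close>

locale cylindrical_product =
  fixes m :: "('y::{real_vector,topological_space} \<times> 'z::{real_vector,topological_space}) set \<Rightarrow> ennreal"
    and Q0 :: "'y measure"
  assumes m: "cylindrical_probability UNIV m"
    and sets_Q0: "sets Q0 = sigma_sets UNIV (cylinder_sets UNIV)"
    and emeasure_Q0: "C \<in> cylinder_sets UNIV \<Longrightarrow> emeasure Q0 C = m (fst -` C)"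
    and prob_Q0: "prob_space Q0"
begin

lemma space_Q0 [simp]: "space Q0 = UNIV"
  using sets_eq_imp_space_eq[of Q0 "sigma UNIV (cylinder_sets UNIV)"] sets_Q0 by simp

lemma cylinder_in_Q0: "C \<in> cylinder_sets UNIV \<Longrightarrow> C \<in> sets Q0"
  unfolding sets_Q0 by (rule sigma_sets.Basic)

lemma dual_measurable_Q0: "f \<in> dual \<Longrightarrow> f \<in> borel_measurable Q0"
  using measurable_mono[OF order_refl refl _ , of "coord_algebra {f}" Q0 borel]
    coord_algebra_subset_cylinder_sets[of "{f}"] measurable_coord[of f "{f}"]
  by (auto intro: cylinder_in_Q0)

lemma coords_measurable_Q0: "I \<subseteq> dual \<Longrightarrow> coords I \<in> Q0 \<rightarrow>\<^sub>M borel_PiM I"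
  unfolding coords_def by (intro measurable_restrict dual_measurable_Q0) auto

text \<open>
  A kernel for the functionals in \<open>J\<close> is tested against cylinder sets of \<open>Y\<close>, since \<open>m\<close> is
  available on cylinder sets only.
\<close>

definition disintegrates :: "('z \<Rightarrow> real) set \<Rightarrow> ('y \<Rightarrow> (('z \<Rightarrow> real) \<Rightarrow> real) measure) \<Rightarrow> bool" where
  "disintegrates J \<kappa> \<longleftrightarrow> \<kappa> \<in> Q0 \<rightarrow>\<^sub>M prob_algebra (borel_PiM J) \<and>
    (\<forall>C\<in>cylinder_sets UNIV. \<forall>B\<in>sets (borel_PiM J).
      (\<integral>\<^sup>+y\<in>C. emeasure (\<kappa> y) B \<partial>Q0) = m {x. fst x \<in> C \<and> coords J (snd x) \<in> B})"

lemma disintegrates_measurable: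
  "disintegrates J \<kappa> \<Longrightarrow> \<kappa> \<in> Q0 \<rightarrow>\<^sub>M prob_algebra (borel_PiM J)"
  by (simp add: disintegrates_def)

lemma cylinder_conditions:
  assumes I: "finite I" "I \<subseteq> dual" and J: "finite J" "J \<subseteq> dual" and D: "D \<in> sets (borel_PiM I \<Otimes>\<^sub>M borel_PiM J)"
  shows "{x. (coords I (fst x), coords J (snd x)) \<in> D} \<in> sets (coord_algebra (lift_coords I J))"
  using measurable_sets[OF measurable_Pair[OF measurable_coords_fst[of I J] measurable_coords_snd[of J I]] D]
  by (simp add: vimage_def)

text \<open>
  For a fixed cylinder set \<open>C\<close> both sides are finite measures in \<open>B\<close>, and rectangles determine such
  measures.
\<close>

lemma disintegratesI:
  assumes J: "finite J" "J \<subseteq> dual" and \<kappa>: "\<kappa> \<in> Q0 \<rightarrow>\<^sub>M prob_algebra (borel_PiM J)"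
    and rect: "\<And>C A. C \<in> cylinder_sets UNIV \<Longrightarrow> (\<And>j. j \<in> J \<Longrightarrow> A j \<in> sets borel) \<Longrightarrow>
      (\<integral>\<^sup>+y\<in>C. emeasure (\<kappa> y) (Pi\<^sub>E J A) \<partial>Q0) = m {x. fst x \<in> C \<and> coords J (snd x) \<in> Pi\<^sub>E J A}"
  shows "disintegrates J \<kappa>"
  unfolding disintegrates_def
proof (intro conjI ballI \<kappa>)
  fix C :: "'y set" and B
  assume C: "C \<in> cylinder_sets UNIV" and B: "B \<in> sets (borel_PiM J)"
  obtain I where I: "finite I" "I \<subseteq> dual" "C \<in> sets (coord_algebra I)"
    using cylinder_setE[OF C] .
  let ?L = "lift_coords I J"
  define M where "M = coord_measure m ?L"
  have L: "finite ?L" "?L \<subseteq> dual"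
    using I J by (simp_all add: finite_lift_coords lift_coords_dual)
  have [measurable]: "C \<in> sets Q0" by (rule cylinder_in_Q0[OF C])
  have ne: "space (density Q0 (indicator C)) \<noteq> {}" by simp
  have \<kappa>s: "\<kappa> \<in> density Q0 (indicator C) \<rightarrow>\<^sub>M subprob_algebra (borel_PiM J)"
    using measurable_prob_algebraD[OF \<kappa>] by (simp cong: measurable_cong_sets)
  define M1 where "M1 = density Q0 (indicator C) \<bind> \<kappa>"
  have M1: "emeasure M1 X = (\<integral>\<^sup>+y\<in>C. emeasure (\<kappa> y) X \<partial>Q0)" if "X \<in> sets (borel_PiM J)" for X
    unfolding M1_def emeasure_bind[OF ne \<kappa>s that]
    using measurable_emeasure_kernel[OF measurable_prob_algebraD[OF \<kappa>] that]
    by (subst nn_integral_density) (auto simp: mult.commute)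
  have sM1: "sets M1 = sets (borel_PiM J)"
    unfolding M1_def using prob_algebra_kernelD(2)[OF \<kappa>] by (intro sets_bind) auto
  obtain A where A: "A \<in> sets (borel_PiM I)" "C = coords I -` A"
    using I(3) by (auto simp: sets_coord_algebra)
  have fC: "fst -` C \<in> sets M"
    using measurable_sets[OF measurable_coords_fst[of I J] A(1)]
    by (simp add: M_def A(2) vimage_def)
  have cJ: "(\<lambda>x. coords J (snd x)) \<in> M \<rightarrow>\<^sub>M borel_PiM J"
    using measurable_coords_snd[of J I] unfolding M_def by (simp cong: measurable_cong_sets)
  define M2 where "M2 = distr (density M (indicator (fst -` C))) (borel_PiM J) (\<lambda>x. coords J (snd x))"
  have M2: "emeasure M2 X = m {x. fst x \<in> C \<and> coords J (snd x) \<in> X}" if X: "X \<in> sets (borel_PiM J)" for X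
  proof -
    have Xs: "(\<lambda>x. coords J (snd x)) -` X \<in> sets M"
      using measurable_sets[OF cJ X] by (simp add: M_def)
    have "emeasure M2 X = emeasure (density M (indicator (fst -` C))) ((\<lambda>x. coords J (snd x)) -` X)"
      unfolding M2_def using cJ X by (subst emeasure_distr) (simp_all add: M_def)
    also have "\<dots> = emeasure M (fst -` C \<inter> (\<lambda>x. coords J (snd x)) -` X)"
      using fC Xs by (simp add: emeasure_density flip: indicator_inter_arith)
    also have "\<dots> = m (fst -` C \<inter> (\<lambda>x. coords J (snd x)) -` X)"
      unfolding M_def using fC Xs by (intro emeasure_coord_measure[OF m L]) (auto simp: M_def)
    also have "fst -` C \<inter> (\<lambda>x. coords J (snd x)) -` X = {x. fst x \<in> C \<and> coords J (snd x) \<in> X}"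
      by auto
    finally show ?thesis .
  qed
  have "M1 = M2"
  proof (rule measure_eqI_PiM_finite[OF J(1) sM1])
    show "sets M2 = sets (borel_PiM J)" by (simp add: M2_def)
    fix A assume A: "\<And>j. j \<in> J \<Longrightarrow> A j \<in> sets (borel :: real measure)"
    then have "Pi\<^sub>E J A \<in> sets (borel_PiM J)"
      using J(1) by (intro sets_PiM_I_finite) auto
    then show "emeasure M1 (Pi\<^sub>E J A) = emeasure M2 (Pi\<^sub>E J A)"
      using rect[OF C A] by (simp add: M1 M2)
  next
    show "range (\<lambda>_::nat. space (borel_PiM J)) \<subseteq> prod_algebra J (\<lambda>_. borel)"
      using J(1) by (auto simp: space_PiM intro!: prod_algebraI_finite)
    have "emeasure M1 (space (borel_PiM J)) \<le> (\<integral>\<^sup>+y. 1 \<partial>Q0)"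
      unfolding M1[OF sets.top] using prob_space.measure_le_1[OF prob_algebra_kernelD(1)[OF \<kappa>]]
      by (intro nn_integral_mono) (auto simp: indicator_def)
    then show "emeasure M1 (space (borel_PiM J)) \<noteq> \<infinity>"
      using prob_space.emeasure_space_1[OF prob_Q0] by (auto simp: top_unique)
  qed auto
  then show "(\<integral>\<^sup>+y\<in>C. emeasure (\<kappa> y) B \<partial>Q0) = m {x. fst x \<in> C \<and> coords J (snd x) \<in> B}"
    using M1[OF B] M2[OF B] by simp
qed

text \<open>
  The defining identity of \<open>disintegrates\<close> concerns rectangles \<open>A \<times> B\<close>.  Both sides are finite
  measures in \<open>D\<close>, hence they agree on all Borel sets of the product.
\<close>

lemma joint_law:
  assumes I: "finite I" "I \<subseteq> dual" and J: "finite J" "J \<subseteq> dual" and \<kappa>: "disintegrates J \<kappa>"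
    and D: "D \<in> sets (borel_PiM I \<Otimes>\<^sub>M borel_PiM J)"
  shows "(\<integral>\<^sup>+y. emeasure (\<kappa> y) (Pair (coords I y) -` D) \<partial>Q0) =
    m {x. (coords I (fst x), coords J (snd x)) \<in> D}"
proof -
  let ?L = "lift_coords I J" and ?N = "borel_PiM I \<Otimes>\<^sub>M borel_PiM J"
  have L: "finite ?L" "?L \<subseteq> dual"
    using I J by (simp_all add: finite_lift_coords lift_coords_dual)
  note \<kappa>m = disintegrates_measurable[OF \<kappa>]
  let ?P = "kernel_product Q0 (borel_PiM J) \<kappa>"
  let ?T = "\<lambda>x. (coords I (fst x), snd x)"
  have T0: "?T \<in> Q0 \<Otimes>\<^sub>M borel_PiM J \<rightarrow>\<^sub>M ?N"
    using coords_measurable_Q0[OF I(2)] by measurable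
  then have T: "?T \<in> ?P \<rightarrow>\<^sub>M ?N"
    using sets_kernel_product[OF prob_Q0 \<kappa>m] by (simp cong: measurable_cong_sets)
  define M1 where "M1 = distr ?P ?N ?T"
  have spP: "space ?P = UNIV \<times> space (borel_PiM J)"
    using sets_eq_imp_space_eq[OF sets_kernel_product[OF prob_Q0 \<kappa>m]] by (simp add: space_pair_measure)
  have M1: "emeasure M1 X = (\<integral>\<^sup>+y. emeasure (\<kappa> y) (Pair (coords I y) -` X) \<partial>Q0)"
    if X: "X \<in> sets ?N" for X
  proof -
    have "?T -` X \<inter> space ?P \<in> sets (Q0 \<Otimes>\<^sub>M borel_PiM J)"
      using measurable_sets[OF T X] sets_kernel_product[OF prob_Q0 \<kappa>m] by simp
    then have "emeasure M1 X = (\<integral>\<^sup>+y. emeasure (\<kappa> y) (Pair y -` (?T -` X \<inter> space ?P)) \<partial>Q0)"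
      unfolding M1_def emeasure_distr[OF T X] by (rule emeasure_kernel_product[OF prob_Q0 \<kappa>m])
    moreover have "Pair y -` (?T -` X \<inter> space ?P) = Pair (coords I y) -` X" for y
      using sets.sets_into_space[OF X] by (auto simp: spP space_pair_measure)
    ultimately show ?thesis by simp
  qed
  let ?M = "coord_measure m ?L"
  let ?U = "\<lambda>x. (coords I (fst x), coords J (snd x))"
  have U: "?U \<in> ?M \<rightarrow>\<^sub>M ?N"
    using measurable_Pair[OF measurable_coords_fst[of I J] measurable_coords_snd[of J I]]
    by (simp cong: measurable_cong_sets)
  define M2 where "M2 = distr ?M ?N ?U"
  have M2: "emeasure M2 X = m {x. ?U x \<in> X}" if X: "X \<in> sets ?N" for X
    unfolding M2_def emeasure_distr[OF U X]
    using emeasure_coord_measure[OF m L cylinder_conditions[OF I J X]] by (simp add: vimage_def)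
  have "M1 = M2"
  proof (rule measure_eqI_generator_eq[OF Int_stable_pair_measure_generator pair_measure_closed])
    show "sets M1 = sigma_sets (space (borel_PiM I) \<times> space (borel_PiM J))
        {a \<times> b |a b. a \<in> sets (borel_PiM I) \<and> b \<in> sets (borel_PiM J)}"
      "sets M2 = sigma_sets (space (borel_PiM I) \<times> space (borel_PiM J))
        {a \<times> b |a b. a \<in> sets (borel_PiM I) \<and> b \<in> sets (borel_PiM J)}"
      by (simp_all add: M1_def M2_def sets_pair_measure)
    fix X assume "X \<in> {a \<times> b |a b. a \<in> sets (borel_PiM I) \<and> b \<in> sets (borel_PiM J)}"
    then obtain A B where AB: "X = A \<times> B" "A \<in> sets (borel_PiM I)" "B \<in> sets (borel_PiM J)" by blast
    then have X: "X \<in> sets ?N" by simp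
    have C: "coords I -` A \<in> cylinder_sets UNIV"
      using coord_algebra_subset_cylinder_sets[OF I] AB(2) by (auto simp: sets_coord_algebra)
    have "emeasure M1 X = (\<integral>\<^sup>+y\<in>coords I -` A. emeasure (\<kappa> y) B \<partial>Q0)"
      unfolding M1[OF X] by (intro nn_integral_cong) (auto simp: AB(1) indicator_def)
    also have "\<dots> = m {x. fst x \<in> coords I -` A \<and> coords J (snd x) \<in> B}"
      using \<kappa> C AB(3) by (simp add: disintegrates_def)
    also have "\<dots> = emeasure M2 X"
      by (subst M2[OF X]) (simp add: AB(1))
    finally show "emeasure M1 X = emeasure M2 X" .
  next
    show "range (\<lambda>_::nat. space (borel_PiM I) \<times> space (borel_PiM J)) \<subseteq>
        {a \<times> b |a b. a \<in> sets (borel_PiM I) \<and> b \<in> sets (borel_PiM J)}"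
      by auto
    have "prob_space M1"
      unfolding M1_def by (rule prob_space.prob_space_distr[OF prob_space_kernel_product[OF prob_Q0 \<kappa>m] T])
    then show "emeasure M1 (space (borel_PiM I) \<times> space (borel_PiM J)) \<noteq> \<infinity>"
      by (rule finite_measure.emeasure_finite[OF prob_space.finite_measure, unfolded infinity_ennreal_def[symmetric]])
  qed auto
  then show ?thesis using M1[OF D] M2[OF D] by simp
qed

end

section \<open>Adding one functional\<close>

text \<open>
  A kernel to the product over a possibly uncountable set \<open>S\<close>, all of whose finite-dimensional
  marginals disintegrate \<open>m\<close>.  Below, \<open>P\<close> is the resulting law on \<open>Y \<times> \<real>\<^sup>S\<close>, and \<open>\<A>\<close> is the algebra of
  those sets that depend on finitely many functionals on \<open>Y\<close> and finitely many coordinates.  Their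
  preimages under \<open>embed\<close> are cylinder sets, so \<open>m\<close> can be evaluated there.
\<close>

locale consistent_kernel = cylindrical_product m Q0
  for m :: "('y::{real_vector,topological_space} \<times> 'z::{real_vector,topological_space}) set \<Rightarrow> ennreal"
    and Q0 :: "'y measure" +
  fixes S :: "('z \<Rightarrow> real) set" and K :: "'y \<Rightarrow> (('z \<Rightarrow> real) \<Rightarrow> real) measure"
  assumes S: "S \<subseteq> dual" and K: "K \<in> Q0 \<rightarrow>\<^sub>M prob_algebra (borel_PiM S)"
    and K_disintegrates: "\<And>J. finite J \<Longrightarrow> J \<subseteq> S \<Longrightarrow>
      disintegrates J (\<lambda>y. distr (K y) (borel_PiM J) (\<lambda>\<omega>. restrict \<omega> J))"
begin

lemma sets_K: "sets (K y) = sets (borel_PiM S)" and space_K: "space (K y) = space (borel_PiM S)"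
  and prob_K: "prob_space (K y)"
  using prob_algebra_kernelD[OF K, of y] by auto

definition \<Omega> :: "('y \<times> (('z \<Rightarrow> real) \<Rightarrow> real)) set" where
  "\<Omega> = UNIV \<times> space (borel_PiM S)"

definition P :: "('y \<times> (('z \<Rightarrow> real) \<Rightarrow> real)) measure" where
  "P = kernel_product Q0 (borel_PiM S) K"

definition proj where
  "proj I J x = (coords I (fst x), restrict (snd x) J)"
  for I :: "('y \<Rightarrow> real) set" and J :: "('z \<Rightarrow> real) set" and x :: "'y \<times> (('z \<Rightarrow> real) \<Rightarrow> real)"

definition proj_algebra where
  "proj_algebra = (\<lambda>(I, J). vimage_algebra \<Omega> (proj I J) (borel_PiM I \<Otimes>\<^sub>M borel_PiM J))"

definition index :: "(('y \<Rightarrow> real) set \<times> ('z \<Rightarrow> real) set) set" where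
  "index = {(I, J). finite I \<and> I \<subseteq> dual \<and> finite J \<and> J \<subseteq> S}"

definition \<A> where
  "\<A> = (\<Union>i\<in>index. sets (proj_algebra i))"

definition embed :: "'y \<times> 'z \<Rightarrow> 'y \<times> (('z \<Rightarrow> real) \<Rightarrow> real)" where
  "embed x = (fst x, coords S (snd x))"

lemma prob_P: "prob_space P" and sets_P: "sets P = sets (Q0 \<Otimes>\<^sub>M borel_PiM S)" and space_P: "space P = \<Omega>"
  using prob_space_kernel_product[OF prob_Q0 K] sets_kernel_product[OF prob_Q0 K]
    sets_eq_imp_space_eq[OF sets_kernel_product[OF prob_Q0 K]]
  by (auto simp: P_def \<Omega>_def space_pair_measure)

lemma proj_in_space: "x \<in> \<Omega> \<Longrightarrow> proj I J x \<in> space (borel_PiM I \<Otimes>\<^sub>M borel_PiM J)"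
  by (simp add: proj_def space_pair_measure coords_in_space) (simp add: space_PiM)

lemma sets_proj_algebra:
  "sets (proj_algebra (I, J)) = {proj I J -` D \<inter> \<Omega> |D. D \<in> sets (borel_PiM I \<Otimes>\<^sub>M borel_PiM J)}"
  unfolding proj_algebra_def by (simp add: proj_in_space sets_vimage_algebra2)

lemma \<A>_I:
  assumes "finite I" "I \<subseteq> dual" "finite J" "J \<subseteq> S" "D \<in> sets (borel_PiM I \<Otimes>\<^sub>M borel_PiM J)"
  shows "proj I J -` D \<inter> \<Omega> \<in> \<A>"
proof -
  have "(I, J) \<in> index" using assms by (simp add: index_def)
  then show ?thesis
    unfolding \<A>_def using assms(5) by (intro UN_I[of "(I, J)"]) (auto simp: sets_proj_algebra)
qed

lemma \<A>_E:
  assumes "G \<in> \<A>"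
  obtains I J D where "finite I" "I \<subseteq> dual" "finite J" "J \<subseteq> S"
    "D \<in> sets (borel_PiM I \<Otimes>\<^sub>M borel_PiM J)" "G = proj I J -` D \<inter> \<Omega>"
    "embed -` G = {x. (coords I (fst x), coords J (snd x)) \<in> D}"
proof -
  obtain I J where IJ: "(I, J) \<in> index" "G \<in> sets (proj_algebra (I, J))"
    using assms by (auto simp: \<A>_def)
  then obtain D where D: "D \<in> sets (borel_PiM I \<Otimes>\<^sub>M borel_PiM J)" "G = proj I J -` D \<inter> \<Omega>"
    by (auto simp: sets_proj_algebra)
  have J: "J \<subseteq> S" using IJ(1) by (simp add: index_def)
  have "restrict (coords S z) J = coords J z" for z
    using J by (auto simp: coords_def fun_eq_iff)
  then have "embed -` G = {x. (coords I (fst x), coords J (snd x)) \<in> D}"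
    by (auto simp: D(2) embed_def proj_def \<Omega>_def coords_in_space)
  with that IJ(1) D show thesis by (auto simp: index_def)
qed

lemma proj_algebra_mono:
  assumes "I \<subseteq> I'" "J \<subseteq> J'"
  shows "sets (proj_algebra (I, J)) \<subseteq> sets (proj_algebra (I', J'))"
proof
  fix G assume "G \<in> sets (proj_algebra (I, J))"
  then obtain D where D: "D \<in> sets (borel_PiM I \<Otimes>\<^sub>M borel_PiM J)" "G = proj I J -` D \<inter> \<Omega>"
    by (auto simp: sets_proj_algebra)
  define r where "r = (\<lambda>x::(('y \<Rightarrow> real) \<Rightarrow> real) \<times> (('z \<Rightarrow> real) \<Rightarrow> real). (restrict (fst x) I, restrict (snd x) J))"
  have r: "r \<in> borel_PiM I' \<Otimes>\<^sub>M borel_PiM J' \<rightarrow>\<^sub>M borel_PiM I \<Otimes>\<^sub>M borel_PiM J"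
    unfolding r_def using assms
    by (intro measurable_Pair measurable_compose[OF measurable_fst] measurable_compose[OF measurable_snd]
        measurable_restrict_subset)
  have r_proj: "r (proj I' J' x) = proj I J x" for x
    using assms by (auto simp: r_def proj_def coords_def fun_eq_iff)
  then have "G = proj I' J' -` (r -` D \<inter> space (borel_PiM I' \<Otimes>\<^sub>M borel_PiM J')) \<inter> \<Omega>"
    unfolding D(2) set_eq_iff Int_iff vimage_eq r_proj using proj_in_space by blast
  then show "G \<in> sets (proj_algebra (I', J'))"
    using measurable_sets[OF r D(1)] unfolding sets_proj_algebra by blast
qed

lemma algebra_\<A>: "algebra \<Omega> \<A>"
  unfolding \<A>_def
proof (rule algebra_directed_Union)
  have "({}, {}) \<in> index" by (simp add: index_def)
  then show "index \<noteq> {}" by blast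
  show "space (proj_algebra i) = \<Omega>" for i
    by (cases i) (simp add: proj_algebra_def)
  fix i j assume "i \<in> index" "j \<in> index"
  moreover obtain I J I' J' where "i = (I, J)" "j = (I', J')" by fastforce
  ultimately show "\<exists>k\<in>index. sets (proj_algebra i) \<subseteq> sets (proj_algebra k) \<and>
      sets (proj_algebra j) \<subseteq> sets (proj_algebra k)"
    by (intro bexI[of _ "(I \<union> I', J \<union> J')"] conjI)
      (simp_all add: proj_algebra_mono index_def)
qed

lemma measurable_proj:
  assumes "I \<subseteq> dual" "J \<subseteq> S"
  shows "proj I J \<in> Q0 \<Otimes>\<^sub>M borel_PiM S \<rightarrow>\<^sub>M borel_PiM I \<Otimes>\<^sub>M borel_PiM J"
  unfolding proj_def
  by (intro measurable_Pair measurable_compose[OF measurable_fst coords_measurable_Q0]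
      measurable_compose[OF measurable_snd measurable_restrict_subset] assms)

text \<open>
  Both coordinate projections are measurable with respect to the sigma-algebra generated by \<open>\<A>\<close>.
\<close>

lemma sets_P_eq: "sets P = sigma_sets \<Omega> \<A>"
proof
  interpret algebra \<Omega> \<A> by (rule algebra_\<A>)
  have "\<A> \<subseteq> sets P"
  proof
    fix G assume "G \<in> \<A>"
    then obtain I J D where G: "finite I" "I \<subseteq> dual" "finite J" "J \<subseteq> S"
        "D \<in> sets (borel_PiM I \<Otimes>\<^sub>M borel_PiM J)" "G = proj I J -` D \<inter> \<Omega>"
      by (elim \<A>_E)
    show "G \<in> sets P"
      using measurable_sets[OF measurable_proj[OF G(2,4)] G(5)]
      by (simp add: G(6) sets_P \<Omega>_def space_pair_measure)
  qed
  then show "sigma_sets \<Omega> \<A> \<subseteq> sets P"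
    using sets.sigma_sets_subset[of \<A> P] by (simp add: space_P)
  let ?\<Sigma> = "sigma \<Omega> \<A>"
  have space_\<Sigma>: "space ?\<Sigma> = \<Omega>" and sets_\<Sigma>: "sets ?\<Sigma> = sigma_sets \<Omega> \<A>"
    using space_closed by simp_all
  have proj: "proj I J \<in> ?\<Sigma> \<rightarrow>\<^sub>M borel_PiM I \<Otimes>\<^sub>M borel_PiM J"
    if "finite I" "I \<subseteq> dual" "finite J" "J \<subseteq> S" for I J
    using \<A>_I[OF that] by (intro measurableI) (auto simp: space_\<Sigma> sets_\<Sigma> proj_in_space)
  have "fst \<in> ?\<Sigma> \<rightarrow>\<^sub>M sigma UNIV (cylinder_sets UNIV)"
  proof (rule measurable_sigma_sets[of _ UNIV "cylinder_sets UNIV"])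
    fix C :: "'y set" assume "C \<in> cylinder_sets UNIV"
    then obtain I where I: "finite I" "I \<subseteq> dual" "C \<in> sets (coord_algebra I)"
      by (rule cylinder_setE)
    then obtain A where A: "A \<in> sets (borel_PiM I)" "C = coords I -` A"
      by (auto simp: sets_coord_algebra)
    have "(\<lambda>x. fst (proj I {} x)) \<in> ?\<Sigma> \<rightarrow>\<^sub>M borel_PiM I"
      by (rule measurable_compose[OF proj measurable_fst]) (use I in auto)
    from measurable_sets[OF this A(1)] show "fst -` C \<inter> space ?\<Sigma> \<in> sets ?\<Sigma>"
      by (simp add: A(2) proj_def vimage_def)
  qed auto
  then have "fst \<in> ?\<Sigma> \<rightarrow>\<^sub>M Q0"
    by (subst measurable_cong_sets[OF refl, of Q0 "sigma UNIV (cylinder_sets UNIV)"]) (simp_all add: sets_Q0)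
  moreover have "snd \<in> ?\<Sigma> \<rightarrow>\<^sub>M borel_PiM S"
  proof (rule measurable_PiM_single')
    show "snd \<in> space ?\<Sigma> \<rightarrow> (\<Pi>\<^sub>E i\<in>S. space borel)"
      unfolding space_\<Sigma> by (auto simp: \<Omega>_def space_PiM)
    fix i assume "i \<in> S"
    then have "(\<lambda>x. snd (proj {} {i} x) i) \<in> borel_measurable ?\<Sigma>"
      by (intro measurable_compose[OF measurable_compose[OF proj measurable_snd] measurable_component_singleton]) auto
    then show "(\<lambda>x. snd x i) \<in> borel_measurable ?\<Sigma>"
      by (simp add: proj_def)
  qed
  ultimately have "(\<lambda>x. (fst x, snd x)) \<in> ?\<Sigma> \<rightarrow>\<^sub>M Q0 \<Otimes>\<^sub>M borel_PiM S"
    by (rule measurable_Pair)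
  then have "(\<lambda>x. x) \<in> ?\<Sigma> \<rightarrow>\<^sub>M P"
    by (simp add: measurable_cong_sets[OF refl sets_P])
  then show "sets P \<subseteq> sigma_sets \<Omega> \<A>"
    using measurable_sets[of "\<lambda>x. x" ?\<Sigma> P] sets.sets_into_space[of _ P]
    by (fastforce simp: space_\<Sigma> sets_\<Sigma> space_P Int_absorb2)
qed

text \<open>
  On \<open>\<A>\<close>, the law \<open>P\<close> is the image of the finitely additive \<open>m\<close>.  This makes the set functions
  \<open>G \<mapsto> m {x. x \<in> embed -` G, h (snd x) \<in> E}\<close> dominated by \<open>P\<close>.
\<close>

lemma emeasure_P:
  assumes "G \<in> \<A>"
  shows "emeasure P G = m (embed -` G)"
proof -
  obtain I J D where G: "finite I" "I \<subseteq> dual" "finite J" "J \<subseteq> S"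
      "D \<in> sets (borel_PiM I \<Otimes>\<^sub>M borel_PiM J)" "G = proj I J -` D \<inter> \<Omega>"
      "embed -` G = {x. (coords I (fst x), coords J (snd x)) \<in> D}"
    using assms by (rule \<A>_E)
  let ?\<kappa> = "\<lambda>y. distr (K y) (borel_PiM J) (\<lambda>\<omega>. restrict \<omega> J)"
  have r: "(\<lambda>\<omega>. restrict \<omega> J) \<in> K y \<rightarrow>\<^sub>M borel_PiM J" for y
    unfolding measurable_cong_sets[OF sets_K refl] using G(4) by (rule measurable_restrict_subset)
  have "G \<in> sets (Q0 \<Otimes>\<^sub>M borel_PiM S)"
    using assms sets_P_eq sets_P by auto
  then have "emeasure P G = (\<integral>\<^sup>+y. emeasure (K y) (Pair y -` G) \<partial>Q0)"
    unfolding P_def by (rule emeasure_kernel_product[OF prob_Q0 K])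
  also have "\<dots> = (\<integral>\<^sup>+y. emeasure (?\<kappa> y) (Pair (coords I y) -` D) \<partial>Q0)"
  proof (rule nn_integral_cong)
    fix y
    have "Pair (coords I y) -` D \<in> sets (borel_PiM J)"
      by (rule sets_Pair1[OF G(5)])
    moreover have "Pair y -` G = (\<lambda>\<omega>. restrict \<omega> J) -` (Pair (coords I y) -` D) \<inter> space (K y)"
      by (auto simp: G(6) proj_def \<Omega>_def space_K)
    ultimately show "emeasure (K y) (Pair y -` G) = emeasure (?\<kappa> y) (Pair (coords I y) -` D)"
      by (simp add: emeasure_distr[OF r])
  qed
  also have "\<dots> = m (embed -` G)"
    unfolding G(7) using G(4) S
    by (intro joint_law[OF G(1-3)] K_disintegrates G) auto
  finally show ?thesis .
qed

end

context consistent_kernel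
begin

text \<open>
  The regular conditional law of \<open>h\<close> given the point \<open>y\<close> and all the coordinates in \<open>S\<close>.  Only its
  joint law with sets from \<open>\<A>\<close> is prescribed by \<open>m\<close>, and countable additivity is available only for
  fixed \<open>G\<close>: then all sets involved depend on the same finitely many functionals.
\<close>

lemma coordinate_given_past:
  assumes h: "h \<in> dual"
  obtains \<kappa> where "\<kappa> \<in> P \<rightarrow>\<^sub>M prob_algebra borel"
    "\<And>G E. G \<in> \<A> \<Longrightarrow> E \<in> sets borel \<Longrightarrow>
      (\<integral>\<^sup>+x\<in>G. emeasure (\<kappa> x) E \<partial>P) = m (embed -` G \<inter> (\<lambda>x. h (snd x)) -` E)"
proof -
  let ?\<nu> = "\<lambda>G E. m (embed -` G \<inter> (\<lambda>x. h (snd x)) -` E)"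
  have cyl: "\<exists>L. finite L \<and> L \<subseteq> dual \<and>
      (\<forall>E\<in>sets borel. embed -` G \<inter> (\<lambda>x. h (snd x)) -` E \<in> sets (coord_algebra L))"
    if G0: "G \<in> \<A>" for G
  proof -
    obtain I J D where G: "finite I" "I \<subseteq> dual" "finite J" "J \<subseteq> S"
        "D \<in> sets (borel_PiM I \<Otimes>\<^sub>M borel_PiM J)" "G = proj I J -` D \<inter> \<Omega>"
        "embed -` G = {x. (coords I (fst x), coords J (snd x)) \<in> D}"
      using G0 by (rule \<A>_E)
    let ?L = "lift_coords I (insert h J)"
    have "J \<subseteq> dual" using G(4) S by blast
    then have "embed -` G \<in> sets (coord_algebra (lift_coords I J))"
      unfolding G(7) by (intro cylinder_conditions G)
    moreover have "lift_coords I J \<subseteq> ?L" by (auto simp: lift_coords_def)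
    ultimately have 1: "embed -` G \<in> sets (coord_algebra ?L)"
      using sets_coord_algebra_mono by blast
    have "h \<circ> snd \<in> borel_measurable (coord_algebra ?L)"
      by (intro measurable_coord) (auto simp: lift_coords_def)
    then have 2: "(\<lambda>x. h (snd x)) -` E \<in> sets (coord_algebra ?L)" if "E \<in> sets borel" for E
      using measurable_sets[of "h \<circ> snd" "coord_algebra ?L" borel E] that by (simp add: vimage_def)
    have "finite ?L" "?L \<subseteq> dual"
      using G h \<open>J \<subseteq> dual\<close> by (simp_all add: finite_lift_coords lift_coords_dual)
    with 1 2 show ?thesis by blast
  qed
  have cyl': "embed -` G \<inter> (\<lambda>x. h (snd x)) -` E \<in> cylinder_sets UNIV"
    if "G \<in> \<A>" "E \<in> sets borel" for G E
    using cyl[OF that(1)] that(2) coord_algebra_subset_cylinder_sets by blast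
  define N where "N = (\<lambda>G. measure_of UNIV (sets (borel :: real measure)) (?\<nu> G))"
  have sN: "sets (N G) = sets borel" for G
    using sets.sigma_sets_eq[of "borel :: real measure"] by (simp add: N_def)
  have eN: "emeasure (N G) E = ?\<nu> G E" if G: "G \<in> \<A>" and E: "E \<in> sets borel" for G E
  proof (rule emeasure_measure_of[OF fun_cong[OF N_def]])
    show "positive (sets (N G)) (?\<nu> G)"
      using cylindrical_probability_empty[OF m] by (simp add: positive_def)
    obtain L where L: "finite L" "L \<subseteq> dual"
      "\<And>E. E \<in> sets borel \<Longrightarrow> embed -` G \<inter> (\<lambda>x. h (snd x)) -` E \<in> sets (coord_algebra L)"
      using cyl[OF G] by blast
    show "countably_additive (sets (N G)) (?\<nu> G)"
    proof (rule countably_additiveI)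
      fix B :: "nat \<Rightarrow> real set"
      assume B: "range B \<subseteq> sets (N G)" "disjoint_family B"
      let ?B = "\<lambda>i. embed -` G \<inter> (\<lambda>x. h (snd x)) -` B i"
      have Bi: "B i \<in> sets borel" for i using B(1) sN by auto
      have "range ?B \<subseteq> sets (coord_algebra L)" using L(3)[OF Bi] by auto
      moreover have "disjoint_family ?B"
        using B(2) unfolding disjoint_family_on_def by blast
      ultimately have "(\<Sum>i. m (?B i)) = m (\<Union>i. ?B i)"
        using countably_additive_coord_algebra[OF m L(1,2)] sets.countable_nat_UN[of ?B "coord_algebra L"]
        unfolding countably_additive_def by blast
      also have "(\<Union>i. ?B i) = embed -` G \<inter> (\<lambda>x. h (snd x)) -` (\<Union>i. B i)" by auto
      finally show "(\<Sum>i. m (?B i)) = m (embed -` G \<inter> (\<lambda>x. h (snd x)) -` (\<Union>i. B i))" .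
    qed
  qed (use E sN in auto)
  show thesis
  proof (rule conditional_kernel[OF prob_P algebra_\<A> sets_P_eq, of N])
    show "additive \<A> (\<lambda>G. emeasure (N G) E)" if E: "E \<in> sets borel" for E
      unfolding additive_def
    proof (intro ballI impI)
      interpret algebra \<Omega> \<A> by (rule algebra_\<A>)
      fix G G' assume G: "G \<in> \<A>" "G' \<in> \<A>" "G \<inter> G' = {}"
      let ?c = "\<lambda>G. embed -` G \<inter> (\<lambda>x. h (snd x)) -` E"
      have "m (?c G \<union> ?c G') = m (?c G) + m (?c G')"
        using m cyl'[OF G(1) E] cyl'[OF G(2) E] G(3)
        unfolding cylindrical_probability_def by (intro additiveD[of "cylinder_sets UNIV" m]) auto
      moreover have "?c G \<union> ?c G' = ?c (G \<union> G')" by auto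
      ultimately show "emeasure (N (G \<union> G')) E = emeasure (N G) E + emeasure (N G') E"
        using G E Un[OF G(1,2)] by (simp add: eN)
    qed
    show "emeasure (N G) UNIV = emeasure P G" if "G \<in> \<A>" for G
      using that by (simp add: eN emeasure_P)
  qed (use sN eN that in auto)
qed

text \<open>
  The coordinate \<open>h\<close> is sampled from its conditional law after the coordinates in \<open>S\<close>.  As this law
  has mass \<open>1\<close> at every point, the old marginal is preserved for every \<open>y\<close> and not just almost surely.
\<close>

lemma extend_by_coordinate:
  assumes h: "h \<in> dual" and hS: "h \<notin> S"
  obtains K' where "K' \<in> Q0 \<rightarrow>\<^sub>M prob_algebra (borel_PiM (insert h S))"
    "\<And>y. distr (K' y) (borel_PiM S) (\<lambda>\<omega>. restrict \<omega> S) = K y"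
    "\<And>J. finite J \<Longrightarrow> J \<subseteq> insert h S \<Longrightarrow>
      disintegrates J (\<lambda>y. distr (K' y) (borel_PiM J) (\<lambda>\<omega>. restrict \<omega> J))"
proof -
  obtain \<kappa> where \<kappa>: "\<kappa> \<in> P \<rightarrow>\<^sub>M prob_algebra borel"
    and \<kappa>_int: "\<And>G E. G \<in> \<A> \<Longrightarrow> E \<in> sets borel \<Longrightarrow>
      (\<integral>\<^sup>+x\<in>G. emeasure (\<kappa> x) E \<partial>P) = m (embed -` G \<inter> (\<lambda>x. h (snd x)) -` E)"
    using coordinate_given_past[OF h] by blast
  let ?N = "borel_PiM (insert h S)"
  define g where "g = (\<lambda>x. distr (\<kappa> x) ?N (\<lambda>t. fun_upd (snd x) h t))"
  define K' where "K' = (\<lambda>y. K y \<bind> (\<lambda>\<omega>. g (y, \<omega>)))"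
  have upd: "(\<lambda>x. fun_upd (snd (fst x)) h (snd x)) \<in> P \<Otimes>\<^sub>M borel \<rightarrow>\<^sub>M ?N"
  proof (rule measurable_fun_upd[where J=S])
    have "snd \<in> P \<rightarrow>\<^sub>M borel_PiM S"
      by (subst measurable_cong_sets[OF sets_P refl]) simp
    then show "(\<lambda>x. snd (fst x)) \<in> P \<Otimes>\<^sub>M borel \<rightarrow>\<^sub>M borel_PiM S"
      by (rule measurable_compose[OF measurable_fst])
  qed auto
  have upd1: "(\<lambda>t. fun_upd (snd x) h t) \<in> \<kappa> x \<rightarrow>\<^sub>M ?N" if "x \<in> space P" for x
    using measurable_compose[OF measurable_Pair1'[OF that] upd]
    by (simp add: measurable_cong_sets[OF prob_algebra_kernelD(2)[OF \<kappa> that] refl])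
  have "g \<in> P \<rightarrow>\<^sub>M prob_algebra ?N"
  proof (rule measurable_prob_algebraI)
    show "prob_space (g x)" if "x \<in> space P" for x
      unfolding g_def by (rule prob_space.prob_space_distr[OF prob_algebra_kernelD(1)[OF \<kappa> that] upd1[OF that]])
    show "g \<in> P \<rightarrow>\<^sub>M subprob_algebra ?N"
      unfolding g_def using upd
      by (intro measurable_distr2[OF _ measurable_prob_algebraD[OF \<kappa>]]) (simp add: split_beta')
  qed
  then have g: "g \<in> Q0 \<Otimes>\<^sub>M borel_PiM S \<rightarrow>\<^sub>M prob_algebra ?N"
    by (simp add: measurable_cong_sets[OF sets_P refl])
  have K'_meas: "K' \<in> Q0 \<rightarrow>\<^sub>M prob_algebra ?N"
    unfolding K'_def by (rule measurable_bind_prob_space2[OF K]) (use g in simp)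
  have in_P: "(y, \<omega>) \<in> space P" if "\<omega> \<in> space (borel_PiM S)" for y \<omega>
    using that by (simp add: space_P \<Omega>_def)
  have gy: "(\<lambda>\<omega>. g (y, \<omega>)) \<in> K y \<rightarrow>\<^sub>M subprob_algebra ?N" for y
    using measurable_compose[OF measurable_Pair1'[of y Q0] measurable_prob_algebraD[OF g]]
    by (simp add: measurable_cong_sets[OF sets_K refl])
  have K'_emeasure: "emeasure (K' y) X = (\<integral>\<^sup>+\<omega>. emeasure (\<kappa> (y, \<omega>)) {t. fun_upd \<omega> h t \<in> X} \<partial>K y)"
    if X: "X \<in> sets ?N" for X y
    unfolding K'_def emeasure_bind[OF prob_space.not_empty[OF prob_K] gy X]
  proof (rule nn_integral_cong)
    fix \<omega> assume "\<omega> \<in> space (K y)"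
    then have *: "(y, \<omega>) \<in> space P" using in_P by (simp add: space_K)
    have "space (\<kappa> (y, \<omega>)) = UNIV"
      using prob_algebra_kernelD(3)[OF \<kappa> *] by simp
    then show "emeasure (g (y, \<omega>)) X = emeasure (\<kappa> (y, \<omega>)) {t. fun_upd \<omega> h t \<in> X}"
      using emeasure_distr[OF upd1[OF *] X] by (simp add: g_def vimage_def)
  qed
  have sets_K': "sets (K' y) = sets ?N" and space_K': "space (K' y) = space ?N" for y
    using prob_algebra_kernelD[OF K'_meas, of y] by auto
  have \<kappa>1: "emeasure (\<kappa> (y, \<omega>)) UNIV = 1" if "\<omega> \<in> space (borel_PiM S)" for y \<omega>
    using prob_space.emeasure_space_1[OF prob_algebra_kernelD(1)[OF \<kappa> in_P[OF that]]]
      prob_algebra_kernelD(3)[OF \<kappa> in_P[OF that]] by simp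
  have restr: "(\<lambda>\<omega>. restrict \<omega> J) \<in> K' y \<rightarrow>\<^sub>M borel_PiM J" if "J \<subseteq> insert h S" for J y
    unfolding measurable_cong_sets[OF sets_K' refl] using that by (rule measurable_restrict_subset)
  have marginal: "distr (K' y) (borel_PiM S) (\<lambda>\<omega>. restrict \<omega> S) = K y" for y
  proof (rule measure_eqI)
    fix X assume "X \<in> sets (distr (K' y) (borel_PiM S) (\<lambda>\<omega>. restrict \<omega> S))"
    then have X: "X \<in> sets (borel_PiM S)" by simp
    let ?X = "(\<lambda>\<omega>. restrict \<omega> S) -` X \<inter> space ?N"
    have sX: "?X \<in> sets ?N"
      using measurable_sets[OF restr[of S y] X] by (simp add: space_K' sets_K' subset_insertI)
    have "emeasure (distr (K' y) (borel_PiM S) (\<lambda>\<omega>. restrict \<omega> S)) X = emeasure (K' y) ?X"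
      using X by (simp add: emeasure_distr[OF restr] space_K' subset_insertI)
    also have "\<dots> = (\<integral>\<^sup>+\<omega>. indicator X \<omega> \<partial>K y)"
      unfolding K'_emeasure[OF sX]
    proof (rule nn_integral_cong)
      fix \<omega> assume "\<omega> \<in> space (K y)"
      then have \<omega>: "\<omega> \<in> space (borel_PiM S)" by (simp add: space_K)
      have "restrict (fun_upd \<omega> h t) S = \<omega>" for t
        using \<omega> hS by (auto simp: space_PiM fun_eq_iff PiE_def extensional_def)
      moreover have "fun_upd \<omega> h t \<in> space ?N" for t
        using \<omega> by (auto simp: space_PiM PiE_def extensional_def)
      ultimately have "{t. fun_upd \<omega> h t \<in> ?X} = (if \<omega> \<in> X then UNIV else {})"
        by auto
      then show "emeasure (\<kappa> (y, \<omega>)) {t. fun_upd \<omega> h t \<in> ?X} = indicator X \<omega>"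
        using \<kappa>1[OF \<omega>] by simp
    qed
    also have "\<dots> = emeasure (K y) X"
      using X sets_K by simp
    finally show "emeasure (distr (K' y) (borel_PiM S) (\<lambda>\<omega>. restrict \<omega> S)) X = emeasure (K y) X" .
  qed (simp add: sets_K)
  have disint: "disintegrates J (\<lambda>y. distr (K' y) (borel_PiM J) (\<lambda>\<omega>. restrict \<omega> J))"
    if J: "finite J" "J \<subseteq> insert h S" for J
  proof (cases "h \<in> J")
    case False
    then have JS: "J \<subseteq> S" using J by blast
    have "distr (K' y) (borel_PiM J) (\<lambda>\<omega>. restrict \<omega> J) = distr (K y) (borel_PiM J) (\<lambda>\<omega>. restrict \<omega> J)" for y
      unfolding marginal[symmetric, of y]
      using JS by (subst distr_distr[OF measurable_restrict_subset[OF JS] restr])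
        (auto simp: comp_def Int_absorb1 intro!: distr_cong)
    then show ?thesis using K_disintegrates[OF J(1) JS] by simp
  next
    case True
    define J0 where "J0 = J - {h}"
    have J0: "finite J0" "J0 \<subseteq> S" "J = insert h J0" "h \<notin> J0"
      using J True by (auto simp: J0_def)
    show ?thesis
    proof (rule disintegratesI)
      show "J \<subseteq> dual" using J S h by blast
      show "(\<lambda>y. distr (K' y) (borel_PiM J) (\<lambda>\<omega>. restrict \<omega> J)) \<in> Q0 \<rightarrow>\<^sub>M prob_algebra (borel_PiM J)"
        by (rule measurable_compose[OF K'_meas measurable_distr_prob_space[OF measurable_restrict_subset[OF J(2)]]])
    next
      fix C :: "'y set" and A
      assume C: "C \<in> cylinder_sets UNIV" and A: "\<And>j. j \<in> J \<Longrightarrow> A j \<in> sets (borel :: real measure)"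
      obtain I where I: "finite I" "I \<subseteq> dual" "C \<in> sets (coord_algebra I)"
        using cylinder_setE[OF C] .
      then obtain B where B: "B \<in> sets (borel_PiM I)" "C = coords I -` B"
        by (auto simp: sets_coord_algebra)
      have Ah: "A h \<in> sets borel" using A True by blast
      have rectJ: "Pi\<^sub>E J A \<in> sets (borel_PiM J)" and rectJ0: "Pi\<^sub>E J0 A \<in> sets (borel_PiM J0)"
        using A J0 J(1) by (auto intro!: sets_PiM_I_finite)
      \<comment> \<open>The event that \<open>y\<close> lies in \<open>C\<close> and the old coordinates meet the conditions of the rectangle;
        what remains is the condition on \<open>h\<close>.\<close>
      define G where "G = proj I J0 -` (B \<times> Pi\<^sub>E J0 A) \<inter> \<Omega>"
      have G: "G \<in> \<A>"
        unfolding G_def using I J0 B(1) rectJ0 by (intro \<A>_I) auto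
      have [measurable]: "G \<in> sets P"
        using G sets_P_eq by auto
      let ?X = "(\<lambda>\<omega>. restrict \<omega> J) -` Pi\<^sub>E J A \<inter> space ?N"
      have sX: "?X \<in> sets ?N"
        using measurable_sets[OF restr[OF J(2)] rectJ] by (simp add: space_K' sets_K')
      have "(\<integral>\<^sup>+y\<in>C. emeasure (distr (K' y) (borel_PiM J) (\<lambda>\<omega>. restrict \<omega> J)) (Pi\<^sub>E J A) \<partial>Q0) =
          (\<integral>\<^sup>+y. \<integral>\<^sup>+\<omega>. emeasure (\<kappa> (y, \<omega>)) (A h) * indicator G (y, \<omega>) \<partial>K y \<partial>Q0)"
      proof (rule nn_integral_cong)
        fix y
        have "emeasure (distr (K' y) (borel_PiM J) (\<lambda>\<omega>. restrict \<omega> J)) (Pi\<^sub>E J A) = emeasure (K' y) ?X"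
          using rectJ by (simp add: emeasure_distr[OF restr[OF J(2)]] space_K')
        also have "\<dots> * indicator C y =
            (\<integral>\<^sup>+\<omega>. emeasure (\<kappa> (y, \<omega>)) (A h) * indicator G (y, \<omega>) \<partial>K y)"
        proof (cases "y \<in> C")
          case True
          have "emeasure (K' y) ?X = (\<integral>\<^sup>+\<omega>. emeasure (\<kappa> (y, \<omega>)) (A h) * indicator G (y, \<omega>) \<partial>K y)"
            unfolding K'_emeasure[OF sX]
          proof (rule nn_integral_cong)
            fix \<omega> assume "\<omega> \<in> space (K y)"
            then have \<omega>: "\<omega> \<in> space (borel_PiM S)" by (simp add: space_K)
            have "fun_upd \<omega> h t \<in> space ?N" for t
              using \<omega> by (auto simp: space_PiM PiE_def extensional_def)
            moreover have "restrict (fun_upd \<omega> h t) J \<in> Pi\<^sub>E J A \<longleftrightarrow> t \<in> A h \<and> restrict \<omega> J0 \<in> Pi\<^sub>E J0 A" for t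
              using J0(3,4) by (auto simp: PiE_iff)
            ultimately have "{t. fun_upd \<omega> h t \<in> ?X} = (if (y, \<omega>) \<in> G then A h else {})"
              using True \<omega> by (auto simp: G_def \<Omega>_def proj_def B(2))
            then show "emeasure (\<kappa> (y, \<omega>)) {t. fun_upd \<omega> h t \<in> ?X} =
                emeasure (\<kappa> (y, \<omega>)) (A h) * indicator G (y, \<omega>)"
              by simp
          qed
          then show ?thesis using True by simp
        next
          case False
          then have "indicator G (y, \<omega>) = (0 :: ennreal)" for \<omega>
            by (auto simp: G_def proj_def B(2) indicator_def)
          then show ?thesis using False by simp
        qed
        finally show "emeasure (distr (K' y) (borel_PiM J) (\<lambda>\<omega>. restrict \<omega> J)) (Pi\<^sub>E J A) * indicator C y =
            (\<integral>\<^sup>+\<omega>. emeasure (\<kappa> (y, \<omega>)) (A h) * indicator G (y, \<omega>) \<partial>K y)" .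
      qed
      also have "\<dots> = (\<integral>\<^sup>+x\<in>G. emeasure (\<kappa> x) (A h) \<partial>P)"
      proof -
        have "(\<lambda>x. emeasure (\<kappa> x) (A h) * indicator G x) \<in> borel_measurable P"
          using measurable_emeasure_kernel[OF measurable_prob_algebraD[OF \<kappa>] Ah] by measurable
        then have "(\<lambda>x. emeasure (\<kappa> x) (A h) * indicator G x) \<in> borel_measurable (Q0 \<Otimes>\<^sub>M borel_PiM S)"
          by (simp add: measurable_cong_sets[OF sets_P refl])
        from nn_integral_kernel_product[OF prob_Q0 K this] show ?thesis by (simp add: P_def)
      qed
      also have "\<dots> = m (embed -` G \<inter> (\<lambda>x. h (snd x)) -` A h)"
        by (rule \<kappa>_int[OF G Ah])
      also have "embed -` G \<inter> (\<lambda>x. h (snd x)) -` A h = {x. fst x \<in> C \<and> coords J (snd x) \<in> Pi\<^sub>E J A}"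
      proof -
        have "restrict (coords S z) J0 = coords J0 z" for z
          using J0(2) by (auto simp: coords_def fun_eq_iff)
        then have "proj I J0 (embed x) = (coords I (fst x), coords J0 (snd x))" for x
          by (simp add: proj_def embed_def)
        moreover have "embed x \<in> \<Omega>" for x
          by (simp add: embed_def \<Omega>_def coords_in_space)
        ultimately have "embed -` G = {x. fst x \<in> C \<and> coords J0 (snd x) \<in> Pi\<^sub>E J0 A}"
          by (simp add: G_def B(2) vimage_def)
        moreover have "coords J z \<in> Pi\<^sub>E J A \<longleftrightarrow> h z \<in> A h \<and> coords J0 z \<in> Pi\<^sub>E J0 A" for z
          unfolding J0(3) by (auto simp: coords_def PiE_iff)
        ultimately show ?thesis by auto
      qed
      finally show "(\<integral>\<^sup>+y\<in>C. emeasure (distr (K' y) (borel_PiM J) (\<lambda>\<omega>. restrict \<omega> J)) (Pi\<^sub>E J A) \<partial>Q0) =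
          m {x. fst x \<in> C \<and> coords J (snd x) \<in> Pi\<^sub>E J A}" .
    qed (rule J(1))
  qed
  from that[OF K'_meas marginal disint] show thesis .
qed

end

section \<open>Exhausting a set of functionals\<close>

context cylindrical_product
begin

text \<open>
  Consistency is demanded at every point \<open>y\<close>.
\<close>

definition consistent_family ::
  "('z \<Rightarrow> real) set \<Rightarrow> (('z \<Rightarrow> real) set \<Rightarrow> 'y \<Rightarrow> (('z \<Rightarrow> real) \<Rightarrow> real) measure) \<Rightarrow> bool" where
  "consistent_family S p \<longleftrightarrow>
    (\<forall>J. finite J \<and> J \<subseteq> S \<longrightarrow> disintegrates J (p J)) \<and>
    (\<forall>J H y. J \<subseteq> H \<and> finite H \<and> H \<subseteq> S \<longrightarrow>
      p J y = distr (p H y) (borel_PiM J) (\<lambda>\<omega>. restrict \<omega> J))"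

lemma consistent_family_kernel:
  assumes "consistent_family S p"
  obtains K where "K \<in> Q0 \<rightarrow>\<^sub>M prob_algebra (borel_PiM S)"
    "\<And>J y. finite J \<Longrightarrow> J \<subseteq> S \<Longrightarrow> distr (K y) (borel_PiM J) (\<lambda>\<omega>. restrict \<omega> J) = p J y"
proof (rule kolmogorov_kernel[of S p Q0])
  show "p J \<in> Q0 \<rightarrow>\<^sub>M prob_algebra (borel_PiM J)" if "finite J" "J \<subseteq> S" for J
    using assms that by (auto simp: consistent_family_def intro: disintegrates_measurable)
  show "p J y = distr (p H y) (borel_PiM J) (\<lambda>\<omega>. restrict \<omega> J)"
    if "J \<subseteq> H" "finite H" "H \<subseteq> S" "y \<in> space Q0" for J H y
    using assms that unfolding consistent_family_def by blast
qed (use that in auto)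

lemma consistent_family_extend:
  assumes S: "S \<subseteq> dual" and p: "consistent_family S p" and h: "h \<in> dual" "h \<notin> S"
  obtains p' where "consistent_family (insert h S) p'" "\<And>J. finite J \<Longrightarrow> J \<subseteq> S \<Longrightarrow> p' J = p J"
proof -
  obtain K where Kp: "K \<in> Q0 \<rightarrow>\<^sub>M prob_algebra (borel_PiM S)"
    "\<And>J y. finite J \<Longrightarrow> J \<subseteq> S \<Longrightarrow> distr (K y) (borel_PiM J) (\<lambda>\<omega>. restrict \<omega> J) = p J y"
    using consistent_family_kernel[OF p] by blast
  interpret consistent_kernel m Q0 S K
  proof
    show "disintegrates J (\<lambda>y. distr (K y) (borel_PiM J) (\<lambda>\<omega>. restrict \<omega> J))"
      if "finite J" "J \<subseteq> S" for J
      using that p by (simp add: Kp(2) consistent_family_def)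
  qed (fact S Kp(1))+
  obtain K' where K': "K' \<in> Q0 \<rightarrow>\<^sub>M prob_algebra (borel_PiM (insert h S))"
    "\<And>y. distr (K' y) (borel_PiM S) (\<lambda>\<omega>. restrict \<omega> S) = K y"
    "\<And>J. finite J \<Longrightarrow> J \<subseteq> insert h S \<Longrightarrow>
      disintegrates J (\<lambda>y. distr (K' y) (borel_PiM J) (\<lambda>\<omega>. restrict \<omega> J))"
    using extend_by_coordinate[OF h] by blast
  define p' where "p' = (\<lambda>J y. distr (K' y) (borel_PiM J) (\<lambda>\<omega>. restrict \<omega> J))"
  have restr: "(\<lambda>\<omega>. restrict \<omega> J) \<in> K' y \<rightarrow>\<^sub>M borel_PiM J" if "J \<subseteq> insert h S" for J y
    using prob_algebra_kernelD(2)[OF K'(1), of y] measurable_restrict_subset[OF that]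
    by (simp cong: measurable_cong_sets)
  have dd: "distr (distr (K' y) (borel_PiM H) (\<lambda>\<omega>. restrict \<omega> H)) (borel_PiM J) (\<lambda>\<omega>. restrict \<omega> J) =
      distr (K' y) (borel_PiM J) (\<lambda>\<omega>. restrict \<omega> J)" if "J \<subseteq> H" "H \<subseteq> insert h S" for J H y
    using that by (subst distr_distr[OF measurable_restrict_subset[OF that(1)] restr[OF that(2)]])
      (auto simp: comp_def Int_absorb1 intro!: distr_cong)
  show thesis
  proof (rule that)
    show "consistent_family (insert h S) p'"
      unfolding consistent_family_def p'_def using K'(3) dd by auto
    fix J assume J: "finite J" "J \<subseteq> S"
    show "p' J = p J"
    proof
      fix y
      show "p' J y = p J y"
        unfolding p'_def Kp(2)[OF J, symmetric] K'(2)[of y, symmetric] using J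
        by (intro dd[symmetric]) auto
    qed
  qed
qed

text \<open>
  The product over the empty index set is a point, which carries a unique probability.
\<close>

lemma consistent_family_empty: "\<exists>p. consistent_family {} p"
proof -
  define \<omega>0 where "\<omega>0 = (\<lambda>_::'z \<Rightarrow> real. undefined :: real)"
  define p where "p = (\<lambda>(J :: ('z \<Rightarrow> real) set) (y::'y). return (borel_PiM {}) \<omega>0)"
  have s: "space (borel_PiM {}) = {\<omega>0}" by (auto simp: space_PiM \<omega>0_def)
  have "disintegrates {} (p {})"
    unfolding disintegrates_def
  proof (intro conjI ballI)
    show "p {} \<in> Q0 \<rightarrow>\<^sub>M prob_algebra (borel_PiM {})"
      unfolding p_def using s
      by (intro measurable_const) (simp add: space_prob_algebra prob_space_return)
    fix C :: "'y set" and B :: "(('z \<Rightarrow> real) \<Rightarrow> real) set"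
    assume C: "C \<in> cylinder_sets UNIV" and B: "B \<in> sets (borel_PiM {})"
    have "B \<subseteq> {\<omega>0}" using sets.sets_into_space[OF B] s by simp
    then consider "B = {}" | "B = {\<omega>0}" by blast
    then show "(\<integral>\<^sup>+y\<in>C. emeasure (p {} y) B \<partial>Q0) = m {x. fst x \<in> C \<and> coords {} (snd x) \<in> B}"
    proof cases
      case 1
      then show ?thesis using cylindrical_probability_empty[OF m] by simp
    next
      case 2
      have "coords {} z = \<omega>0" for z :: 'z by (simp add: coords_def \<omega>0_def fun_eq_iff)
      then have "{x. fst x \<in> C \<and> coords {} (snd x) \<in> B} = fst -` C"
        using 2 by auto
      moreover have "emeasure (p {} y) B = 1" for y
        using 2 B by (simp add: p_def)
      ultimately show ?thesis
        using cylinder_in_Q0[OF C] emeasure_Q0[OF C] by simp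
    qed
  qed
  moreover have "p {} y = distr (p {} y) (borel_PiM {}) (\<lambda>\<omega>. restrict \<omega> {})" for y
  proof -
    have "distr (p {} y) (borel_PiM {}) (\<lambda>\<omega>. restrict \<omega> {}) = distr (p {} y) (p {} y) (\<lambda>\<omega>. \<omega>)"
      using s by (intro distr_cong) (auto simp: p_def \<omega>0_def)
    then show ?thesis by (simp add: distr_id2)
  qed
  ultimately have "consistent_family {} p"
    unfolding consistent_family_def by (metis subset_empty)
  then show ?thesis by blast
qed

text \<open>
  Families are encoded by their graphs, so that extension of families is inclusion and the
  union of a chain is again such a graph.
\<close>

definition family_graph where
  "family_graph S p = {(J, p J) |J. finite J \<and> J \<subseteq> S}"
  for S :: "('z \<Rightarrow> real) set" and p :: "('z \<Rightarrow> real) set \<Rightarrow> 'y \<Rightarrow> (('z \<Rightarrow> real) \<Rightarrow> real) measure"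

lemma Domain_family_graph: "\<Union> (Domain (family_graph S p)) = S"
  by (auto simp: family_graph_def Domain_unfold intro!: exI[of _ "{_}"])

text \<open>
  Every condition on a consistent family involves finitely many functionals, so it passes to
  unions of chains.  A maximal family must be indexed by all of \<open>H\<close>, since otherwise one more
  functional could be added.
\<close>

lemma exists_disintegration:
  assumes H: "H \<subseteq> dual"
  obtains K where "K \<in> Q0 \<rightarrow>\<^sub>M prob_algebra (borel_PiM H)"
    "\<And>J. finite J \<Longrightarrow> J \<subseteq> H \<Longrightarrow> disintegrates J (\<lambda>y. distr (K y) (borel_PiM J) (\<lambda>\<omega>. restrict \<omega> J))"
proof -
  define F where "F = {family_graph S p |S p. S \<subseteq> H \<and> consistent_family S p}"
  have F_I: "family_graph S p \<in> F" if "S \<subseteq> H" "consistent_family S p" for S p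
    using that unfolding F_def by blast
  have F_E: "\<exists>S p. X = family_graph S p \<and> S \<subseteq> H \<and> consistent_family S p" if "X \<in> F" for X
    using that unfolding F_def by blast
  have "\<exists>M\<in>F. \<forall>X\<in>F. M \<subseteq> X \<longrightarrow> X = M"
  proof (rule subset_Zorn_nonempty)
    show "F \<noteq> {}" using consistent_family_empty F_I by blast
    fix \<C> assume ne: "\<C> \<noteq> {}" and chain: "subset.chain F \<C>"
    let ?S = "\<lambda>X. \<Union> (Domain X)"
    have CF: "\<C> \<subseteq> F" using chain by (simp add: subset_chain_def)
    have XF: "\<exists>p. X = family_graph (?S X) p \<and> ?S X \<subseteq> H \<and> consistent_family (?S X) p" if X: "X \<in> \<C>" for X
    proof -
      obtain S p where "X = family_graph S p" "S \<subseteq> H" "consistent_family S p"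
        using F_E[OF subsetD[OF CF X]] by blast
      moreover from this(1) have "?S X = S" by (simp only: Domain_family_graph)
      ultimately show ?thesis by (intro exI[of _ p]) (simp only: simp_thms)
    qed
    then obtain q where q: "\<And>X. X \<in> \<C> \<Longrightarrow> X = family_graph (?S X) (q X)"
      "\<And>X. X \<in> \<C> \<Longrightarrow> ?S X \<subseteq> H" "\<And>X. X \<in> \<C> \<Longrightarrow> consistent_family (?S X) (q X)"
      by metis
    define T where "T = (\<Union>X\<in>\<C>. ?S X)"
    have nested: "X \<subseteq> Y \<or> Y \<subseteq> X" if "X \<in> \<C>" "Y \<in> \<C>" for X Y
      using that chain unfolding subset_chain_def by blast
    have cover: "\<exists>X\<in>\<C>. J \<subseteq> ?S X" if J: "finite J" "J \<subseteq> T" for J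
    proof -
      have ch: "subset.chain UNIV (?S ` \<C>)"
        unfolding subset_chain_def
      proof (intro conjI ballI)
        fix A B assume "A \<in> ?S ` \<C>" "B \<in> ?S ` \<C>"
        then obtain X Y where "X \<in> \<C>" "Y \<in> \<C>" "A = ?S X" "B = ?S Y" by blast
        then show "A \<subseteq> B \<or> B \<subseteq> A"
          using nested[of X Y] by (metis Domain_mono Union_mono)
      qed simp
      have "J \<subseteq> \<Union> (?S ` \<C>)" using J(2) by (auto simp: T_def)
      moreover have "?S ` \<C> \<noteq> {}" using ne by simp
      ultimately obtain B where "B \<in> ?S ` \<C>" "J \<subseteq> B"
        using finite_subset_Union_chain[OF J(1) _ _ ch] by blast
      then show ?thesis by blast
    qed
    have mem: "(J, \<kappa>) \<in> X \<longleftrightarrow> finite J \<and> J \<subseteq> ?S X \<and> \<kappa> = q X J" if X: "X \<in> \<C>" for X J \<kappa>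
    proof -
      have "(J, \<kappa>) \<in> family_graph (?S X) (q X) \<longleftrightarrow> finite J \<and> J \<subseteq> ?S X \<and> \<kappa> = q X J"
        by (auto simp: family_graph_def)
      then show ?thesis by (simp only: q(1)[OF X, symmetric])
    qed
    have agree: "q X J = q Y J"
      if X: "X \<in> \<C>" "J \<subseteq> ?S X" and Y: "Y \<in> \<C>" "J \<subseteq> ?S Y" and J: "finite J" for X Y J
    proof -
      have "(J, q X J) \<in> X" "(J, q Y J) \<in> Y"
        using mem[OF X(1)] mem[OF Y(1)] X(2) Y(2) J by simp_all
      then have "(J, q X J) \<in> Y \<or> (J, q Y J) \<in> X"
        using nested[OF X(1) Y(1)] subsetD by metis
      then show ?thesis
        unfolding mem[OF X(1)] mem[OF Y(1)] by metis
    qed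
    define p where "p = (\<lambda>J. q (SOME X. X \<in> \<C> \<and> J \<subseteq> ?S X) J)"
    have p: "p J = q X J" if X: "X \<in> \<C>" "finite J" "J \<subseteq> ?S X" for X J
    proof -
      let ?Y = "SOME X. X \<in> \<C> \<and> J \<subseteq> ?S X"
      have "?Y \<in> \<C> \<and> J \<subseteq> ?S ?Y"
        by (rule someI[of "\<lambda>X. X \<in> \<C> \<and> J \<subseteq> ?S X" X]) (use X in simp)
      then show ?thesis
        unfolding p_def using X by (intro agree) auto
    qed
    have "consistent_family T p"
      unfolding consistent_family_def
    proof (intro conjI allI impI)
      fix J assume J: "finite J \<and> J \<subseteq> T"
      then obtain X where X: "X \<in> \<C>" "J \<subseteq> ?S X" using cover by blast
      then show "disintegrates J (p J)"
        using J q(3)[OF X(1)] p[OF X(1) _ X(2)] by (auto simp: consistent_family_def)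
    next
      fix J L y assume *: "J \<subseteq> L \<and> finite L \<and> L \<subseteq> T"
      then obtain X where X: "X \<in> \<C>" "L \<subseteq> ?S X" using cover by blast
      have "finite J" "J \<subseteq> ?S X" using * X finite_subset by auto
      then have "p J = q X J" "p L = q X L" using p X * by auto
      then show "p J y = distr (p L y) (borel_PiM J) (\<lambda>\<omega>. restrict \<omega> J)"
        using q(3)[OF X(1)] * X(2) by (simp add: consistent_family_def)
    qed
    moreover have "T \<subseteq> H" using q(2) by (auto simp: T_def)
    moreover have "\<Union>\<C> = family_graph T p"
    proof (intro set_eqI iffI)
      fix x assume "x \<in> \<Union>\<C>"
      then obtain X where X: "X \<in> \<C>" "x \<in> X" by (rule UnionE)
      obtain J \<kappa> where x: "x = (J, \<kappa>)" by fastforce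
      then have J: "finite J" "J \<subseteq> ?S X" "\<kappa> = q X J"
        using mem[OF X(1), of J \<kappa>] X(2) by simp_all
      then have "\<kappa> = p J" "J \<subseteq> T" using p[OF X(1) J(1,2)] X(1) by (auto simp: T_def)
      then show "x \<in> family_graph T p" using J(1) by (simp add: family_graph_def x)
    next
      fix x assume "x \<in> family_graph T p"
      then obtain J where J: "x = (J, p J)" "finite J" "J \<subseteq> T" by (auto simp: family_graph_def)
      then obtain X where X: "X \<in> \<C>" "J \<subseteq> ?S X" using cover by blast
      then have "x \<in> X" using mem[OF X(1), of J "p J"] p[OF X(1) J(2) X(2)] J by simp
      then show "x \<in> \<Union>\<C>" using X(1) by (rule UnionI[rotated])
    qed
    ultimately show "\<Union>\<C> \<in> F" by (simp add: F_I)
  qed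
  then obtain M where M: "M \<in> F" "\<forall>X\<in>F. M \<subseteq> X \<longrightarrow> X = M" by (rule bexE)
  obtain S p where Sp: "M = family_graph S p" "S \<subseteq> H" "consistent_family S p"
    using F_E[OF M(1)] by blast
  have max: "X = family_graph S p" if "X \<in> F" "family_graph S p \<subseteq> X" for X
    using M(2) that unfolding Sp(1) by simp
  have "S = H"
  proof (rule ccontr)
    assume "S \<noteq> H"
    then obtain h where h: "h \<in> H" "h \<notin> S" using Sp(2) by blast
    obtain p' where p': "consistent_family (insert h S) p'"
      "\<And>J. finite J \<Longrightarrow> J \<subseteq> S \<Longrightarrow> p' J = p J"
      using consistent_family_extend[OF order_trans[OF Sp(2) H] Sp(3), of h] H h by blast
    have "family_graph S p \<subseteq> family_graph (insert h S) p'"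
      using p'(2) by (auto simp: family_graph_def)
    moreover have "family_graph (insert h S) p' \<in> F"
      using p'(1) h(1) Sp(2) by (intro F_I) auto
    ultimately have "family_graph (insert h S) p' = family_graph S p" by (intro max)
    then have "insert h S = S" by (metis Domain_family_graph)
    with h(2) show False by blast
  qed
  with Sp(3) have p: "consistent_family H p" by (rule subst[rotated])
  obtain K where K: "K \<in> Q0 \<rightarrow>\<^sub>M prob_algebra (borel_PiM H)"
    "\<And>J y. finite J \<Longrightarrow> J \<subseteq> H \<Longrightarrow> distr (K y) (borel_PiM J) (\<lambda>\<omega>. restrict \<omega> J) = p J y"
    using consistent_family_kernel[OF p] by blast
  show thesis
    using p by (intro that[OF K(1)]) (simp add: K(2) consistent_family_def)
qed

end

section \<open>Cylindrical probabilities from measures on a basis of the dual\<close>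

lemma dual_linear: "f \<in> dual \<Longrightarrow> linear f"
  by (rule linearI) (auto simp: dual_def continuous_linear_on_def)

lemma sum_fun_apply: "(\<Sum>h\<in>J. g h) z = (\<Sum>h\<in>J. g h z)" for g :: "'b \<Rightarrow> 'a \<Rightarrow> real"
  by (induction J rule: infinite_finite_induct) auto

text \<open>
  By induction, adding \<open>h\<close> to \<open>J\<close>.  If \<open>h\<close> vanished on the common kernel of \<open>J\<close>, then a dual system \<open>e\<close>
  for \<open>J\<close> would express \<open>h\<close> as a linear combination of \<open>J\<close>.  So some \<open>w\<close> in the common kernel has
  \<open>h w \<noteq> 0\<close>, and a multiple of \<open>w\<close> corrects the value of \<open>h\<close>.
\<close>

lemma independent_functionals_jointly_onto:
  fixes J :: "('a::real_vector \<Rightarrow> real) set"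
  assumes "finite J" "independent J" "\<And>f. f \<in> J \<Longrightarrow> linear f"
  shows "\<exists>z. \<forall>f\<in>J. f z = c f"
  using assms
proof (induction J arbitrary: c rule: finite_induct)
  case (insert h J)
  have lin: "linear h" "\<And>f. f \<in> J \<Longrightarrow> linear f" using insert.prems by auto
  have "independent J" using insert.prems(1) by (rule independent_mono) auto
  then have IH: "\<exists>z. \<forall>f\<in>J. f z = c f" for c
    using insert.IH lin by blast
  have "\<exists>w. (\<forall>f\<in>J. f w = 0) \<and> h w \<noteq> 0"
  proof (rule ccontr)
    assume "\<nexists>w. (\<forall>f\<in>J. f w = 0) \<and> h w \<noteq> 0"
    then have vanish: "h w = 0" if "\<And>f. f \<in> J \<Longrightarrow> f w = 0" for w
      using that by blast
    have "\<forall>g. \<exists>e. \<forall>f\<in>J. f e = (if f = g then 1 else 0)"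
    proof
      fix g show "\<exists>e. \<forall>f\<in>J. f e = (if f = g then 1 else 0)"
        using IH[of "\<lambda>f. if f = g then 1 else 0"] .
    qed
    then obtain e where e: "\<And>f g. f \<in> J \<Longrightarrow> f (e g) = (if f = g then 1 else 0)"
      by metis
    have "h z = (\<Sum>g\<in>J. h (e g) *\<^sub>R g) z" for z
    proof -
      have "h (z - (\<Sum>g\<in>J. g z *\<^sub>R e g)) = 0"
      proof (rule vanish)
        fix f assume f: "f \<in> J"
        then show "f (z - (\<Sum>g\<in>J. g z *\<^sub>R e g)) = 0"
          using lin(2)[OF f] insert.hyps(1)
          by (simp add: linear_diff linear_sum linear_cmul e if_distrib[of "(*) _"] cong: if_cong)
      qed
      then have "h z = (\<Sum>g\<in>J. g z * h (e g))"
        using lin(1) by (simp add: linear_diff linear_sum linear_cmul)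
      then show ?thesis
        by (simp add: sum_fun_apply scaleR_fun_def mult.commute)
    qed
    then have "h = (\<Sum>g\<in>J. h (e g) *\<^sub>R g)" by blast
    then have "h \<in> span J"
      by (metis (no_types, lifting) span_base span_scale span_sum)
    then show False
      using insert.prems(1) insert.hyps(2) by (simp add: independent_insert)
  qed
  then obtain w where w: "\<And>f. f \<in> J \<Longrightarrow> f w = 0" "h w \<noteq> 0" by blast
  obtain z0 where z0: "\<And>f. f \<in> J \<Longrightarrow> f z0 = c f" using IH by blast
  let ?z = "z0 + ((c h - h z0) / h w) *\<^sub>R w"
  have "f ?z = c f" if "f \<in> insert h J" for f
    using that w z0 lin by (auto simp: linear_add linear_cmul)
  then show ?case by blast
qed simp

locale dual_basis =
  fixes H :: "('z::{real_vector,topological_space} \<Rightarrow> real) set"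
  assumes H_dual: "H \<subseteq> dual" and H_indep: "independent H" and H_span: "dual \<subseteq> span H"
begin

lemma coords_onto:
  assumes "finite J" "J \<subseteq> H"
  obtains z where "\<forall>j\<in>J. j z = \<omega> j"
  using independent_functionals_jointly_onto[OF assms(1) independent_mono[OF H_indep assms(2)], of \<omega>]
    dual_linear H_dual assms(2) by blast

lemma factor_through_basis:
  assumes b: "continuous_linear_on UNIV (Rn n) b"
  obtains J \<beta> where "finite J" "J \<subseteq> H" "\<beta> \<in> borel_PiM J \<rightarrow>\<^sub>M borel_Rn n" "b = \<beta> \<circ> coords J"
proof -
  define P where "P i J c \<longleftrightarrow> finite J \<and> J \<subseteq> H \<and> (\<lambda>z. b z i) = (\<Sum>h\<in>J. c h *\<^sub>R h)" for i J c
  have "\<exists>J c. P i J c" for i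
  proof -
    have "(\<lambda>z. b z i) \<in> span H"
      using b by (intro subsetD[OF H_span]) (simp add: continuous_linear_on_Rn_iff)
    then show ?thesis unfolding span_explicit P_def by blast
  qed
  then obtain J c where P: "\<And>i. P i (J i) (c i)" by metis
  then have J: "\<And>i. finite (J i)" "\<And>i. J i \<subseteq> H"
    "\<And>i. (\<lambda>z. b z i) = (\<Sum>h\<in>J i. c i h *\<^sub>R h)"
    unfolding P_def by blast+
  have bz: "b z i = (\<Sum>h\<in>J i. c i h * h z)" for z i
    using fun_cong[OF J(3)[of i], of z] by (simp add: sum_fun_apply scaleR_fun_def)
  define L where "L = (\<Union>i<n. J i)"
  define \<beta> where "\<beta> = (\<lambda>\<omega> i. if i < n then \<Sum>h\<in>J i. c i h * \<omega> h else 0)"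
  show thesis
  proof (rule that)
    show "finite L" "L \<subseteq> H" using J(1,2) by (auto simp: L_def)
    show "\<beta> \<in> borel_PiM L \<rightarrow>\<^sub>M borel_Rn n"
      unfolding measurable_borel_Rn_iff
    proof (intro conjI ballI allI)
      show "\<beta> x \<in> Rn n" for x by (simp add: \<beta>_def Rn_iff)
      fix i show "(\<lambda>x. \<beta> x i) \<in> borel_measurable (borel_PiM L)"
      proof (cases "i < n")
        case True
        then have "J i \<subseteq> L" by (auto simp: L_def)
        then have "(\<lambda>x. \<Sum>h\<in>J i. c i h * x h) \<in> borel_measurable (borel_PiM L)"
          by (intro borel_measurable_sum borel_measurable_times borel_measurable_const
              measurable_component_singleton) auto
        then show ?thesis using True by (simp add: \<beta>_def)
      qed (simp add: \<beta>_def)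
    qed
    show "b = \<beta> \<circ> coords L"
    proof (intro ext)
      fix z i show "b z i = (\<beta> \<circ> coords L) z i"
      proof (cases "i < n")
        case True
        then have "J i \<subseteq> L" by (auto simp: L_def)
        then show ?thesis
          using True by (auto simp: \<beta>_def bz coords_def intro!: sum.cong)
      next
        case False
        then show ?thesis using b by (simp add: \<beta>_def continuous_linear_on_Rn_iff Rn_iff)
      qed
    qed
  qed
qed

lemma cylinder_over_basis:
  assumes "C \<in> cylinder_sets UNIV"
  obtains J where "finite J" "J \<subseteq> H" "C \<in> sets (coord_algebra J)"
proof -
  obtain k u B where *: "continuous_linear_on UNIV (Rn k) u" "B \<in> sets (borel_Rn k)" "C = u -` B"
    using assms by (auto simp: cylinder_sets_def)
  obtain J \<beta> where J: "finite J" "J \<subseteq> H" "\<beta> \<in> borel_PiM J \<rightarrow>\<^sub>M borel_Rn k" "u = \<beta> \<circ> coords J"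
    using factor_through_basis[OF *(1)] .
  have "C = coords J -` (\<beta> -` B \<inter> space (borel_PiM J))"
    by (auto simp: *(3) J(4) coords_in_space)
  then show thesis
    using that[OF J(1,2)] measurable_sets[OF J(3) *(2)] unfolding sets_coord_algebra by blast
qed

text \<open>
  The finite-dimensional cylinder in \<open>\<real>\<^sup>H\<close> whose preimage under \<open>z \<mapsto> (h z)\<close> is the cylinder set \<open>C\<close>.
  Quantifying over \<open>J\<close> avoids a choice among the representations of \<open>C\<close>.
\<close>

definition cylinder_lift :: "'z set \<Rightarrow> (('z \<Rightarrow> real) \<Rightarrow> real) set" where
  "cylinder_lift C = {\<omega> \<in> space (borel_PiM H). \<exists>J z. finite J \<and> J \<subseteq> H \<and>
    C \<in> sets (coord_algebra J) \<and> z \<in> C \<and> (\<forall>j\<in>J. j z = \<omega> j)}"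

text \<open>
  Two representations of the same cylinder set give the same cylinder in \<open>\<real>\<^sup>H\<close>, because finitely
  many coordinates of any \<open>\<omega>\<close> are attained by some \<open>z\<close>.
\<close>

lemma cylinder_lift_eq:
  assumes J: "finite J" "J \<subseteq> H" and B: "B \<in> sets (borel_PiM J)"
  shows "cylinder_lift (coords J -` B) = (\<lambda>\<omega>. restrict \<omega> J) -` B \<inter> space (borel_PiM H)"
proof (intro set_eqI iffI)
  fix \<omega> assume "\<omega> \<in> cylinder_lift (coords J -` B)"
  then obtain J' z where *: "\<omega> \<in> space (borel_PiM H)" "finite J'" "J' \<subseteq> H"
    "coords J -` B \<in> sets (coord_algebra J')" "z \<in> coords J -` B" "\<And>j. j \<in> J' \<Longrightarrow> j z = \<omega> j"
    by (auto simp: cylinder_lift_def)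
  obtain B' where B': "coords J -` B = coords J' -` B'"
    using *(4) by (auto simp: sets_coord_algebra)
  obtain z' where z': "\<forall>j\<in>J \<union> J'. j z' = \<omega> j"
    using coords_onto[of "J \<union> J'" \<omega>] J *(2,3) by auto
  have "coords J' z' = coords J' z"
    unfolding coords_def
  proof (rule restrict_ext)
    fix j assume "j \<in> J'"
    then show "j z' = j z" using z' *(6)[of j] by simp
  qed
  then have "z' \<in> coords J -` B"
    using *(5) unfolding B' by simp
  moreover have "coords J z' = restrict \<omega> J"
    using z' by (auto simp: coords_def fun_eq_iff)
  ultimately show "\<omega> \<in> (\<lambda>\<omega>. restrict \<omega> J) -` B \<inter> space (borel_PiM H)"
    using *(1) by simp
next
  fix \<omega> assume \<omega>: "\<omega> \<in> (\<lambda>\<omega>. restrict \<omega> J) -` B \<inter> space (borel_PiM H)"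
  obtain z where z: "\<forall>j\<in>J. j z = \<omega> j" using coords_onto[OF J] .
  then have "coords J z = restrict \<omega> J" by (auto simp: coords_def fun_eq_iff)
  then have "z \<in> coords J -` B" using \<omega> by simp
  moreover have "coords J -` B \<in> sets (coord_algebra J)"
    using B by (auto simp: sets_coord_algebra)
  ultimately show "\<omega> \<in> cylinder_lift (coords J -` B)"
    unfolding cylinder_lift_def using \<omega> J z by blast
qed

text \<open>
  Disjointness can be tested on \<open>Z\<close>, again because finitely many coordinates are jointly onto.
\<close>

lemma coords_vimage_disjointD:
  assumes J: "finite J" "J \<subseteq> H" and "coords J -` A \<inter> coords J -` B = {}"
  shows "(\<lambda>\<omega>. restrict \<omega> J) -` A \<inter> (\<lambda>\<omega>. restrict \<omega> J) -` B = {}"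
proof (rule ccontr)
  assume "\<not> ?thesis"
  then obtain \<omega> where \<omega>: "restrict \<omega> J \<in> A" "restrict \<omega> J \<in> B" by blast
  obtain z where z: "\<forall>j\<in>J. j z = \<omega> j" using coords_onto[OF J] .
  then have "coords J z = restrict \<omega> J" by (auto simp: coords_def fun_eq_iff)
  with \<omega> assms(3) show False by auto
qed

text \<open>
  Up to the map \<open>C \<mapsto> cylinder_lift C\<close>, a cylindrical probability on \<open>Z\<close> is the restriction of a
  measure on \<open>\<real>\<^sup>H\<close> to finite-dimensional cylinders.  The image of \<open>z\<close> may be negligible in
  \<open>\<real>\<^sup>H\<close>, so countable additivity holds only over a fixed finite set of functionals.
\<close>

lemma cylindrical_probability_cylinder_lift:
  assumes R: "prob_space R" "sets R = sets (borel_PiM H)"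
  shows "cylindrical_probability UNIV (\<lambda>C. emeasure R (cylinder_lift C))" (is "cylindrical_probability UNIV ?\<mu>")
proof -
  have sp: "space R = space (borel_PiM H)" by (rule sets_eq_imp_space_eq[OF R(2)])
  have "cylinder_lift (coords {} -` space (borel_PiM {})) =
      (\<lambda>\<omega>. restrict \<omega> {}) -` space (borel_PiM {}) \<inter> space (borel_PiM H)"
    by (rule cylinder_lift_eq) auto
  also have "coords {} -` space (borel_PiM {}) = (UNIV :: 'z set)"
    by (simp add: vimage_def coords_in_space)
  also have "(\<lambda>\<omega>. restrict \<omega> {}) -` space (borel_PiM {}) \<inter> space (borel_PiM H) = space R"
    by (auto simp: sp space_PiM)
  finally have UNIV: "?\<mu> UNIV = 1"
    using prob_space.emeasure_space_1[OF R(1)] by simp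
  have empty: "?\<mu> {} = 0"
    using cylinder_lift_eq[of "{}" "{}"] by simp
  have ca: "countably_additive (sets (coord_algebra J)) ?\<mu>" if J: "finite J" "J \<subseteq> H" for J
  proof (rule countably_additiveI)
    fix C :: "nat \<Rightarrow> 'z set"
    assume C: "range C \<subseteq> sets (coord_algebra J)" "disjoint_family C"
    have "\<exists>B. B \<in> sets (borel_PiM J) \<and> C i = coords J -` B" for i
    proof -
      have "C i \<in> sets (coord_algebra J)" using C(1) by (rule range_subsetD)
      then show ?thesis by (rule coord_algebraE) (intro exI conjI)
    qed
    then obtain B where B: "\<And>i. B i \<in> sets (borel_PiM J)" "\<And>i. C i = coords J -` B i" by metis
    let ?r = "\<lambda>\<omega>. restrict \<omega> J"
    let ?D = "\<lambda>i. ?r -` B i \<inter> space (borel_PiM H)"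
    have lift: "cylinder_lift (C i) = ?D i" for i
      unfolding B(2) by (rule cylinder_lift_eq[OF J B(1)])
    have "range ?D \<subseteq> sets R"
      using measurable_sets[OF measurable_restrict_subset[OF J(2)] B(1)] R(2) by auto
    moreover have "disjoint_family ?D"
      unfolding disjoint_family_on_def
    proof (intro ballI impI)
      fix i j :: nat assume "i \<noteq> j"
      then have "C i \<inter> C j = {}" using C(2) by (simp add: disjoint_family_on_def)
      then show "?D i \<inter> ?D j = {}"
        using coords_vimage_disjointD[OF J, of "B i" "B j"] by (auto simp: B(2))
    qed
    ultimately have "(\<Sum>i. ?\<mu> (C i)) = emeasure R (\<Union>i. ?D i)"
      unfolding lift by (rule suminf_emeasure)
    also have "(\<Union>i. ?D i) = ?r -` (\<Union>i. B i) \<inter> space (borel_PiM H)" by auto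
    also have "\<dots> = cylinder_lift (coords J -` (\<Union>i. B i))"
      using B(1) by (intro cylinder_lift_eq[OF J, symmetric]) auto
    also have "coords J -` (\<Union>i. B i) = (\<Union>i. C i)" by (auto simp: B(2))
    finally show "(\<Sum>i. ?\<mu> (C i)) = ?\<mu> (\<Union>i. C i)" .
  qed
  show ?thesis
    unfolding cylindrical_probability_def
  proof (intro conjI allI impI UNIV)
    show "additive (cylinder_sets UNIV) ?\<mu>"
      unfolding additive_def
    proof (intro ballI impI)
      fix C D :: "'z set"
      assume CD: "C \<in> cylinder_sets UNIV" "D \<in> cylinder_sets UNIV" "C \<inter> D = {}"
      obtain I where I: "finite I" "I \<subseteq> H" "C \<in> sets (coord_algebra I)"
        using cylinder_over_basis[OF CD(1)] .
      obtain J where J: "finite J" "J \<subseteq> H" "D \<in> sets (coord_algebra J)"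
        using cylinder_over_basis[OF CD(2)] .
      let ?L = "I \<union> J"
      have L: "finite ?L" "?L \<subseteq> H" "C \<in> sets (coord_algebra ?L)" "D \<in> sets (coord_algebra ?L)"
        using I J sets_coord_algebra_mono[of I ?L] sets_coord_algebra_mono[of J ?L] by auto
      have "additive (sets (coord_algebra ?L)) ?\<mu>"
      proof (rule ring_of_sets.countably_additive_additive[OF _ _ ca[OF L(1,2)]])
        show "ring_of_sets UNIV (sets (coord_algebra ?L))"
          using sets.ring_of_sets_axioms[of "coord_algebra ?L"] by simp
        show "positive (sets (coord_algebra ?L)) ?\<mu>"
          using empty by (simp add: positive_def)
      qed
      then show "?\<mu> (C \<union> D) = ?\<mu> C + ?\<mu> D"
        by (rule additiveD[OF _ CD(3) L(3,4)])
    qed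
    fix k u assume u: "continuous_linear_on UNIV (Rn k) (u :: 'z \<Rightarrow> _)"
    obtain J \<beta> where J: "finite J" "J \<subseteq> H" "\<beta> \<in> borel_PiM J \<rightarrow>\<^sub>M borel_Rn k" "u = \<beta> \<circ> coords J"
      using factor_through_basis[OF u] .
    have u_meas: "u \<in> coord_algebra J \<rightarrow>\<^sub>M borel_Rn k"
        unfolding J(4) comp_def by (rule measurable_compose[OF measurable_coords J(3)])
    show "countably_additive (sets (borel_Rn k)) (image_set_function UNIV u ?\<mu>)"
    proof (rule countably_additiveI)
      fix B :: "nat \<Rightarrow> (nat \<Rightarrow> real) set"
      assume B: "range B \<subseteq> sets (borel_Rn k)" "disjoint_family B"
      have r: "range (\<lambda>i. u -` B i) \<subseteq> sets (coord_algebra J)"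
        using measurable_sets[OF u_meas range_subsetD[OF B(1)]] by auto
      moreover have "disjoint_family (\<lambda>i. u -` B i)"
        using B(2) unfolding disjoint_family_on_def by blast
      ultimately have "(\<Sum>i. ?\<mu> (u -` B i)) = ?\<mu> (\<Union>i. u -` B i)"
        using ca[OF J(1,2)] sets.countable_nat_UN[OF r] unfolding countably_additive_def by blast
      then show "(\<Sum>i. image_set_function UNIV u ?\<mu> (B i)) = image_set_function UNIV u ?\<mu> (\<Union>i. B i)"
        by (simp add: image_set_function_def vimage_UN)
    qed
  qed
qed

end

section \<open>The joint extension\<close>

lemma emeasure_Times_null_eq:
  assumes M: "sets M = sets (completion Q0 \<Otimes>\<^sub>M N)" and N': "N' \<in> null_sets Q0"
    and null: "emeasure M (N' \<times> space N) = 0"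
    and S: "S \<in> sets Q0" and A: "A = S \<union> N1" "N1 \<subseteq> N'" "A \<in> sets (completion Q0)" and E: "E \<in> sets N"
  shows "emeasure M (A \<times> E) = emeasure M (S \<times> E)"
proof (rule antisym)
  have s: "S \<times> E \<in> sets M" "N' \<times> space N \<in> sets M" "A \<times> E \<in> sets M"
    unfolding M using S N' A E by auto
  have "emeasure M (A \<times> E) \<le> emeasure M (S \<times> E \<union> N' \<times> space N)"
    using s A(1,2) sets.sets_into_space[OF E] by (intro emeasure_mono sets.Un) auto
  also have "\<dots> \<le> emeasure M (S \<times> E) + emeasure M (N' \<times> space N)"
    using s by (intro emeasure_subadditive)
  finally show "emeasure M (A \<times> E) \<le> emeasure M (S \<times> E)" using null by simp
  show "emeasure M (S \<times> E) \<le> emeasure M (A \<times> E)"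
    using s A(1) by (intro emeasure_mono) auto
qed

lemma zero_Rn [simp]: "0 \<in> Rn n"
  by (simp add: Rn_iff)

lemma add_Rn: "x \<in> Rn n \<Longrightarrow> y \<in> Rn n \<Longrightarrow> x + y \<in> Rn n"
  by (simp add: Rn_iff)

text \<open>
  The map \<open>u\<close> that defines \<open>C\<close> and the identity of \<open>\<real>\<^sup>n\<close> are concatenated into one map with \<open>k + n\<close> coordinates.
\<close>

lemma Times_cylinder_set:
  fixes C :: "'y::{real_vector,topological_space} set"
  assumes C: "C \<in> cylinder_sets UNIV" and E: "E \<in> sets (borel_Rn n)"
  shows "C \<times> E \<in> cylinder_sets (UNIV \<times> Rn n)"
proof -
  obtain k u B where *: "k > 0" "continuous_linear_on UNIV (Rn k) u" "B \<in> sets (borel_Rn k)" "C = u -` B"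
    using C by (auto simp: cylinder_sets_def)
  have u: "\<And>y. u y \<in> Rn k" "\<And>x y. u (x + y) = u x + u y" "\<And>c x. u (c *\<^sub>R x) = c *\<^sub>R u x"
    "continuous_on UNIV u"
    using *(2) by (auto simp: continuous_linear_on_def)
  define w where "w = (\<lambda>(y, x) i. if i < k then u y i else if i < k + n then (x :: nat \<Rightarrow> real) (i - k) else 0)"
  define left where "left = (\<lambda>(v :: nat \<Rightarrow> real) i. if i < k then v i else 0)"
  define right where "right = (\<lambda>(v :: nat \<Rightarrow> real) i. if i < n then v (i + k) else 0)"
  have lw: "left (w (y, x)) = u y" for y x
    using u(1)[of y] by (auto simp: left_def w_def Rn_iff fun_eq_iff)
  have rw: "right (w (y, x)) = x" if "x \<in> Rn n" for y x
    using that by (auto simp: right_def w_def Rn_iff fun_eq_iff)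
  have left: "left \<in> borel_Rn (k + n) \<rightarrow>\<^sub>M borel_Rn k"
    unfolding measurable_borel_Rn_iff
  proof (intro conjI ballI allI)
    fix i show "(\<lambda>v. left v i) \<in> borel_measurable (borel_Rn (k + n))"
      by (cases "i < k") (simp_all add: left_def borel_measurable_component_Rn)
  qed (simp add: left_def Rn_iff)
  have right: "right \<in> borel_Rn (k + n) \<rightarrow>\<^sub>M borel_Rn n"
    unfolding measurable_borel_Rn_iff
  proof (intro conjI ballI allI)
    fix i show "(\<lambda>v. right v i) \<in> borel_measurable (borel_Rn (k + n))"
      by (cases "i < n") (simp_all add: right_def borel_measurable_component_Rn)
  qed (simp add: right_def Rn_iff)
  have "continuous_linear_on (UNIV \<times> Rn n) (Rn (k + n)) w"
    unfolding continuous_linear_on_def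
  proof (intro conjI)
    show "w ` (UNIV \<times> Rn n) \<subseteq> Rn (k + n)"
      by (auto simp: w_def Rn_iff)
    have "continuous_on (UNIV \<times> Rn n) (\<lambda>p. w p i)" for i
    proof -
      have "continuous_on UNIV (\<lambda>y. u y i)"
        using u(4) by (rule continuous_on_product_then_coordinatewise)
      from continuous_on_compose2[OF this continuous_on_fst[OF continuous_on_id]]
      have 1: "continuous_on (UNIV \<times> Rn n) (\<lambda>p. u (fst p) i)" by simp
      have "continuous_on UNIV (\<lambda>x :: nat \<Rightarrow> real. x (i - k))" by simp
      from continuous_on_compose2[OF this continuous_on_snd[OF continuous_on_id]]
      have 2: "continuous_on (UNIV \<times> Rn n) (\<lambda>p :: 'y \<times> (nat \<Rightarrow> real). snd p (i - k))" by simp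
      show ?thesis
        using 1 2 by (cases "i < k"; cases "i < k + n") (simp_all add: w_def split_beta')
    qed
    then show "continuous_on (UNIV \<times> Rn n) w"
      by (rule continuous_on_coordinatewise_then_product)
  qed (auto simp: w_def u fun_eq_iff scaleR_fun_def)
  moreover have "left -` B \<inter> right -` E \<inter> Rn (k + n) \<in> sets (borel_Rn (k + n))"
    using sets.Int[OF measurable_sets[OF left *(3)] measurable_sets[OF right E]]
    by (simp add: Int_assoc Int_left_commute Int_commute)
  moreover have "C \<times> E = w -` (left -` B \<inter> right -` E \<inter> Rn (k + n)) \<inter> (UNIV \<times> Rn n)"
    using sets.sets_into_space[OF E] rw lw *(4) by (auto simp: w_def Rn_iff)
  ultimately show ?thesis
    unfolding cylinder_sets_def mem_Collect_eq using *(1)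
    by (intro exI[of _ "k + n"] exI[of _ w] exI[of _ "left -` B \<inter> right -` E \<inter> Rn (k + n)"]) simp
qed

context cylindrical_product
begin

text \<open>
  Rectangles with a cylinder set as first factor are cylinder sets and generate the product of the
  uncompleted sigma-algebra with the Borel sets.  A set of the completion differs from a set of the
  uncompleted sigma-algebra by a subset of a null set, and this difference is negligible for both
  measures since their marginals on \<open>Y\<close> agree.
\<close>

lemma joint_extension_unique:
  assumes M1: "sets M1 = sets (completion Q0 \<Otimes>\<^sub>M borel_Rn n)"
    and M2: "sets M2 = sets (completion Q0 \<Otimes>\<^sub>M borel_Rn n)"
    and eq: "\<And>C. C \<in> cylinder_sets (UNIV \<times> Rn n) \<Longrightarrow> emeasure M1 C = emeasure M2 C"
    and fin: "finite_measure M1"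
    and marginal: "\<And>N'. N' \<in> null_sets Q0 \<Longrightarrow> emeasure M1 (N' \<times> Rn n) = 0"
  shows "M1 = M2"
proof -
  interpret M1: finite_measure M1 by fact
  let ?N = "borel_Rn n"
  have id: "(\<lambda>x. x) \<in> M \<rightarrow>\<^sub>M Q0 \<Otimes>\<^sub>M ?N" if M: "sets M = sets (completion Q0 \<Otimes>\<^sub>M ?N)" for M
  proof -
    have "(\<lambda>x. (fst x, snd x)) \<in> completion Q0 \<Otimes>\<^sub>M ?N \<rightarrow>\<^sub>M Q0 \<Otimes>\<^sub>M ?N"
      by (intro measurable_Pair measurable_snd measurable_compose[OF measurable_fst measurable_completion])
        simp
    then show ?thesis by (simp add: measurable_cong_sets[OF M refl])
  qed
  have spM: "space M1 = UNIV \<times> Rn n" "space M2 = UNIV \<times> Rn n"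
    using sets_eq_imp_space_eq[OF M1] sets_eq_imp_space_eq[OF M2] by (simp_all add: space_pair_measure)
  let ?G = "{C \<times> E |C E. C \<in> cylinder_sets (UNIV :: 'y set) \<and> E \<in> sets ?N}"
  interpret cyl: algebra UNIV "cylinder_sets (UNIV :: 'y set)" by (rule algebra_cylinder_sets)
  have sG: "sets (Q0 \<Otimes>\<^sub>M ?N) = sigma_sets (UNIV \<times> Rn n) ?G"
  proof -
    have "sets (Q0 \<Otimes>\<^sub>M ?N) = sets (sigma (space Q0 \<times> space ?N) ?G)"
    proof (rule sets_pair_eq)
      show "{UNIV} \<subseteq> cylinder_sets (UNIV :: 'y set)" using cyl.top by simp
      show "{Rn n} \<subseteq> sets ?N" using sets.top[of ?N] by simp
      show "sets ?N = sigma_sets (space ?N) (sets ?N)" by (rule sets.sigma_sets_eq[symmetric])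
      show "sets ?N \<subseteq> Pow (space ?N)" by (rule sets.space_closed)
    qed (simp_all add: sets_Q0)
    moreover have "?G \<subseteq> Pow (space Q0 \<times> space ?N)"
      using sets.sets_into_space[of _ ?N] by auto
    ultimately show ?thesis by simp
  qed
  have "distr M1 (Q0 \<Otimes>\<^sub>M ?N) (\<lambda>x. x) = distr M2 (Q0 \<Otimes>\<^sub>M ?N) (\<lambda>x. x)"
  proof (rule measure_eqI_generator_eq[of ?G "UNIV \<times> Rn n"])
    show "Int_stable ?G"
      unfolding Int_stable_def
    proof (intro ballI)
      fix a b assume "a \<in> ?G" "b \<in> ?G"
      then obtain C E C' E' where ab: "a = C \<times> E" "b = C' \<times> E'" "C \<in> cylinder_sets UNIV"
        "C' \<in> cylinder_sets UNIV" "E \<in> sets ?N" "E' \<in> sets ?N" by blast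
      have "a \<inter> b = (C \<inter> C') \<times> (E \<inter> E')" using ab by auto
      moreover have "C \<inter> C' \<in> cylinder_sets UNIV" "E \<inter> E' \<in> sets ?N" using ab by auto
      ultimately show "a \<inter> b \<in> ?G" by blast
    qed
    show "?G \<subseteq> Pow (UNIV \<times> Rn n)" using sets.sets_into_space[of _ ?N] by auto
    show "sets (distr M1 (Q0 \<Otimes>\<^sub>M ?N) (\<lambda>x. x)) = sigma_sets (UNIV \<times> Rn n) ?G"
      "sets (distr M2 (Q0 \<Otimes>\<^sub>M ?N) (\<lambda>x. x)) = sigma_sets (UNIV \<times> Rn n) ?G"
      using sG by simp_all
    show "range (\<lambda>_::nat. UNIV \<times> Rn n) \<subseteq> ?G" using cyl.top sets.top[of ?N] by auto
    fix X assume X: "X \<in> ?G"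
    then obtain C E where "X = C \<times> E" "C \<in> cylinder_sets UNIV" "E \<in> sets ?N" by blast
    then have Xc: "X \<in> cylinder_sets (UNIV \<times> Rn n)" using Times_cylinder_set by simp
    have Xs: "X \<in> sets (Q0 \<Otimes>\<^sub>M ?N)" unfolding sG using X by (rule sigma_sets.Basic)
    have "X \<inter> (UNIV \<times> Rn n) = X" using X sets.sets_into_space[of _ ?N] by auto
    then show "emeasure (distr M1 (Q0 \<Otimes>\<^sub>M ?N) (\<lambda>x. x)) X = emeasure (distr M2 (Q0 \<Otimes>\<^sub>M ?N) (\<lambda>x. x)) X"
      using Xs eq[OF Xc] by (simp add: emeasure_distr id M1 M2 spM)
  next
    fix i :: nat
    have "UNIV \<times> Rn n \<in> sets (Q0 \<Otimes>\<^sub>M ?N)"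
      using sets.top[of "Q0 \<Otimes>\<^sub>M ?N"] by (simp add: space_pair_measure)
    then show "emeasure (distr M1 (Q0 \<Otimes>\<^sub>M ?N) (\<lambda>x. x)) (UNIV \<times> Rn n) \<noteq> \<infinity>"
      by (simp add: emeasure_distr id M1 spM)
  qed auto
  then have eq0: "emeasure M1 X = emeasure M2 X" if "X \<in> sets (Q0 \<Otimes>\<^sub>M ?N)" for X
  proof -
    have "X \<inter> (UNIV \<times> Rn n) = X"
      using sets.sets_into_space[OF that] by (auto simp: space_pair_measure)
    then show ?thesis
      using arg_cong[OF \<open>distr M1 _ _ = distr M2 _ _\<close>, of "\<lambda>M. emeasure M X"] that
      by (simp add: emeasure_distr id M1 M2 spM)
  qed
  show ?thesis
  proof (rule measure_eqI_generator_eq[OF Int_stable_pair_measure_generator pair_measure_closed])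
    show "sets M1 = sigma_sets (space (completion Q0) \<times> space ?N)
        {a \<times> b |a b. a \<in> sets (completion Q0) \<and> b \<in> sets ?N}"
      "sets M2 = sigma_sets (space (completion Q0) \<times> space ?N)
        {a \<times> b |a b. a \<in> sets (completion Q0) \<and> b \<in> sets ?N}"
      unfolding M1 M2 by (rule sets_pair_measure)+
    fix X assume "X \<in> {a \<times> b |a b. a \<in> sets (completion Q0) \<and> b \<in> sets ?N}"
    then obtain A E where X: "X = A \<times> E" "A \<in> sets (completion Q0)" "E \<in> sets ?N" by blast
    obtain S N1 N' where A: "A = S \<union> N1" "N1 \<subseteq> N'" "N' \<in> null_sets Q0" "S \<in> sets Q0"
      using sets_completionE[OF X(2)] by blast
    have "N' \<times> Rn n \<in> sets (Q0 \<Otimes>\<^sub>M ?N)"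
      using A(3) sets.top[of ?N] by auto
    then have null: "emeasure M1 (N' \<times> space ?N) = 0" "emeasure M2 (N' \<times> space ?N) = 0"
      using marginal[OF A(3)] eq0[of "N' \<times> Rn n"] by simp_all
    have "emeasure M1 X = emeasure M1 (S \<times> E)"
      unfolding X(1) by (rule emeasure_Times_null_eq[OF M1 A(3) null(1) A(4,1,2) X(2,3)])
    also have "\<dots> = emeasure M2 (S \<times> E)"
      using A(4) X(3) by (intro eq0) auto
    also have "\<dots> = emeasure M2 X"
      unfolding X(1) by (rule emeasure_Times_null_eq[OF M2 A(3) null(2) A(4,1,2) X(2,3), symmetric])
    finally show "emeasure M1 X = emeasure M2 X" .
  next
    show "range (\<lambda>_::nat. UNIV \<times> Rn n) \<subseteq> {a \<times> b |a b. a \<in> sets (completion Q0) \<and> b \<in> sets ?N}"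
      using sets.top[of "completion Q0"] sets.top[of ?N] by auto
  qed auto
qed

text \<open>
  The law of \<open>(y, \<beta> \<omega>)\<close>, with \<open>\<omega>\<close> drawn from \<open>\<kappa> y\<close>, is the joint extension.  A linear map on
  \<open>Y \<times> \<real>\<^sup>n\<close> is the sum of its restrictions to the two factors, so a cylinder set is a condition on
  finitely many functionals of \<open>y\<close> and on \<open>\<omega>\<close>, to which \<open>joint_law\<close> applies.
\<close>

lemma joint_extension_Times:
  assumes J: "finite J" "J \<subseteq> dual" and \<kappa>: "disintegrates J \<kappa>"
    and \<beta>: "\<beta> \<in> borel_PiM J \<rightarrow>\<^sub>M borel_Rn n" and b: "continuous_linear_on UNIV (Rn n) b" "b = \<beta> \<circ> coords J"
    and F: "F \<in> sets (completion Q0)" and E: "E \<in> sets (borel_Rn n)"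
  shows "emeasure (joint_extension (completion Q0) n (image_set_function UNIV (map_prod id b) m)) (F \<times> E) =
    (\<integral>\<^sup>+y\<in>F. emeasure (\<kappa> y) (\<beta> -` E \<inter> space (borel_PiM J)) \<partial>completion Q0)"
proof -
  let ?N = "borel_Rn n" and ?Q = "completion Q0" and ?\<mu> = "image_set_function UNIV (map_prod id b) m"
  have prob_Q: "prob_space ?Q"
    using prob_space.emeasure_space_1[OF prob_Q0] sets.top[of Q0] by (intro prob_spaceI) simp
  note \<kappa>m = disintegrates_measurable[OF \<kappa>]
  define \<rho> where "\<rho> y = distr (\<kappa> y) ?N \<beta>" for y
  have "\<rho> \<in> Q0 \<rightarrow>\<^sub>M prob_algebra ?N"
    unfolding \<rho>_def by (rule measurable_compose[OF \<kappa>m measurable_distr_prob_space[OF \<beta>]])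
  then have \<rho>: "\<rho> \<in> ?Q \<rightarrow>\<^sub>M prob_algebra ?N" by (rule measurable_completion)
  have \<beta>\<kappa>: "\<beta> \<in> \<kappa> y \<rightarrow>\<^sub>M ?N" for y
    using \<beta> prob_algebra_kernelD(2)[OF \<kappa>m, of y] by (simp cong: measurable_cong_sets)
  have sp\<kappa>: "space (\<kappa> y) = space (borel_PiM J)" for y
    using prob_algebra_kernelD(3)[OF \<kappa>m, of y] by simp
  have \<rho>_E: "emeasure (\<rho> y) X = emeasure (\<kappa> y) (\<beta> -` X \<inter> space (borel_PiM J))" if "X \<in> sets ?N" for y X
    unfolding \<rho>_def emeasure_distr[OF \<beta>\<kappa> that] sp\<kappa> ..
  define M where "M = kernel_product ?Q ?N \<rho>"
  have sM: "sets M = sets (?Q \<Otimes>\<^sub>M ?N)"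
    unfolding M_def by (rule sets_kernel_product[OF prob_Q \<rho>])
  have M_Times: "emeasure M (A \<times> X) = (\<integral>\<^sup>+y\<in>A. emeasure (\<rho> y) X \<partial>?Q)"
    if "A \<in> sets ?Q" "X \<in> sets ?N" for A X
  proof -
    have "A \<times> X \<in> sets (?Q \<Otimes>\<^sub>M ?N)" using that by (rule pair_measureI)
    from emeasure_kernel_product[OF prob_Q \<rho> this] show ?thesis
      unfolding M_def by (auto simp: indicator_def intro!: nn_integral_cong)
  qed
  have M_cyl: "emeasure M C = ?\<mu> C" if C: "C \<in> cylinder_sets (UNIV \<times> Rn n)" for C
  proof -
    obtain k w B where w: "continuous_linear_on (UNIV \<times> Rn n) (Rn k) w" "B \<in> sets (borel_Rn k)"
      "C = w -` B \<inter> (UNIV \<times> Rn n)"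
      using C by (auto simp: cylinder_sets_def)
    have w_add: "w (p + q) = w p + w q" if "p \<in> UNIV \<times> Rn n" "q \<in> UNIV \<times> Rn n" for p q
      using w(1) that unfolding continuous_linear_on_def by blast
    have w_scale: "w (c *\<^sub>R p) = c *\<^sub>R w p" if "p \<in> UNIV \<times> Rn n" for p c
      using w(1) that unfolding continuous_linear_on_def by blast
    have w_Rn: "w p \<in> Rn k" if "p \<in> UNIV \<times> Rn n" for p
      using w(1) that unfolding continuous_linear_on_def by blast
    have w_cont: "continuous_on (UNIV \<times> Rn n) w"
      using w(1) unfolding continuous_linear_on_def by blast
    define u where "u y = w (y, 0)" for y
    define v where "v x = w (0, x)" for x
    have w_split: "w (y, x) = u y + v x" if "x \<in> Rn n" for y x
      using w_add[of "(y, 0)" "(0, x)"] that by (simp add: u_def v_def)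
    have u: "continuous_linear_on UNIV (Rn k) u"
      unfolding continuous_linear_on_def
    proof (intro conjI ballI allI)
      show "u ` UNIV \<subseteq> Rn k" using w_Rn by (auto simp: u_def)
      show "continuous_on UNIV u"
        unfolding u_def
        by (rule continuous_on_compose2[OF w_cont]) (auto intro!: continuous_on_Pair continuous_on_id continuous_on_const)
      show "u (x + y) = u x + u y" for x y
        using w_add[of "(x, 0)" "(y, 0)"] by (simp add: u_def)
      show "u (c *\<^sub>R x) = c *\<^sub>R u x" for c x
        using w_scale[of "(x, 0)" c] by (simp add: u_def)
    qed
    have v: "v \<in> ?N \<rightarrow>\<^sub>M borel_Rn k"
      unfolding measurable_borel_Rn_iff
    proof (intro conjI ballI allI)
      show "v x \<in> Rn k" if "x \<in> space ?N" for x
        using w_Rn that by (simp add: v_def)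
      fix i
      have "continuous_on (Rn n) v"
        unfolding v_def
        by (rule continuous_on_compose2[OF w_cont]) (auto intro!: continuous_on_Pair continuous_on_id continuous_on_const)
      then have "continuous_on (Rn n) (\<lambda>x. v x i)"
        by (rule continuous_on_product_then_coordinatewise)
      then show "(\<lambda>x. v x i) \<in> borel_measurable ?N"
        unfolding borel_Rn_def by (rule borel_measurable_continuous_on_restrict)
    qed
    define I where "I = (\<lambda>i x. u x i) ` {..<k}"
    have I: "finite I" "I \<subseteq> dual"
      using u by (auto simp: I_def continuous_linear_on_Rn_iff)
    define \<upsilon> where "\<upsilon> a i = (if i < k then a (\<lambda>x. u x i) else 0)" for a :: "('y \<Rightarrow> real) \<Rightarrow> real" and i
    have \<upsilon>: "\<upsilon> (coords I y) = u y" for y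
      using u by (auto simp: \<upsilon>_def coords_def I_def fun_eq_iff continuous_linear_on_Rn_iff Rn_iff)
    have \<upsilon>_meas: "(\<lambda>a. \<upsilon> a i) \<in> borel_measurable (borel_PiM I)" for i
    proof (cases "i < k")
      case True
      then have "(\<lambda>x. u x i) \<in> I" by (auto simp: I_def)
      then show ?thesis using True by (simp add: \<upsilon>_def)
    qed (simp add: \<upsilon>_def)
    have u_meas: "(\<lambda>y. u y i) \<in> borel_measurable ?Q" for i
      using u by (intro measurable_completion dual_measurable_Q0) (simp add: continuous_linear_on_Rn_iff)
    have comp: "(\<lambda>x. f x i) \<in> borel_measurable M'" if "f \<in> M' \<rightarrow>\<^sub>M borel_Rn k" for f i and M' :: "'b measure"
      using that by (simp add: measurable_borel_Rn_iff)
    have v_in: "v x \<in> Rn k" if "x \<in> Rn n" for x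
      using w_Rn that by (simp add: v_def)
    have u_in: "u y \<in> Rn k" for y using u by (simp add: continuous_linear_on_Rn_iff)
    have wQ: "(\<lambda>p. u (fst p) + v (snd p)) \<in> ?Q \<Otimes>\<^sub>M ?N \<rightarrow>\<^sub>M borel_Rn k"
      unfolding measurable_borel_Rn_iff
    proof (intro conjI ballI allI)
      show "u (fst p) + v (snd p) \<in> Rn k" if "p \<in> space (?Q \<Otimes>\<^sub>M ?N)" for p
        using that u_in v_in by (auto simp: space_pair_measure intro!: add_Rn)
      show "(\<lambda>p. (u (fst p) + v (snd p)) i) \<in> borel_measurable (?Q \<Otimes>\<^sub>M ?N)" for i
        unfolding plus_fun_apply
        by (intro borel_measurable_add measurable_compose[OF measurable_fst u_meas]
            measurable_compose[OF measurable_snd comp[OF v]])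
    qed
    have C_eq: "C = {p. u (fst p) + v (snd p) \<in> B \<and> snd p \<in> Rn n}"
      using w_split by (auto simp: w(3))
    have "C = (\<lambda>p. u (fst p) + v (snd p)) -` B \<inter> space (?Q \<Otimes>\<^sub>M ?N)"
      unfolding C_eq by (auto simp: space_pair_measure)
    then have Cs: "C \<in> sets (?Q \<Otimes>\<^sub>M ?N)"
      using measurable_sets[OF wQ w(2)] by simp
    define D where "D = (\<lambda>p. \<upsilon> (fst p) + v (\<beta> (snd p))) -` B \<inter> space (borel_PiM I \<Otimes>\<^sub>M borel_PiM J)"
    have D: "D \<in> sets (borel_PiM I \<Otimes>\<^sub>M borel_PiM J)"
      unfolding D_def
    proof (rule measurable_sets[OF _ w(2)])
      show "(\<lambda>p. \<upsilon> (fst p) + v (\<beta> (snd p))) \<in> borel_PiM I \<Otimes>\<^sub>M borel_PiM J \<rightarrow>\<^sub>M borel_Rn k"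
        unfolding measurable_borel_Rn_iff
      proof (intro conjI ballI allI)
        show "\<upsilon> (fst p) + v (\<beta> (snd p)) \<in> Rn k" if "p \<in> space (borel_PiM I \<Otimes>\<^sub>M borel_PiM J)" for p
        proof (rule add_Rn)
          show "\<upsilon> (fst p) \<in> Rn k" by (simp add: \<upsilon>_def Rn_iff)
          show "v (\<beta> (snd p)) \<in> Rn k"
            using that measurable_space[OF \<beta>] by (auto simp: space_pair_measure intro!: v_in)
        qed
        show "(\<lambda>p. (\<upsilon> (fst p) + v (\<beta> (snd p))) i) \<in> borel_measurable (borel_PiM I \<Otimes>\<^sub>M borel_PiM J)" for i
          unfolding plus_fun_apply
          by (intro borel_measurable_add measurable_compose[OF measurable_fst \<upsilon>_meas]
              measurable_compose[OF measurable_snd measurable_compose[OF \<beta> comp[OF v]]])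
      qed
    qed
    have "emeasure M C = (\<integral>\<^sup>+y. emeasure (\<rho> y) (Pair y -` C) \<partial>?Q)"
      unfolding M_def by (rule emeasure_kernel_product[OF prob_Q \<rho> Cs])
    also have "\<dots> = (\<integral>\<^sup>+y. emeasure (\<kappa> y) (Pair (coords I y) -` D) \<partial>?Q)"
    proof (rule nn_integral_cong)
      fix y
      have "Pair y -` C \<in> sets ?N" by (rule sets_Pair1[OF Cs])
      moreover have "\<beta> -` (Pair y -` C) \<inter> space (borel_PiM J) = Pair (coords I y) -` D"
        using measurable_space[OF \<beta>] by (auto simp: C_eq D_def \<upsilon> space_pair_measure coords_in_space)
      ultimately show "emeasure (\<rho> y) (Pair y -` C) = emeasure (\<kappa> y) (Pair (coords I y) -` D)"
        by (simp add: \<rho>_E)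
    qed
    also have "\<dots> = (\<integral>\<^sup>+y. emeasure (\<kappa> y) (Pair (coords I y) -` D) \<partial>Q0)"
      by (rule nn_integral_completion)
    also have "\<dots> = m {x. (coords I (fst x), coords J (snd x)) \<in> D}"
      by (rule joint_law[OF I J \<kappa> D])
    also have "{x. (coords I (fst x), coords J (snd x)) \<in> D} = map_prod id b -` C"
      using measurable_space[OF \<beta> coords_in_space[of J]]
      by (auto simp: D_def C_eq \<upsilon> b(2) space_pair_measure coords_in_space)
    finally show ?thesis by (simp add: image_set_function_def)
  qed
  have "joint_extension ?Q n ?\<mu> = M"
    unfolding joint_extension_def measure_extension_def
  proof (rule the_equality)
    show "sets M = sets (?Q \<Otimes>\<^sub>M ?N) \<and> (\<forall>C\<in>cylinder_sets (UNIV \<times> Rn n). emeasure M C = ?\<mu> C)"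
      using sM M_cyl by blast
    fix M' assume M': "sets M' = sets (?Q \<Otimes>\<^sub>M ?N) \<and> (\<forall>C\<in>cylinder_sets (UNIV \<times> Rn n). emeasure M' C = ?\<mu> C)"
    have "M = M'"
    proof (rule joint_extension_unique[OF sM])
      show "finite_measure M"
        unfolding M_def by (rule prob_space.finite_measure[OF prob_space_kernel_product[OF prob_Q \<rho>]])
      fix N' assume N': "N' \<in> null_sets Q0"
      have "emeasure M (N' \<times> Rn n) = (\<integral>\<^sup>+y\<in>N'. emeasure (\<rho> y) (Rn n) \<partial>?Q)"
        using N' sets.top[of ?N] by (intro M_Times) auto
      also have "\<dots> = (\<integral>\<^sup>+y. 0 \<partial>?Q)"
        using AE_completion[OF AE_not_in[OF N']] by (intro nn_integral_cong_AE) (auto elim: eventually_mono)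
      finally show "emeasure M (N' \<times> Rn n) = 0" by simp
    qed (use M' M_cyl in auto)
    then show "M' = M" ..
  qed
  then show ?thesis
    using M_Times[OF F E] by (simp add: \<rho>_E[OF E])
qed

end

section \<open>Disintegration of a cylindrical probability\<close>

theorem theorem2:
  fixes m :: "('y::locally_convex_space \<times> 'z::locally_convex_space) set \<Rightarrow> ennreal"
    and Q :: "'y measure"
  assumes "cylindrical_probability UNIV m"
    and "countably_additive (cylinder_sets UNIV) (image_set_function UNIV fst m)"
  defines "Q \<equiv> completed_extension (image_set_function UNIV fst m)"
  shows "\<exists>\<mu> :: 'y \<Rightarrow> 'z set \<Rightarrow> ennreal.
    (\<forall>y. cylindrical_probability UNIV (\<mu> y)) \<and>
    (\<forall>n>0. \<forall>b. continuous_linear_on UNIV (Rn n) b \<longrightarrow>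
      (\<forall>E\<in>sets (borel_Rn n).
        (\<lambda>y. image_set_function UNIV b (\<mu> y) E) \<in> borel_measurable Q \<and>
        (\<forall>F\<in>sets Q.
          emeasure (joint_extension Q n (image_set_function UNIV (map_prod id b) m)) (F \<times> E) =
          (\<integral>\<^sup>+ y\<in>F. image_set_function UNIV b (\<mu> y) E \<partial>Q))))"
proof -
  let ?m1 = "image_set_function UNIV fst m"
  define Q0 :: "'y measure"
    where "Q0 = measure_extension (sigma UNIV (cylinder_sets UNIV)) (cylinder_sets UNIV) ?m1"
  have Q: "Q = completion Q0"
    unfolding Q_def Q0_def completed_extension_def ..
  have pos: "positive (cylinder_sets UNIV) ?m1"
    using cylindrical_probability_empty[OF assms(1)] by (simp add: positive_def image_set_function_def)
  have total: "?m1 UNIV = 1"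
    using assms(1) by (simp add: image_set_function_def cylindrical_probability_def)
  note ext = measure_extension_from_algebra[OF algebra_cylinder_sets pos assms(2) total, folded Q0_def]
  interpret cylindrical_product m Q0
  proof (rule cylindrical_product.intro)
    show "emeasure Q0 C = m (fst -` C)" if "C \<in> cylinder_sets UNIV" for C
      using ext(2)[OF that] by (simp add: image_set_function_def)
  qed (rule assms(1) ext(1,3))+
  obtain H :: "('z \<Rightarrow> real) set" where H: "H \<subseteq> dual" "independent H" "dual \<subseteq> span H"
    using maximal_independent_subset[of dual] by blast
  interpret dual_basis H by standard (fact H)+
  obtain K where K: "K \<in> Q0 \<rightarrow>\<^sub>M prob_algebra (borel_PiM H)"
    "\<And>J. finite J \<Longrightarrow> J \<subseteq> H \<Longrightarrow> disintegrates J (\<lambda>y. distr (K y) (borel_PiM J) (\<lambda>\<omega>. restrict \<omega> J))"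
    using exists_disintegration[OF H(1)] by blast
  define \<mu> where "\<mu> y C = emeasure (K y) (cylinder_lift C)" for y C
  have K': "prob_space (K y)" "sets (K y) = sets (borel_PiM H)" "space (K y) = space (borel_PiM H)" for y
    using prob_algebra_kernelD[OF K(1), of y] by auto
  have *: "(\<lambda>y. image_set_function UNIV b (\<mu> y) E) \<in> borel_measurable Q \<and>
      (\<forall>F\<in>sets Q. emeasure (joint_extension Q n (image_set_function UNIV (map_prod id b) m)) (F \<times> E) =
        (\<integral>\<^sup>+ y\<in>F. image_set_function UNIV b (\<mu> y) E \<partial>Q))"
    if b: "continuous_linear_on UNIV (Rn n) b" and E: "E \<in> sets (borel_Rn n)" for n b E
  proof -
    obtain J \<beta> where J: "finite J" "J \<subseteq> H" and \<beta>: "\<beta> \<in> borel_PiM J \<rightarrow>\<^sub>M borel_Rn n" "b = \<beta> \<circ> coords J"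
      using factor_through_basis[OF b] .
    let ?\<kappa> = "\<lambda>y. distr (K y) (borel_PiM J) (\<lambda>\<omega>. restrict \<omega> J)"
    let ?B = "\<beta> -` E \<inter> space (borel_PiM J)"
    have B: "?B \<in> sets (borel_PiM J)" by (rule measurable_sets[OF \<beta>(1) E])
    have bE: "b -` E = coords J -` ?B"
      by (auto simp: \<beta>(2) coords_in_space)
    have r: "(\<lambda>\<omega>. restrict \<omega> J) \<in> K y \<rightarrow>\<^sub>M borel_PiM J" for y
      unfolding measurable_cong_sets[OF K'(2) refl] using J(2) by (rule measurable_restrict_subset)
    have \<mu>_eq: "image_set_function UNIV b (\<mu> y) E = emeasure (?\<kappa> y) ?B" for y
      unfolding image_set_function_def \<mu>_def bE Int_UNIV_right cylinder_lift_eq[OF J B]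
        emeasure_distr[OF r B] K'(3) ..
    have J_dual: "J \<subseteq> dual" using J(2) H(1) by blast
    have "(\<lambda>y. emeasure (?\<kappa> y) ?B) \<in> borel_measurable Q"
      unfolding Q
      by (intro measurable_completion measurable_emeasure_kernel[OF _ B] measurable_prob_algebraD
          disintegrates_measurable K(2) J)
    moreover have "emeasure (joint_extension Q n (image_set_function UNIV (map_prod id b) m)) (F \<times> E) =
        (\<integral>\<^sup>+ y\<in>F. emeasure (?\<kappa> y) ?B \<partial>Q)" if F: "F \<in> sets Q" for F
      unfolding Q
      by (rule joint_extension_Times[OF J(1) J_dual K(2)[OF J] \<beta>(1) b \<beta>(2) F[unfolded Q] E])
    ultimately show ?thesis unfolding \<mu>_eq by (intro conjI ballI)
  qed
  have "cylindrical_probability UNIV (\<mu> y)" for y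
    unfolding \<mu>_def by (rule cylindrical_probability_cylinder_lift[OF K'(1,2)])
  then show ?thesis
    by (intro exI[of _ \<mu>] conjI allI impI ballI) (use * in simp_all)
qed

end
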